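(* Let $p$ be an odd prime with $p\not\equiv 3\pmod 4$, let $\delta_p$ be an integer with $4\delta_p\equiv 1\pmod{p^2}$, and let $k,n\in\mathbb Z$ with $\left(\frac{k}{p}\right)=1$. Then $$N_{V_1}(p^2n+(pk+1)\delta_p)\equiv 0\pmod 4.$$
   Context: Let $(a;q)_n=\prod_{j=0}^{n-1}(1-aq^j)$. Define $N_{V_1}(n)$ by $V_1(q)=\sum_{n\ge0}N_{V_1}(n)q^n=\sum_{n\ge0}\frac{q^{(n+1)^2}(-q;q^2)_n}{(q;q^2)_{n+1}}$, with $N_{V_1}(m)=0$ for $m<0$. $\left(\frac{\cdot}{\cdot}\right)$ is the Kronecker symbol. *)

theory Defs
  imports
    "HOL-Number_Theory.Number_Theory"
    "HOL-Computational_Algebra.Formal_Power_Series"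
begin

definition qpoch :: "'a::comm_ring_1 \<Rightarrow> 'a \<Rightarrow> nat \<Rightarrow> 'a" where
  "qpoch a q n = (\<Prod>j<n. 1 - a * q ^ j)"

(* The type int fps has no division operator, so 1/(q; q^2)_(n+1) is written with
   fps_right_inverse, whose second argument is an inverse of the constant term (here 1);
   see V1_denominator_inverse. *)
definition V1_term :: "nat \<Rightarrow> int fps" where
  "V1_term n = fps_X ^ ((n + 1)\<^sup>2) * qpoch (- fps_X) (fps_X\<^sup>2) n
               * fps_right_inverse (qpoch fps_X (fps_X\<^sup>2) (n + 1)) 1"

(* The sum is the limit in the X-adic metric; see V1_sums and nth_V1. *)
definition V1 :: "int fps" where
  "V1 = (\<Sum>n. V1_term n)"

definition N_V1 :: "int \<Rightarrow> int" where
  "N_V1 m = (if m < 0 then 0 else fps_nth V1 (nat m))"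

lemma V1_denominator_inverse:
  "qpoch fps_X (fps_X\<^sup>2) n * fps_right_inverse (qpoch fps_X (fps_X\<^sup>2) n) 1 = (1 :: int fps)"
proof (rule fps_right_inverse)
  have "fps_nth (qpoch fps_X (fps_X\<^sup>2) n) 0 = (1 :: int)"
    unfolding qpoch_def by (induction n) simp_all
  thus "fps_nth (qpoch fps_X (fps_X\<^sup>2) n) 0 * 1 = (1 :: int)"
    by simp
qed

lemma nth_V1_term_eq_0:
  assumes "m < (n + 1)\<^sup>2"
  shows "fps_nth (V1_term n) m = 0"
  using assms by (simp only: V1_term_def mult.assoc fps_X_power_mult_nth if_True)

lemma V1_term_sums: "V1_term sums Abs_fps (\<lambda>m. \<Sum>n\<le>m. fps_nth (V1_term n) m)"
  unfolding sums_def
proof (rule tendsto_fpsI)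
  fix m
  have "fps_nth (\<Sum>n<N. V1_term n) m = (\<Sum>n\<le>m. fps_nth (V1_term n) m)" if "N > m" for N
  proof -
    have "fps_nth (V1_term n) m = 0" if "n > m" for n
      using that by (intro nth_V1_term_eq_0) (simp add: power2_eq_square)
    hence "(\<Sum>n<N. fps_nth (V1_term n) m) = (\<Sum>n\<le>m. fps_nth (V1_term n) m)"
      using that by (intro sum.mono_neutral_right) auto
    thus ?thesis by (simp add: fps_sum_nth)
  qed
  thus "\<forall>\<^sub>F N in sequentially. fps_nth (\<Sum>n<N. V1_term n) m =
          fps_nth (Abs_fps (\<lambda>m. \<Sum>n\<le>m. fps_nth (V1_term n) m)) m"
    by (intro eventually_mono[OF eventually_gt_at_top[of m]]) (simp only: fps_nth_Abs_fps)
qed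

lemma V1_sums: "V1_term sums V1"
  using V1_term_sums unfolding V1_def by (simp add: sums_iff)

lemma nth_V1: "fps_nth V1 m = (\<Sum>n\<le>m. fps_nth (V1_term n) m)"
  by (simp only: sums_unique2[OF V1_sums V1_term_sums] fps_nth_Abs_fps)

end

theory Submission
  imports Defs
begin

text \<open>
  Put \<open>M = 4N - 1\<close>. Since \<open>(1 + x)/(1 - x) = 1 + 2x/(1 - x)\<close>, modulo 4 the coefficient of \<open>q^N\<close>
  equals \<open>P + 2A\<close>, where \<open>P\<close> counts the factorisations \<open>M = a(a + 2w)\<close> and \<open>A\<close> counts the solutions
  of \<open>ab + 4cl = M\<close> with \<open>0 < c < a < b\<close> and \<open>c\<close> odd. A chain of involutions, in the style of
  Liouville, shows that for \<open>M\<close> not three times a square and \<open>P\<close> even, \<open>A\<close> has the parity of the number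
  \<open>U\<close> of solutions of \<open>tp + pq + qt = M\<close> in odd \<open>0 < t < p < q\<close>. These triples together with the
  factorisations are the reduced binary quadratic forms of discriminant \<open>- M\<close>: there are exactly
  \<open>2U + P\<close> of them. In the theorem \<open>M = pm\<close> with \<open>p \<equiv> 1 (mod 4)\<close> and \<open>m\<close> a quadratic residue mod
  \<open>p\<close>, and the class group of every order of discriminant \<open>- M/f\<^sup>2\<close> has order divisible by 4:
  if \<open>m/f\<^sup>2\<close> is not a prime power, the ambiguous classes give a Klein four-group; if it is a power of
  \<open>l\<close>, Legendre's equation \<open>pV\<^sup>2 + lU\<^sup>2 = W\<^sup>2\<close> is solvable and makes the ambiguous class a square.
\<close>

section \<open>Counting by involutions\<close>

text \<open>Modulo 4 only the parity of \<open>A\<close> matters, so involutions can replace exact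
  class number relations. The inequalities \<open>c < a < b\<close> are the obstacle: each change of
  variables preserves a quadratic form but moves the region, and every comparison of regions leaves
  solutions on its faces. On a face the form splits as \<open>a * (a + 2 * w)\<close>, so these
  solutions are factorisations of \<open>M\<close>; they cancel up to a congruence on the factors.
  One count, \<open>Wo\<close>, escapes such rearrangements and is evaluated by residues instead.
  What remains is the number of factorisations with \<open>w\<close> congruent to 1 or 7 modulo 8.
  This congruence is decided by \<open>M\<close> modulo 16, so the number is 0 or \<open>P\<close>:
  here an even \<open>P\<close> enters, which itself follows from \<open>4 dvd 2 * U + P\<close>. A
  factorisation with \<open>a = w\<close>, that is \<open>M = 3 * a * a\<close>, would spoil the
  count on the faces; it cannot occur because \<open>p > 3\<close> divides \<open>M\<close> exactly
  once. Reduced forms need not be primitive, which is why the orders of all discriminants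
  \<open>- M / f^2\<close> come in.\<close>

lemma even_card_involution:
  assumes "finite S" "\<And>x. x \<in> S \<Longrightarrow> f x \<in> S" "\<And>x. x \<in> S \<Longrightarrow> f (f x) = x"
    and "\<And>x. x \<in> S \<Longrightarrow> f x \<noteq> x"
  shows "even (card S)"
  using assms
proof (induction "card S" arbitrary: S rule: less_induct)
  case less
  show ?case
  proof (cases "S = {}")
    case False
    then obtain x where x: "x \<in> S" by blast
    let ?T = "S - {x, f x}"
    have fx: "f x \<in> S" "f x \<noteq> x" "f (f x) = x" using x less.prems by auto
    have c: "card S = card ?T + 2"
    proof -
      have "card {x, f x} \<le> card S" using x fx less.prems(1) by (intro card_mono) auto
      moreover have "card ?T = card S - card {x, f x}" using x fx by (intro card_Diff_subset) auto
      ultimately show ?thesis using fx by simp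
    qed
    have "even (card ?T)"
    proof (rule less.hyps)
      show "card ?T < card S" using c by simp
      show "finite ?T" using less.prems(1) by simp
      fix y assume y: "y \<in> ?T"
      hence yS: "y \<in> S" by simp
      have "f y \<noteq> x" using y less.prems(3)[OF yS] by auto
      moreover have "f y \<noteq> f x" using y less.prems(3)[OF yS] fx(3) by auto
      ultimately show "f y \<in> ?T" using less.prems(2)[OF yS] by simp
      show "f (f y) = y" "f y \<noteq> y" using less.prems yS by auto
    qed
    thus ?thesis using c by simp
  qed simp
qed

lemma even_card_fixpoints:
  assumes "finite S" "\<And>x. x \<in> S \<Longrightarrow> f x \<in> S" "\<And>x. x \<in> S \<Longrightarrow> f (f x) = x"
  shows "even (card S) \<longleftrightarrow> even (card {x \<in> S. f x = x})"
proof -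
  have "even (card {x \<in> S. f x \<noteq> x})"
    by (rule even_card_involution[where f = f]) (use assms in auto)
  moreover have "card S = card {x \<in> S. f x = x} + card {x \<in> S. f x \<noteq> x}"
    by (subst card_Un_disjoint[symmetric]) (use assms(1) in \<open>auto intro!: arg_cong[where f = card]\<close>)
  ultimately show ?thesis by simp
qed

lemma even_card_sym_diff:
  assumes "finite A" "finite B"
  shows "even (card A + card B) \<longleftrightarrow> even (card ((A - B) \<union> (B - A)))"
proof -
  have "card ((A - B) \<union> (B - A)) = card (A - B) + card (B - A)"
    by (rule card_Un_disjoint) (use assms in auto)
  moreover have "card A = card (A - B) + card (A \<inter> B)"
    using assms by (metis card_Diff_subset_Int card_Int_Diff add.commute finite_Int)
  moreover have "card B = card (B - A) + card (A \<inter> B)"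
    using assms by (metis card_Int_Diff add.commute Int_commute)
  ultimately show ?thesis by presburger
qed

text \<open>Modulo 2 only symmetric differences count. Two overlapping families can thus be traded
  for two others by a pointwise check, without describing any intersection.\<close>

lemma even_card_xor:
  assumes "finite A" "finite B" "finite C" "finite D"
    and "\<And>x. (x \<in> A \<longleftrightarrow> x \<in> B) \<longleftrightarrow> (x \<in> C \<longleftrightarrow> x \<in> D)"
  shows "even (card A + card B) \<longleftrightarrow> even (card C + card D)"
proof -
  have "(A - B) \<union> (B - A) = (C - D) \<union> (D - C)" using assms(5) by blast
  thus ?thesis
    using even_card_sym_diff[OF assms(1,2)] even_card_sym_diff[OF assms(3,4)] by metis
qed

lemma card_eq_by_inverse:
  assumes "\<And>x. x \<in> A \<Longrightarrow> f x \<in> B \<and> g (f x) = x" "\<And>y. y \<in> B \<Longrightarrow> g y \<in> A \<and> f (g y) = y"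
  shows "card A = card B"
  by (rule bij_betw_same_card[of f], rule bij_betw_byWitness[where f' = g]) (use assms in auto)

lemma finite_by_inverse:
  assumes "finite A" "\<And>y. y \<in> B \<Longrightarrow> g y \<in> A \<and> f (g y) = y"
  shows "finite B"
  by (rule finite_surj[OF assms(1), of _ f]) (use assms(2) in force)

lemma pos_factors_le:
  fixes a b :: int assumes "0 < a" "0 < b" shows "a \<le> a * b" "b \<le> a * b"
  using assms by (simp_all add: mult_le_cancel_left1 mult_le_cancel_right1)

lemma mod4_cases: "(a::int) mod 4 = 0 \<or> a mod 4 = 1 \<or> a mod 4 = 2 \<or> a mod 4 = 3"
  by presburger

lemma mult_mod4_eq3:
  fixes a b :: int assumes "a * b mod 4 = 3"
  shows "odd a" "odd b" "4 dvd a + b" "\<not> 4 dvd b - a"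
proof -
  have "(a mod 4) * (b mod 4) mod 4 = 3" using assms by (simp add: mod_mult_eq)
  hence "(a mod 4 = 1 \<and> b mod 4 = 3) \<or> (a mod 4 = 3 \<and> b mod 4 = 1)"
    using mod4_cases[of a] mod4_cases[of b] by auto
  thus "odd a" "odd b" "4 dvd a + b" "\<not> 4 dvd b - a" by presburger+
qed

locale three_mod_four =
  fixes M :: int
  assumes M_pos: "0 < M" and M_mod4: "M mod 4 = 3"
begin

definition Quad :: "(int \<times> int \<times> int \<times> int) set" where
  "Quad = {(a,b,c,l). 0 < c \<and> c < a \<and> a < b \<and> 0 < l \<and> a * b + 4 * c * l = M}"

text \<open>The image of the part \<open>8 dvd a + b - 4 * c\<close> of \<open>Quad\<close> under the substitution
  \<open>a = p + 2y\<close>, \<open>b = a + 2t\<close>, \<open>c = (p + t)/2\<close>, \<open>l = (q - p - 4y)/2\<close>; its section \<open>y = 0\<close> is \<open>Trip\<close>.\<close>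

definition QuadV :: "(int \<times> int \<times> int \<times> int) set" where
  "QuadV = {(t,p,q,y). odd t \<and> odd p \<and> odd q \<and> even y \<and> 0 < t \<and> 0 < p + t \<and>
     t < p + 4 * y \<and> p + 4 * y < q \<and> t * p + p * q + q * t + 4 * y * y = M}"

lemma Quad_mod4: "(a,b,c,l) \<in> Quad \<Longrightarrow> a * b mod 4 = 3"
proof -
  assume "(a,b,c,l) \<in> Quad"
  hence "a * b = M - 4 * (c * l)" by (auto simp: Quad_def)
  thus ?thesis using M_mod4 by presburger
qed

lemma finite_Quad: "finite Quad"
proof (rule finite_subset)
  show "Quad \<subseteq> {0..M} \<times> {0..M} \<times> {0..M} \<times> {0..M}"
  proof
    fix x assume "x \<in> Quad"
    then obtain a b c l where x: "x = (a,b,c,l)"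
      and h: "0 < c" "c < a" "a < b" "0 < l" "a * b + 4 * (c * l) = M" by (auto simp: Quad_def)
    have "0 < a * b" "0 < c * l" using h by simp_all
    moreover have "a \<le> a * b" "b \<le> a * b" "c \<le> c * l" "l \<le> c * l"
      using h pos_factors_le[of a b] pos_factors_le[of c l] by auto
    ultimately have "a \<le> M" "b \<le> M" "c \<le> M" "l \<le> M" using h(5) by linarith+
    thus "x \<in> {0..M} \<times> {0..M} \<times> {0..M} \<times> {0..M}" using h x by simp
  qed
qed auto

lemma finite_Quad': "finite {(a,b,c,l). (a,b,c,l) \<in> Quad \<and> Q a b c l}"
  by (rule finite_subset[OF _ finite_Quad]) auto

text \<open>Since \<open>a * b\<close> is 3 modulo 4, \<open>4 dvd a + b\<close>, and subtracting
  \<open>4 * c\<close> with odd \<open>c\<close> switches the residue of \<open>a + b\<close> modulo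
  8 between 0 and 4. So the tuples with odd \<open>c\<close> are the symmetric difference of two
  sets that admit ternary parametrisations.\<close>

lemma Quad_split:
  "even (card {(a,b,c,l) \<in> Quad. odd c} + card {(a,b,c,l) \<in> Quad. 8 dvd a + b - 4 * c}
      + card {(a,b,c,l) \<in> Quad. 8 dvd a + b})"
proof -
  have "{(a,b,c,l) \<in> Quad. odd c} =
     ({(a,b,c,l) \<in> Quad. 8 dvd a + b - 4 * c} - {(a,b,c,l) \<in> Quad. 8 dvd a + b}) \<union>
     ({(a,b,c,l) \<in> Quad. 8 dvd a + b} - {(a,b,c,l) \<in> Quad. 8 dvd a + b - 4 * c})"
  proof -
    have "odd c \<longleftrightarrow> (8 dvd a + b - 4 * c) \<noteq> (8 dvd a + b)" if "(a,b,c,l) \<in> Quad" for a b c l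
      using mult_mod4_eq3(3)[OF Quad_mod4[OF that]] by presburger
    thus ?thesis by auto
  qed
  hence "even (card {(a,b,c,l) \<in> Quad. 8 dvd a + b - 4 * c} + card {(a,b,c,l) \<in> Quad. 8 dvd a + b})
      = even (card {(a,b,c,l) \<in> Quad. odd c})"
    by (subst even_card_sym_diff[OF finite_Quad' finite_Quad']) simp
  thus ?thesis by auto
qed

text \<open>Divisibility by 8 is exactly evenness of \<open>y = (a + b) / 4 - c\<close>, and
  \<open>t = (b - a) / 2\<close> is odd because one of \<open>a\<close>, \<open>b\<close> is 1 and
  the other 3 modulo 4.\<close>

lemma card_QuadV: "card {(a,b,c,l) \<in> Quad. 8 dvd a + b - 4 * c} = card QuadV"
  and finite_QuadV: "finite QuadV"
proof -
  define f where "f = (\<lambda>(a::int,b::int,c::int,l::int).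
    ((b - a) div 2, 2 * c - (b - a) div 2, 2 * l + (2 * c - (b - a) div 2) + 4 * ((a + b) div 4 - c), (a + b) div 4 - c))"
  define g where "g = (\<lambda>(t::int,p::int,q::int,y::int).
    (p + 2 * y, p + 2 * y + 2 * t, (p + t) div 2, (q - p - 4 * y) div 2))"
  have 1: "f x \<in> QuadV \<and> g (f x) = x" if x: "x \<in> {(a,b,c,l) \<in> Quad. 8 dvd a + b - 4 * c}" for x
  proof -
    obtain a b c l where x': "x = (a,b,c,l)" and Q: "(a,b,c,l) \<in> Quad" and d: "8 dvd a + b - 4 * c"
      using x by auto
    note m = mult_mod4_eq3[OF Quad_mod4[OF Q]]
    obtain t where t: "b = a + 2 * t" "odd t"
    proof -
      have "even (b - a)" using m by simp
      then obtain t where t: "b - a = 2 * t" by (elim evenE)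
      hence "odd t" using m(4) by (auto elim!: evenE)
      thus ?thesis using t that[of t] by simp
    qed
    have "4 dvd 2 * a + 2 * t" using m(3) t by (simp add: algebra_simps)
    then obtain y where y: "a + t = 2 * (y + c)" "even y" 
    proof -
      have "8 dvd 2 * a + 2 * t - 4 * c" using d t by (simp add: algebra_simps)
      then obtain k where "2 * a + 2 * t - 4 * c = 8 * k" by auto
      thus ?thesis using that[of "2 * k"] by auto
    qed
    have a: "a = 2 * y + 2 * c - t" using y by simp
    have ba: "b - a = 2 * t" "a + b = 4 * (y + c)" using t y by auto
    have fx: "f x = (t, 2 * c - t, 2 * l + 2 * c - t + 4 * y, y)"
      unfolding f_def x' by (simp add: ba)
    have "0 < c" "c < a" "0 < t" "0 < l" "a * b + 4 * c * l = M" using Q t by (auto simp: Quad_def)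
    moreover have "t * (2 * c - t) + (2 * c - t) * (2 * l + 2 * c - t + 4 * y) + (2 * l + 2 * c - t + 4 * y) * t + 4 * y * y
       = a * b + 4 * c * l" unfolding t a by (simp add: algebra_simps)
    ultimately have "f x \<in> QuadV" unfolding fx QuadV_def using t y a by auto
    moreover have "g (f x) = x" by (simp only: fx) (simp add: g_def x' t a)
    ultimately show ?thesis ..
  qed
  have 2: "g x \<in> {(a,b,c,l) \<in> Quad. 8 dvd a + b - 4 * c} \<and> f (g x) = x" if x: "x \<in> QuadV" for x
  proof -
    obtain t p q y where x': "x = (t,p,q,y)" by (cases x) auto
    from x have h: "odd t" "odd p" "odd q" "even y" "0 < t" "0 < p + t" "t < p + 4 * y" "p + 4 * y < q"
      "t * p + p * q + q * t + 4 * y * y = M" unfolding x' QuadV_def by auto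
    from h have "even (p + t)" "even (q - p - 4 * y)" by auto
    then obtain c l where c: "p + t = 2 * c" and l: "q - p - 4 * y = 2 * l" unfolding dvd_def by blast
    have p: "p = 2 * c - t" and q: "q = 2 * l + 2 * c - t + 4 * y" using c l by auto
    have gx: "g x = (p + 2 * y, p + 2 * y + 2 * t, c, l)" unfolding x' g_def using c l by auto
    have e: "(p + 2 * y) * (p + 2 * y + 2 * t) + 4 * c * l = t * p + p * q + q * t + 4 * y * y"
      unfolding p q by (simp add: algebra_simps)
    have "8 dvd (p + 2 * y) + (p + 2 * y + 2 * t) - 4 * c"
      using h(4) unfolding p by (auto elim!: evenE)
    hence "g x \<in> {(a,b,c,l) \<in> Quad. 8 dvd a + b - 4 * c}"
      unfolding gx Quad_def using h e c l by auto
    moreover have "f (g x) = x" by (simp only: gx) (simp add: f_def x' p q algebra_simps)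
    ultimately show ?thesis ..
  qed
  show "card {(a,b,c,l) \<in> Quad. 8 dvd a + b - 4 * c} = card QuadV"
    by (rule card_eq_by_inverse[of _ f _ g]) (use 1 2 in auto)
  have "finite {(a,b,c,l) \<in> Quad. 8 dvd a + b - 4 * c}" by (rule finite_Quad')
  thus "finite QuadV" by (rule finite_by_inverse[of _ _ g f]) (use 2 in auto)
qed

end

section \<open>Ternary sums with parameters\<close>

context three_mod_four begin

definition Trip :: "(int \<times> int \<times> int) set" where
  "Trip = {(t,p,q). odd t \<and> odd p \<and> odd q \<and> 0 < t \<and> t < p \<and> p < q \<and> t * p + p * q + q * t = M}"

text \<open>The equation of \<open>QuadV\<close> with \<open>z\<close> the absolute value of a
  nonzero \<open>y\<close>. It is symmetric in the three odd variables, so they may be permuted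
  freely from here on.\<close>

definition shape :: "int \<Rightarrow> int \<Rightarrow> int \<Rightarrow> int \<Rightarrow> bool" where
  "shape x y w z \<longleftrightarrow> odd x \<and> odd y \<and> odd w \<and> even z \<and> 0 < z \<and> x * y + y * w + w * x + 4 * z * z = M"

lemma shape_swap: "shape x y w z \<Longrightarrow> shape y x w z"
  by (auto simp: shape_def algebra_simps)

lemma card_QuadV_split:
  "card QuadV = card Trip + card {(t,p,q,z). shape p t q z \<and> 0 < t \<and> 0 < p + t \<and> t < p + 4 * z \<and> p + 4 * z < q}
     + card {(t,p,q,z). shape p t q z \<and> 0 < t \<and> t < p - 4 * z \<and> p - 4 * z < q}" (is "_ = _ + card ?P + card ?N")
  and finite_QuadV_pos: "finite {(t,p,q,z). shape p t q z \<and> 0 < t \<and> 0 < p + t \<and> t < p + 4 * z \<and> p + 4 * z < q}"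
  and finite_QuadV_neg: "finite {(t,p,q,z). shape p t q z \<and> 0 < t \<and> t < p - 4 * z \<and> p - 4 * z < q}"
proof -
  have 1: "card {x \<in> QuadV. snd (snd (snd x)) = 0} = card Trip"
    by (rule card_eq_by_inverse[of _ "\<lambda>(t,p,q,y). (t,p,q)" _ "\<lambda>(t,p,q). (t,p,q,0)"])
       (auto simp: QuadV_def Trip_def)
  have 3: "card {x \<in> QuadV. snd (snd (snd x)) < 0} = card ?N"
    by (rule card_eq_by_inverse[of _ "\<lambda>(t,p,q,y). (t,p,q,-y)" _ "\<lambda>(t,p,q,y). (t,p,q,-y)"])
       (auto simp: QuadV_def shape_def algebra_simps)
  have P: "{x \<in> QuadV. snd (snd (snd x)) > 0} = ?P"
    by (auto simp: QuadV_def shape_def algebra_simps)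
  have "QuadV = {x \<in> QuadV. snd (snd (snd x)) = 0} \<union> (?P \<union> {x \<in> QuadV. snd (snd (snd x)) < 0})"
    unfolding P[symmetric] by auto
  hence "card QuadV = card {x \<in> QuadV. snd (snd (snd x)) = 0} + card (?P \<union> {x \<in> QuadV. snd (snd (snd x)) < 0})"
    using finite_QuadV unfolding P[symmetric] by (subst card_Un_disjoint[symmetric]) auto
  also have "card (?P \<union> {x \<in> QuadV. snd (snd (snd x)) < 0}) = card ?P + card {x \<in> QuadV. snd (snd (snd x)) < 0}"
    using finite_QuadV unfolding P[symmetric] by (subst card_Un_disjoint[symmetric]) auto
  finally show "card QuadV = card Trip + card ?P + card ?N" using 1 3 by simp
  show "finite ?P" using finite_QuadV unfolding P[symmetric] by simp
  show "finite ?N"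
    by (rule finite_by_inverse[OF finite_QuadV, of _ "\<lambda>(t,p,q,y). (t,p,q,-y)" "\<lambda>(t,p,q,y). (t,p,q,-y)"])
       (auto simp: QuadV_def shape_def algebra_simps)
qed

text \<open>In these sets \<open>x\<close> plays the part of the middle variable \<open>p\<close> of
  \<open>QuadV\<close>, the only one that can be negative. \<open>X_neg\<close> and
  \<open>X_pos\<close> are its two sign cases in the region of \<open>QuadV_pos_neg_parity\<close>,
  the faces removed.\<close>

definition X_neg :: "(int \<times> int \<times> int \<times> int) set" where
  "X_neg = {(x,y,w,z). shape x y w z \<and> x < 0 \<and> y \<noteq> w \<and> 0 < x + y \<and> 0 < x + w \<and> y - x < 4 * z}"

definition X_pos :: "(int \<times> int \<times> int \<times> int) set" where
  "X_pos = {(x,y,w,z). shape x y w z \<and> 0 < x \<and> 0 < y \<and> 0 < w \<and> y \<noteq> w \<and> \<bar>x - y\<bar> < 4 * z}"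

text \<open>On the faces \<open>x = y + 4 * z\<close> and \<open>x = y - 4 * z\<close> the ternary
  form becomes \<open>a * (a + 2 * w)\<close>, with \<open>a = y + 2 * z\<close> for
  \<open>Edge1\<close> and \<open>a = y - 2 * z\<close> for \<open>Edge2\<close>.\<close>

definition Edge1 :: "(int \<times> int \<times> int) set" where
  "Edge1 = {(a,w,z). odd a \<and> odd w \<and> even z \<and> 0 < z \<and> a * (a + 2 * w) = M \<and> 0 < a - 2 * z \<and> a - 2 * z < w}"

definition Edge2 :: "(int \<times> int \<times> int) set" where
  "Edge2 = {(a,w,z). odd a \<and> odd w \<and> even z \<and> 0 < z \<and> a * (a + 2 * w) = M \<and> 0 < a \<and> 0 < w \<and> w < a + 2 * z \<and> 2 * z < a + w}"

text \<open>From \<open>x * y + y * w + w * x = (x + y) * (x + w) - x * x\<close> the form becomes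
  \<open>(2 * z + x) * (2 * z - x) + 4 * c * l\<close> with \<open>c = (x + y) / 2\<close> and
  \<open>l = (x + w) / 2\<close>. So negative \<open>x\<close> gives back the second set of
  \<open>Quad_split\<close>, apart from its diagonal \<open>c = l\<close>.\<close>

lemma X_neg_card: "card X_neg = card {(a,b,c,l) \<in> Quad. 8 dvd a + b \<and> c \<noteq> l}"
  and finite_X_neg: "finite X_neg"
proof -
  define f where "f = (\<lambda>(x::int,y::int,w::int,z::int). (2 * z + x, 2 * z - x, (y + x) div 2, (w + x) div 2))"
  define g where "g = (\<lambda>(a::int,b::int,c::int,l::int).
     ((a - b) div 2, 2 * c - (a - b) div 2, 2 * l - (a - b) div 2, (a + b) div 4))"
  have 1: "f v \<in> {(a,b,c,l) \<in> Quad. 8 dvd a + b \<and> c \<noteq> l} \<and> g (f v) = v" if v: "v \<in> X_neg" for v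
  proof -
    obtain x y w z where v': "v = (x,y,w,z)" by (cases v) auto
    from v have h: "odd x" "odd y" "odd w" "even z" "0 < z" "x * y + y * w + w * x + 4 * z * z = M"
      "x < 0" "y \<noteq> w" "0 < x + y" "0 < x + w" "y - x < 4 * z"
      unfolding v' X_neg_def shape_def by auto
    from h have "even (y + x)" "even (w + x)" by auto
    then obtain c l where c: "y + x = 2 * c" and l: "w + x = 2 * l" unfolding dvd_def by blast
    have y: "y = 2 * c - x" and w: "w = 2 * l - x" using c l by auto
    have fv: "f v = (2 * z + x, 2 * z - x, c, l)" unfolding v' f_def using c l by simp
    have e: "(2 * z + x) * (2 * z - x) + 4 * c * l = x * y + y * w + w * x + 4 * z * z"
      unfolding y w by (simp add: algebra_simps)
    have "8 dvd (2 * z + x) + (2 * z - x)" using h(4) by (auto elim!: evenE)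
    hence "f v \<in> {(a,b,c,l) \<in> Quad. 8 dvd a + b \<and> c \<noteq> l}"
      unfolding fv Quad_def using h e y w by auto
    moreover have "g (f v) = v" by (simp only: fv) (simp add: g_def v' y w)
    ultimately show ?thesis ..
  qed
  have 2: "g v \<in> X_neg \<and> f (g v) = v" if v: "v \<in> {(a,b,c,l) \<in> Quad. 8 dvd a + b \<and> c \<noteq> l}" for v
  proof -
    obtain a b c l where v': "v = (a,b,c,l)" and Q: "(a,b,c,l) \<in> Quad" and d: "8 dvd a + b" "c \<noteq> l"
      using v by auto
    note m = mult_mod4_eq3[OF Quad_mod4[OF Q]]
    have h: "0 < c" "c < a" "a < b" "0 < l" "a * b + 4 * c * l = M" using Q by (auto simp: Quad_def)
    from m have "even (a - b)" by simp
    then obtain x where x: "a - b = 2 * x" unfolding dvd_def by blast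
    from d obtain k where k: "a + b = 8 * k" unfolding dvd_def by blast
    define z where "z = 2 * k"
    have z: "a + b = 4 * z" using k by (simp add: z_def)
    have ab: "a = 2 * z + x" "b = 2 * z - x" using x z by auto
    have "odd x" using m ab by auto
    have gv: "g v = (x, 2 * c - x, 2 * l - x, z)" unfolding v' g_def using x z by simp
    have "x * (2 * c - x) + (2 * c - x) * (2 * l - x) + (2 * l - x) * x + 4 * z * z = a * b + 4 * c * l"
      unfolding ab by (simp add: algebra_simps)
    hence "g v \<in> X_neg" unfolding gv X_neg_def shape_def
      using h d(2) ab \<open>odd x\<close> by (auto simp: z_def)
    moreover have "f (g v) = v" by (simp only: gv) (simp add: f_def v' ab)
    ultimately show ?thesis ..
  qed
  show "card X_neg = card {(a,b,c,l) \<in> Quad. 8 dvd a + b \<and> c \<noteq> l}"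
    by (rule card_eq_by_inverse[of _ f _ g]) (use 1 2 in auto)
  show "finite X_neg"
    by (rule finite_by_inverse[OF finite_Quad'[of "\<lambda>a b c l. 8 dvd a + b \<and> c \<noteq> l"], of _ f g]) (use 1 in auto)
qed

lemma shape_pos_le:
  assumes "shape x y w z" "0 < x" "0 < y" "0 < w"
  shows "x \<in> {1..M}" "y \<in> {1..M}" "w \<in> {1..M}" "z \<in> {1..M}"
proof -
  have e: "x * y + y * w + w * x + 4 * (z * z) = M" and z: "0 < z" using assms by (auto simp: shape_def)
  have "0 < x * y" "0 < y * w" "0 < w * x" "0 < z * z" using assms z by simp_all
  moreover have "x \<le> x * y" "y \<le> x * y" "w \<le> w * x" "z \<le> z * z"
    using pos_factors_le[of x y] pos_factors_le[of w x] pos_factors_le[of z z] assms z by auto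
  ultimately have "x \<le> M" "y \<le> M" "w \<le> M" "z \<le> M" using e by linarith+
  thus "x \<in> {1..M}" "y \<in> {1..M}" "w \<in> {1..M}" "z \<in> {1..M}" using assms z by auto
qed

lemma finite_shape_pos: "finite {(x,y,w,z). shape x y w z \<and> 0 < x \<and> 0 < y \<and> 0 < w}"
proof (rule finite_subset)
  show "{(x,y,w,z). shape x y w z \<and> 0 < x \<and> 0 < y \<and> 0 < w} \<subseteq> {1..M} \<times> {1..M} \<times> {1..M} \<times> {1..M}"
    using shape_pos_le by auto
qed auto

lemma finite_shape_pos': "finite {(x,y,w,z). shape x y w z \<and> 0 < x \<and> 0 < y \<and> 0 < w \<and> Q x y w z}"
  by (rule finite_subset[OF _ finite_shape_pos]) auto

text \<open>Positive solutions of \<open>shape\<close> with two equal odd variables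
  \<open>y\<close>; they arise as fixed points of a swap.\<close>

definition Tern :: "(int \<times> int \<times> int) set" where
  "Tern = {(y,x,z). odd x \<and> odd y \<and> even z \<and> 0 < z \<and> 0 < y \<and> 0 < x \<and> y * y + 2 * x * y + 4 * z * z = M}"

lemma finite_Tern: "finite {(y,x,z). (y,x,z) \<in> Tern \<and> Q x y z}"
  by (rule finite_by_inverse[OF finite_shape_pos, of _ "\<lambda>(y,x,z). (y,y,x,z)" "\<lambda>(x,y,w,z). (x,w,z)"])
     (auto simp: Tern_def shape_def algebra_simps)

text \<open>Without the condition \<open>y \<noteq> w\<close> the region is invariant under swapping
  \<open>x\<close> and \<open>y\<close>, and the fixed points are \<open>Tern\<close>. The solutions
  with \<open>w = y\<close>, which have to be taken out again, are the part of \<open>Tern\<close>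
  where the distance of \<open>x\<close> and \<open>y\<close> is less than \<open>4 * z\<close>; the
  complementary part remains.\<close>

lemma X_pos_parity: "even (card X_pos) \<longleftrightarrow> even (card {(y,x,z) \<in> Tern. 4 * z \<le> \<bar>x - y\<bar>})"
  and finite_X_pos: "finite X_pos"
proof -
  define Y where "Y = {(x,y,w,z). shape x y w z \<and> 0 < x \<and> 0 < y \<and> 0 < w \<and> \<bar>x - y\<bar> < 4 * z}"
  have fY: "finite Y" unfolding Y_def by (rule finite_shape_pos')
  show fX: "finite X_pos"
    by (rule finite_subset[OF _ fY]) (auto simp: X_pos_def Y_def)
  have "Y = X_pos \<union> {(x,y,w,z) \<in> Y. w = y}"
    by (auto simp: X_pos_def Y_def)
  hence "card Y = card X_pos + card {(x,y,w,z) \<in> Y. w = y}"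
    using fX fY by (subst card_Un_disjoint[symmetric]) (auto simp: X_pos_def intro: finite_subset[OF _ fY])
  moreover have "card {(x,y,w,z) \<in> Y. w = y} = card {(y,x,z) \<in> Tern. \<bar>x - y\<bar> < 4 * z}"
    by (rule card_eq_by_inverse[of _ "\<lambda>(x,y,w,z). (y,x,z)" _ "\<lambda>(y,x,z). (x,y,y,z)"])
       (auto simp: Y_def Tern_def shape_def algebra_simps)
  moreover have "even (card Y) \<longleftrightarrow> even (card {v \<in> Y. (\<lambda>(x,y,w,z). (y,x,w,z)) v = v})"
    by (rule even_card_fixpoints[OF fY]) (auto simp: Y_def shape_swap)
  moreover have "card {v \<in> Y. (\<lambda>(x,y,w,z). (y,x,w,z)) v = v} = card Tern"
    by (rule card_eq_by_inverse[of _ "\<lambda>(x,y,w,z). (x,w,z)" _ "\<lambda>(y,x,z). (y,y,x,z)"])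
       (auto simp: Y_def Tern_def shape_def algebra_simps)
  moreover have "card Tern = card {(y,x,z) \<in> Tern. \<bar>x - y\<bar> < 4 * z} + card {(y,x,z) \<in> Tern. 4 * z \<le> \<bar>x - y\<bar>}"
    by (subst card_Un_disjoint[symmetric])
       (auto intro!: arg_cong[where f = card] finite_Tern)
  ultimately show "even (card X_pos) \<longleftrightarrow> even (card {(y,x,z) \<in> Tern. 4 * z \<le> \<bar>x - y\<bar>})"
    by auto
qed

definition E1 :: "(int \<times> int \<times> int \<times> int) set" where
  "E1 = {(x,y,w,z). shape x y w z \<and> x = y + 4 * z \<and> 0 < y \<and> y < w}"

definition E2 :: "(int \<times> int \<times> int \<times> int) set" where
  "E2 = {(x,y,w,z). shape x y w z \<and> x = y - 4 * z \<and> 0 < w \<and> w < y \<and> 0 < x + w}"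

lemma finite_E1: "finite E1"
  by (rule finite_subset[OF _ finite_shape_pos]) (auto simp: E1_def shape_def)

lemma card_E1: "card E1 = card Edge1"
  by (rule card_eq_by_inverse[of _ "\<lambda>(x,y,w,z). (y + 2 * z, w, z)" _ "\<lambda>(a,w,z). (a + 2 * z, a - 2 * z, w, z)"])
     (auto simp: E1_def Edge1_def shape_def algebra_simps)

lemma finite_Edge2: "finite Edge2"
proof (rule finite_subset)
  show "Edge2 \<subseteq> {1..M} \<times> {1..M} \<times> {1..M}"
  proof
    fix v assume "v \<in> Edge2"
    then obtain a w z where v: "v = (a,w,z)" and h: "0 < z" "a * (a + 2 * w) = M" "0 < a" "0 < w" "2 * z < a + w"
      by (auto simp: Edge2_def)
    have "a \<le> M" "a + 2 * w \<le> M" using pos_factors_le[of a "a + 2 * w"] h by auto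
    thus "v \<in> {1..M} \<times> {1..M} \<times> {1..M}" using h v by auto
  qed
qed auto

lemma card_E2: "card E2 = card Edge2" and finite_E2: "finite E2"
proof -
  have 1: "(\<lambda>(x,y,w,z). (y - 2 * z, w, z)) v \<in> Edge2
      \<and> (\<lambda>(a,w,z). (a - 2 * z, a + 2 * z, w, z)) ((\<lambda>(x,y,w,z). (y - 2 * z, w, z)) v) = v" if "v \<in> E2" for v
  proof -
    obtain x y w z where vx: "v = (x, y, w, z)" by (cases v) auto
    hence v: "v = (y - 4 * z, y, w, z)" using that by (simp add: E2_def)
    have h: "odd y" "odd w" "even z" "0 < z"
      "(y - 4 * z) * y + y * w + w * (y - 4 * z) + 4 * z * z = M" "0 < w" "w < y" "0 < y - 4 * z + w"
      using that unfolding v E2_def shape_def by auto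
    have e: "(y - 2 * z) * (y - 2 * z + 2 * w) = M" using h(5) by (simp add: algebra_simps)
    \<comment> \<open>Positivity of \<open>a = y - 2 * z\<close> is not a linear consequence of the
      region: it comes from \<open>a * (a + 2 * w) = M > 0\<close> with a positive second
      factor.\<close>
    have "0 < y - 2 * z"
    proof (rule ccontr)
      assume "\<not> 0 < y - 2 * z"
      moreover have "0 < y - 2 * z + 2 * w" using h by linarith
      ultimately have "(y - 2 * z) * (y - 2 * z + 2 * w) \<le> 0" by (simp add: mult_le_0_iff)
      thus False using e M_pos by simp
    qed
    thus ?thesis using h e by (auto simp: v Edge2_def)
  qed
  have 2: "(\<lambda>(a,w,z). (a - 2 * z, a + 2 * z, w, z)) v \<in> E2
     \<and> (\<lambda>(x,y,w,z). (y - 2 * z, w, z)) ((\<lambda>(a,w,z). (a - 2 * z, a + 2 * z, w, z)) v) = v" if "v \<in> Edge2" for v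
    using that by (auto simp: E2_def Edge2_def shape_def algebra_simps)
  show "card E2 = card Edge2"
    by (rule card_eq_by_inverse[OF 1 2])
  show "finite E2"
    by (rule finite_by_inverse[OF finite_Edge2 1])
qed

text \<open>For \<open>t < q\<close> the condition \<open>t < s < q\<close> is the difference of
  \<open>t < s\<close> and \<open>q \<le> s\<close>. Taken at \<open>s = p + 4 * z\<close> and
  \<open>s = p - 4 * z\<close>, the two windows become modulo 2 one window for \<open>p - t\<close>
  and one for \<open>p - q\<close>. Renaming variables makes the first live on \<open>y < w\<close>
  and the second on \<open>w < y\<close>, so that together they form one region, up to
  faces.\<close>

lemma QuadV_pos_neg_parity:
  "even (card {(t,p,q,z). shape p t q z \<and> 0 < t \<and> 0 < p + t \<and> t < p + 4 * z \<and> p + 4 * z < q}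
     + card {(t,p,q,z). shape p t q z \<and> 0 < t \<and> t < p - 4 * z \<and> p - 4 * z < q})
   \<longleftrightarrow> even (card X_neg + card X_pos + card Edge1 + card Edge2)" (is "even (card ?P + card ?N) = _")
proof -
  define S1 where "S1 = {(x,y,w,z). shape x y w z \<and> 0 < y \<and> y < w \<and> 0 < x + y \<and> - 4 * z < x - y \<and> x - y \<le> 4 * z}"
  define S2 where "S2 = {(x,y,w,z). shape x y w z \<and> 0 < w \<and> w < y \<and> 0 < x + w \<and> - 4 * z \<le> x - y \<and> x - y < 4 * z}"
  have "v \<in> S1 \<union> S2 \<longleftrightarrow> v \<in> (X_neg \<union> X_pos) \<union> (E1 \<union> E2)" for v
  proof -
    obtain x y w z where v: "v = (x, y, w, z)" by (cases v) auto
    show ?thesis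
    proof (cases "shape x y w z")
      case True
      hence "x \<noteq> 0" "0 < z" by (auto simp: shape_def)
      hence "((0 < y \<and> y < w \<and> 0 < x + y \<and> - 4 * z < x - y \<and> x - y \<le> 4 * z) \<or>
          (0 < w \<and> w < y \<and> 0 < x + w \<and> - 4 * z \<le> x - y \<and> x - y < 4 * z)) \<longleftrightarrow>
        ((x < 0 \<and> y \<noteq> w \<and> 0 < x + y \<and> 0 < x + w \<and> y - x < 4 * z) \<or>
         (0 < x \<and> 0 < y \<and> 0 < w \<and> y \<noteq> w \<and> \<bar>x - y\<bar> < 4 * z)) \<or>
        ((x = y + 4 * z \<and> 0 < y \<and> y < w) \<or> (x = y - 4 * z \<and> 0 < w \<and> w < y \<and> 0 < x + w))"
        by (smt (verit))
      thus ?thesis using True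
        by (simp only: v S1_def S2_def X_neg_def X_pos_def E1_def E2_def Un_iff mem_Collect_eq prod.case simp_thms)
    qed (simp add: v S1_def S2_def X_neg_def X_pos_def E1_def E2_def)
  qed
  hence U: "S1 \<union> S2 = (X_neg \<union> X_pos) \<union> (E1 \<union> E2)" by blast
  have f: "finite S1" "finite S2" using U finite_X_neg finite_X_pos finite_E1 finite_E2
    by (metis finite_Un)+
  have "card S1 + card S2 = card (S1 \<union> S2)"
    by (rule card_Un_disjoint[symmetric]) (use f in \<open>auto simp: S1_def S2_def\<close>)
  also have "\<dots> = card (X_neg \<union> X_pos) + card (E1 \<union> E2)" unfolding U
    by (rule card_Un_disjoint) (use finite_X_neg finite_X_pos finite_E1 finite_E2 in
      \<open>auto simp: X_neg_def X_pos_def E1_def E2_def shape_def\<close>)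
  also have "card (X_neg \<union> X_pos) = card X_neg + card X_pos"
    by (rule card_Un_disjoint) (use finite_X_neg finite_X_pos in \<open>auto simp: X_neg_def X_pos_def\<close>)
  also have "card (E1 \<union> E2) = card E1 + card E2"
    by (rule card_Un_disjoint) (use finite_E1 finite_E2 in \<open>auto simp: E1_def E2_def\<close>)
  finally have c: "card S1 + card S2 = card X_neg + card X_pos + card Edge1 + card Edge2"
    by (simp add: card_E1 card_E2)
  define S1' where "S1' = {(t,p,q,z). shape p t q z \<and> 0 < t \<and> t < q \<and> 0 < p + t \<and> - 4 * z < p - t \<and> p - t \<le> 4 * z}"
  define S2' where "S2' = {(t,p,q,z). shape p t q z \<and> 0 < t \<and> t < q \<and> 0 < p + t \<and> - 4 * z \<le> p - q \<and> p - q < 4 * z}"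
  have c1: "card S1 = card S1'" and f1: "finite S1'"
    by (rule card_eq_by_inverse[of _ "\<lambda>(x,y,w,z). (y,x,w,z)" _ "\<lambda>(t,p,q,z). (p,t,q,z)"],
        auto simp: S1_def S1'_def)
       (rule finite_by_inverse[OF f(1), of _ "\<lambda>(t,p,q,z). (p,t,q,z)" "\<lambda>(x,y,w,z). (y,x,w,z)"],
        auto simp: S1_def S1'_def)
  have c2: "card S2 = card S2'" and f2: "finite S2'"
    by (rule card_eq_by_inverse[of _ "\<lambda>(x,y,w,z). (w,x,y,z)" _ "\<lambda>(t,p,q,z). (p,q,t,z)"],
        auto simp: S2_def S2'_def shape_def algebra_simps)
       (rule finite_by_inverse[OF f(2), of _ "\<lambda>(t,p,q,z). (p,q,t,z)" "\<lambda>(x,y,w,z). (w,x,y,z)"],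
        auto simp: S2_def S2'_def shape_def algebra_simps)
  have "even (card ?P + card ?N) \<longleftrightarrow> even (card S1' + card S2')"
    by (rule even_card_xor[OF finite_QuadV_pos finite_QuadV_neg f1 f2])
       (auto simp: S1'_def S2'_def shape_def)
  thus ?thesis unfolding c[unfolded c1 c2] .
qed

text \<open>The tuples with \<open>8 dvd a + b\<close> and \<open>c \<noteq> l\<close> enter twice,
  from \<open>Quad_split\<close> and as \<open>X_neg\<close>, and drop out. Only terms with one
  variable fewer accompany the two wanted counts.\<close>

theorem Quad_parity:
  "even (card {(a,b,c,l) \<in> Quad. odd c} + card Trip + card {(y,x,z) \<in> Tern. 4 * z \<le> \<bar>x - y\<bar>}
     + card {(a,b,c,l) \<in> Quad. 8 dvd a + b \<and> c = l} + card Edge1 + card Edge2)"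
proof -
  have "card {(a,b,c,l) \<in> Quad. 8 dvd a + b}
     = card {(a,b,c,l) \<in> Quad. 8 dvd a + b \<and> c = l} + card {(a,b,c,l) \<in> Quad. 8 dvd a + b \<and> c \<noteq> l}"
    by (subst card_Un_disjoint[symmetric]) (auto intro!: arg_cong[where f = card] finite_Quad')
  hence "card {(a,b,c,l) \<in> Quad. 8 dvd a + b} = card {(a,b,c,l) \<in> Quad. 8 dvd a + b \<and> c = l} + card X_neg"
    by (simp add: X_neg_card)
  moreover have "even (a + u + t + d + e + f)"
    if "even (a + b + c)" "b = v" "v = u + p + n" "even (p + n) = even (x + y + e + f)" "even y = even t" "c = d + x"
    for a b c d e f p n t u v x y :: nat
    using that by presburger
  ultimately show ?thesis
    using Quad_split card_QuadV card_QuadV_split QuadV_pos_neg_parity X_pos_parity(1) by blast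
qed

end

section \<open>Representations by $4u^2+4v^2-t^2$\<close>

context three_mod_four begin

text \<open>Both remaining families, the far part of \<open>Tern\<close> and the diagonal of
  \<open>Quad\<close>, are solutions of this indefinite equation. Its integral automorphisms supply
  all the maps below.\<close>

definition om :: "int \<Rightarrow> int \<Rightarrow> int \<Rightarrow> bool" where
  "om u v t \<longleftrightarrow> 4 * u * u + 4 * v * v - t * t = M"

lemma om_odd: "om u v t \<Longrightarrow> odd t"
proof -
  assume "om u v t"
  hence "t * t = 4 * (u * u + v * v) - M" by (simp add: om_def algebra_simps)
  moreover have "odd M" using M_mod4 by presburger
  ultimately have "odd (t * t)" by presburger
  thus ?thesis by simp
qed

lemma om_nz: "om u v t \<Longrightarrow> t \<noteq> 0"
  using om_odd by force

lemma om_swap: "om u v t \<longleftrightarrow> om v u t"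
  by (auto simp: om_def)

lemma finite_om: "finite {(u,v,t). om u v t \<and> - 2 * u < t \<and> t < 2 * u \<and> Q u v t}"
proof (rule finite_subset)
  show "{(u,v,t). om u v t \<and> - 2 * u < t \<and> t < 2 * u \<and> Q u v t} \<subseteq> {- M..M} \<times> {- M..M} \<times> {- 2 * M..2 * M}"
  proof
    fix x assume "x \<in> {(u,v,t). om u v t \<and> - 2 * u < t \<and> t < 2 * u \<and> Q u v t}"
    then obtain u v t where x: "x = (u,v,t)" and h: "om u v t" "- 2 * u < t" "t < 2 * u" by auto
    have e: "(2 * u - t) * (2 * u + t) + 4 * (v * v) = M"
      using h(1) by (simp add: om_def algebra_simps)
    have p: "0 < 2 * u - t" "0 < 2 * u + t" using h by auto
    have "0 \<le> v * v" "0 < (2 * u - t) * (2 * u + t)" using p by simp_all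
    moreover have "\<bar>v\<bar> \<le> v * v"
    proof (cases "v = 0")
      case False
      hence "\<bar>v\<bar> \<le> \<bar>v\<bar> * \<bar>v\<bar>" by (intro pos_factors_le) auto
      thus ?thesis by simp
    qed simp
    ultimately have "2 * u - t \<le> M" "2 * u + t \<le> M" "\<bar>v\<bar> \<le> M"
      using pos_factors_le[OF p] e by linarith+
    thus "x \<in> {- M..M} \<times> {- M..M} \<times> {- 2 * M..2 * M}" using h M_pos by (auto simp: x)
  qed
qed auto

lemma finite_om': "finite {(u,v,t). om u v t \<and> - 2 * v < t \<and> t < 2 * v \<and> Q u v t}"
  by (rule finite_by_inverse[OF finite_om[of "\<lambda>u v t. Q v u t"],
        of _ "\<lambda>(u,v,t). (v,u,t)" "\<lambda>(u,v,t). (v,u,t)"]) (auto simp: om_swap)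

lemma finite_om_sub: "(\<And>u v t. (u,v,t) \<in> S \<Longrightarrow> om u v t \<and> - 2 * u < t \<and> t < 2 * u) \<Longrightarrow> finite S"
  by (rule finite_subset[OF _ finite_om[of "\<lambda>_ _ _. True"]]) auto

lemma finite_om_sub': "(\<And>u v t. (u,v,t) \<in> S \<Longrightarrow> om u v t \<and> - 2 * v < t \<and> t < 2 * v) \<Longrightarrow> finite S"
  by (rule finite_subset[OF _ finite_om'[of "\<lambda>_ _ _. True"]]) auto

text \<open>The factorisations of \<open>M\<close> into two factors \<open>a < b\<close>, with
  \<open>b = a + 2 * w\<close>; both factors are odd, so \<open>w\<close> is an integer.\<close>

definition PW :: "(int \<times> int) set" where
  "PW = {(a,w). 0 < a \<and> 0 < w \<and> a * (a + 2 * w) = M}"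

lemma PW_odd: assumes "(a,w) \<in> PW" shows "odd a" "odd w"
proof -
  have e: "a * (a + 2 * w) mod 4 = 3" using assms M_mod4 by (simp add: PW_def)
  from mult_mod4_eq3[OF e] show "odd a" "odd w" by presburger+
qed

lemma finite_PW: "finite PW"
proof (rule finite_subset)
  show "PW \<subseteq> {1..M} \<times> {1..M}"
  proof
    fix x assume "x \<in> PW"
    then obtain a w where x: "x = (a,w)" and h: "0 < a" "0 < w" "a * (a + 2 * w) = M" by (auto simp: PW_def)
    thus "x \<in> {1..M} \<times> {1..M}" using pos_factors_le[of a "a + 2 * w"] by auto
  qed
qed auto

lemma finite_PW': "finite {(a,w). (a,w) \<in> PW \<and> Q a w}"
  by (rule finite_subset[OF _ finite_PW]) auto

definition Wo :: "(int \<times> int \<times> int) set" where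
  "Wo = {(u,v,t). om u v t \<and> 0 < u \<and> odd v \<and> 0 < v \<and> 0 < t \<and> t < 2 * u}"

lemma card_Tern_om:
  "card {(y,x,z) \<in> Tern. 4 * z \<le> \<bar>x - y\<bar>} =
   card {(u,v,t). om u v t \<and> even u \<and> 0 < u \<and> 0 < t \<and> t < 2 * v \<and> 2 * u \<le> \<bar>t - v\<bar>}" (is "card ?A = card ?B")
proof (rule card_eq_by_inverse[of _ "\<lambda>(y,x,z). (z, (y + x) div 2, x)" _ "\<lambda>(u,v,t). (2 * v - t, t, u)"])
  fix s assume "s \<in> ?A"
  then obtain y x z where s: "s = (y,x,z)" and h: "odd x" "odd y" "even z" "0 < z" "0 < y" "0 < x"
     "y * y + 2 * x * y + 4 * z * z = M" "4 * z \<le> \<bar>x - y\<bar>" by (auto simp: Tern_def)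
  have "even (y + x)" using h by simp
  then obtain v where v: "y + x = 2 * v" unfolding dvd_def by blast
  have y: "y = 2 * v - x" using v by simp
  have "om z v x" using h(7) unfolding om_def y by (simp add: algebra_simps)
  thus "(\<lambda>(y,x,z). (z, (y + x) div 2, x)) s \<in> ?B \<and>
     (\<lambda>(u,v,t). (2 * v - t, t, u)) ((\<lambda>(y,x,z). (z, (y + x) div 2, x)) s) = s"
    using h y unfolding s by (auto simp: v)
next
  fix s assume "s \<in> ?B"
  then obtain u v t where s: "s = (u,v,t)" and h: "om u v t" "even u" "0 < u" "0 < t" "t < 2 * v" "2 * u \<le> \<bar>t - v\<bar>"
    by auto
  have "(2 * v - t, t, u) \<in> ?A" using h om_odd[OF h(1)] 
    by (auto simp: Tern_def om_def algebra_simps)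
  thus "(\<lambda>(u,v,t). (2 * v - t, t, u)) s \<in> ?A \<and>
     (\<lambda>(y,x,z). (z, (y + x) div 2, x)) ((\<lambda>(u,v,t). (2 * v - t, t, u)) s) = s"
    unfolding s by auto
qed

lemma card_diag_om:
  "card {(a,b,c,l) \<in> Quad. 8 dvd a + b \<and> c = l} =
   card {(u,v,t). om u v t \<and> even u \<and> 0 < u \<and> 0 < v \<and> 0 < t \<and> t < 2 * u - v}" (is "card ?A = card ?B")
proof (rule card_eq_by_inverse[of _ "\<lambda>(a,b,c,l). ((a + b) div 4, c, (b - a) div 2)" _
        "\<lambda>(u,v,t). (2 * u - t, 2 * u + t, v, v)"])
  fix s assume "s \<in> ?A"
  then obtain a b c where s: "s = (a,b,c,c)" and Q: "(a,b,c,c) \<in> Quad" and d: "8 dvd a + b" by auto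
  have h: "0 < c" "c < a" "a < b" "a * b + 4 * c * c = M" using Q by (auto simp: Quad_def)
  have "even (b - a)" using mult_mod4_eq3[OF Quad_mod4[OF Q]] by simp
  then obtain t where t: "b - a = 2 * t" unfolding dvd_def by blast
  from d obtain k where k: "a + b = 8 * k" unfolding dvd_def by blast
  have ab: "a = 4 * k - t" "b = 4 * k + t" using t k by auto
  have "om (2 * k) c t" using h(4) unfolding om_def ab by (simp add: algebra_simps)
  thus "(\<lambda>(a,b,c,l). ((a + b) div 4, c, (b - a) div 2)) s \<in> ?B \<and>
    (\<lambda>(u,v,t). (2 * u - t, 2 * u + t, v, v)) ((\<lambda>(a,b,c,l). ((a + b) div 4, c, (b - a) div 2)) s) = s"
    using h unfolding s ab by auto
next
  fix s assume "s \<in> ?B"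
  then obtain u v t where s: "s = (u,v,t)" and h: "om u v t" "even u" "0 < u" "0 < v" "0 < t" "t < 2 * u - v"
    by auto
  from h(2) obtain k where "u = 2 * k" unfolding dvd_def by blast
  hence "(2 * u - t, 2 * u + t, v, v) \<in> ?A" using h
    by (auto simp: Quad_def om_def algebra_simps)
  thus "(\<lambda>(u,v,t). (2 * u - t, 2 * u + t, v, v)) s \<in> ?A \<and>
    (\<lambda>(a,b,c,l). ((a + b) div 4, c, (b - a) div 2)) ((\<lambda>(u,v,t). (2 * u - t, 2 * u + t, v, v)) s) = s"
    unfolding s by auto
qed

text \<open>The map sends \<open>(u, v, t)\<close> to \<open>(v, - u, t)\<close> and then reflects
  in the vector \<open>(1, -1, 2)\<close> of norm 4, both automorphisms of the form. As
  \<open>t\<close> is odd, it exchanges the condition \<open>even u\<close> for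
  \<open>odd v\<close>, and the image region overlaps \<open>Wo\<close>.\<close>

lemma card_T3a:
  "card {(u,v,t). om u v t \<and> even u \<and> 0 < u \<and> 2 * u + v \<le> t \<and> t < 2 * v} =
   card {(u,v,t). om u v t \<and> odd v \<and> 0 \<le> u \<and> 2 * u - v < t \<and> t < 2 * u}" (is "card ?A = card ?B")
  and finite_T3a': "finite {(u,v,t). om u v t \<and> odd v \<and> 0 \<le> u \<and> 2 * u - v < t \<and> t < 2 * u}"
proof -
  let ?f = "\<lambda>(u::int,v::int,t::int). (t - 2 * u - v, 2 * v + u - t, 3 * t - 4 * u - 4 * v)"
  let ?g = "\<lambda>(u::int,v::int,t::int). (t - 2 * u + v, t - u + 2 * v, 3 * t - 4 * u + 4 * v)"
  have 1: "?f s \<in> ?B \<and> ?g (?f s) = s" if "s \<in> ?A" for s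
  proof -
    obtain u v t where s: "s = (u,v,t)" and h: "om u v t" "even u" "0 < u" "2 * u + v \<le> t" "t < 2 * v"
      using \<open>s \<in> ?A\<close> by auto
    have "om (t - 2 * u - v) (2 * v + u - t) (3 * t - 4 * u - 4 * v)"
      using h(1) by (simp add: om_def algebra_simps)
    thus ?thesis using h om_odd[OF h(1)] by (auto simp: s)
  qed
  have 2: "?g s \<in> ?A \<and> ?f (?g s) = s" if "s \<in> ?B" for s
  proof -
    obtain u v t where s: "s = (u,v,t)" and h: "om u v t" "odd v" "0 \<le> u" "2 * u - v < t" "t < 2 * u"
      using \<open>s \<in> ?B\<close> by auto
    have "om (t - 2 * u + v) (t - u + 2 * v) (3 * t - 4 * u + 4 * v)"
      using h(1) by (simp add: om_def algebra_simps)
    thus ?thesis using h om_odd[OF h(1)] by (auto simp: s)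
  qed
  show "card ?A = card ?B" by (rule card_eq_by_inverse[OF 1 2])
  have "finite ?A" by (rule finite_om_sub') auto
  thus "finite ?B" by (rule finite_by_inverse[OF _ 2])
qed


text \<open>The region is cut by the sign of \<open>t\<close>, which is never 0. On the face
  \<open>u = 0\<close> the equation reads \<open>(2 * v + t) * (2 * v - t) = M\<close> and yields
  factorisations.\<close>

lemma T3a_parts:
  "card {(u,v,t). om u v t \<and> odd v \<and> 0 \<le> u \<and> 2 * u - v < t \<and> t < 2 * u} =
     card {(a,w) \<in> PW. w < a \<and> (a + w) mod 4 = 2}
     + card {(u,v,t). om u v t \<and> 0 < u \<and> odd v \<and> 0 < t \<and> t < v - 2 * u}
     + card {(u,v,t). om u v t \<and> 0 < u \<and> odd v \<and> 0 < t \<and> 2 * u - v < t \<and> t < 2 * u}" (is "card ?S = card ?B + card ?P + card ?R")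
proof -
  let ?B' = "{(u,v,t). om u v t \<and> odd v \<and> u = 0 \<and> - v < t \<and> t < 0}"
  let ?P' = "{(u,v,t). om u v t \<and> odd v \<and> 0 < u \<and> 2 * u - v < t \<and> t < 0}"
  have "(u,v,t) \<in> ?S \<longleftrightarrow> (u,v,t) \<in> ?B' \<union> (?P' \<union> ?R)" for u v t
    using om_nz[of u v t] by auto
  hence S: "?S = ?B' \<union> (?P' \<union> ?R)" by auto
  have "finite (?B' \<union> (?P' \<union> ?R))" using finite_T3a' unfolding S .
  hence f: "finite ?B'" "finite ?P'" "finite ?R" by (simp_all only: finite_Un)
  have "card ?S = card ?B' + card (?P' \<union> ?R)" unfolding S
    by (rule card_Un_disjoint) (use f in auto)
  also have "card (?P' \<union> ?R) = card ?P' + card ?R"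
    by (rule card_Un_disjoint) (use f in auto)
  also have "card ?P' = card ?P"
    by (rule card_eq_by_inverse[of _ "\<lambda>(u,v,t). (u,v,-t)" _ "\<lambda>(u,v,t). (u,v,-t)"]) (auto simp: om_def)
  also have "card ?B' = card ?B"
  proof (rule card_eq_by_inverse[of _ "\<lambda>(u,v,t). (2 * v + t, - t)" _ "\<lambda>(a,w). (0, (a + w) div 2, - w)"])
    fix s assume "s \<in> ?B'"
    then obtain v t where s: "s = (0,v,t)" and h: "om 0 v t" "odd v" "- v < t" "t < 0" by auto
    from h(2) obtain k where k: "v = 2 * k + 1" by (elim oddE)
    have "(2 * v + t, - t) \<in> ?B" using h k by (simp add: PW_def om_def algebra_simps)
    thus "(\<lambda>(u,v,t). (2 * v + t, - t)) s \<in> ?B \<and>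
      (\<lambda>(a,w). (0, (a + w) div 2, - w)) ((\<lambda>(u,v,t). (2 * v + t, - t)) s) = s" by (simp add: s)
  next
    fix s assume "s \<in> ?B"
    then obtain a w where s: "s = (a,w)" and h: "(a,w) \<in> PW" "w < a" "(a + w) mod 4 = 2" by auto
    then obtain k where k: "a + w = 4 * k + 2" by (metis mult_div_mod_eq)
    have a: "a = 4 * k + 2 - w" using k by simp
    have "(0, 2 * k + 1, - w) \<in> ?B'" using h(1,2) unfolding a
      by (simp add: PW_def om_def algebra_simps)
    thus "(\<lambda>(a,w). (0, (a + w) div 2, - w)) s \<in> ?B' \<and>
      (\<lambda>(u,v,t). (2 * v + t, - t)) ((\<lambda>(a,w). (0, (a + w) div 2, - w)) s) = s"
      by (simp add: s a)
  qed
  finally show ?thesis by simp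
qed

text \<open>On the face \<open>t = 2 * u - v\<close> the form equals
  \<open>v * (3 * v + 4 * u)\<close>, a factorisation with \<open>a = v\<close> and
  \<open>w = v + 2 * u\<close>. The face \<open>t = v - 2 * u\<close> in \<open>T3b_parts\<close>
  has the same square \<open>t * t\<close> and hence the same factorisation.\<close>

lemma Wo_parts:
  "card Wo = card {(u,v,t). om u v t \<and> 0 < u \<and> odd v \<and> 0 < t \<and> 2 * u - v < t \<and> t < 2 * u}
     + card {(a,w) \<in> PW. 2 * a < w}
     + card {(u,v,t). om u v t \<and> 0 < u \<and> odd v \<and> 0 < v \<and> 0 < t \<and> t < 2 * u - v}" (is "_ = card ?R + card ?B + card ?P")
proof -
  let ?B' = "{(u,v,t). om u v t \<and> 0 < u \<and> odd v \<and> 0 < v \<and> 0 < t \<and> t = 2 * u - v}"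
  have W: "Wo = ?R \<union> (?B' \<union> ?P)" by (auto simp: Wo_def)
  have f: "finite ?R" "finite ?B'" "finite ?P" by (rule finite_om_sub; auto)+
  have "card Wo = card ?R + card (?B' \<union> ?P)" unfolding W
    by (rule card_Un_disjoint) (use f in auto)
  also have "card (?B' \<union> ?P) = card ?B' + card ?P"
    by (rule card_Un_disjoint) (use f in auto)
  also have "card ?B' = card ?B"
  proof (rule card_eq_by_inverse[of _ "\<lambda>(u,v,t). (v, v + 2 * u)" _ "\<lambda>(a,w). ((w - a) div 2, a, w - 2 * a)"])
    fix s assume "s \<in> ?B'"
    then obtain u v where s: "s = (u,v,2 * u - v)" and h: "om u v (2 * u - v)" "0 < u" "odd v" "0 < v" "0 < 2 * u - v" by auto
    have "(v, v + 2 * u) \<in> ?B" using h by (simp add: PW_def om_def algebra_simps)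
    thus "(\<lambda>(u,v,t). (v, v + 2 * u)) s \<in> ?B \<and>
      (\<lambda>(a,w). ((w - a) div 2, a, w - 2 * a)) ((\<lambda>(u,v,t). (v, v + 2 * u)) s) = s" by (simp add: s)
  next
    fix s assume "s \<in> ?B"
    then obtain a w where s: "s = (a,w)" and h: "(a,w) \<in> PW" "2 * a < w" by auto
    note o = PW_odd[OF h(1)]
    hence "even (w - a)" by simp
    then obtain k where k: "w - a = 2 * k" unfolding dvd_def by blast
    have w: "w = a + 2 * k" using k by simp
    have "(k, a, w - 2 * a) \<in> ?B'" using h o unfolding w
      by (simp add: PW_def om_def algebra_simps)
    thus "(\<lambda>(a,w). ((w - a) div 2, a, w - 2 * a)) s \<in> ?B' \<and>
      (\<lambda>(u,v,t). (v, v + 2 * u)) ((\<lambda>(a,w). ((w - a) div 2, a, w - 2 * a)) s) = s"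
      by (simp add: s w)
  qed
  finally show ?thesis by simp
qed

lemma T3b_parts:
  "card {(u,v,t). om u v t \<and> even u \<and> 0 < u \<and> 0 < t \<and> t \<le> v - 2 * u} =
     card {(a,w) \<in> PW. a < w \<and> w < 2 * a \<and> 4 dvd w - a}
     + card {(u,v,t). om u v t \<and> even u \<and> 0 < u \<and> 0 < t \<and> t < v - 2 * u}" (is "card ?S = card ?B + card ?P")
proof -
  let ?B' = "{(u,v,t). om u v t \<and> even u \<and> 0 < u \<and> 0 < t \<and> t = v - 2 * u}"
  have W: "?S = ?B' \<union> ?P" by auto
  have f: "finite ?B'" "finite ?P" by (rule finite_om_sub'; auto)+
  have "card ?S = card ?B' + card ?P" unfolding W
    by (rule card_Un_disjoint) (use f in auto)
  also have "card ?B' = card ?B"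
  proof (rule card_eq_by_inverse[of _ "\<lambda>(u,v,t). (v, v + 2 * u)" _ "\<lambda>(a,w). ((w - a) div 2, a, 2 * a - w)"])
    fix s assume "s \<in> ?B'"
    then obtain u v where s: "s = (u,v,v - 2 * u)" and h: "om u v (v - 2 * u)" "even u" "0 < u" "0 < v - 2 * u" by auto
    have "(v, v + 2 * u) \<in> ?B" using h by (auto simp: PW_def om_def algebra_simps elim!: evenE)
    thus "(\<lambda>(u,v,t). (v, v + 2 * u)) s \<in> ?B \<and>
      (\<lambda>(a,w). ((w - a) div 2, a, 2 * a - w)) ((\<lambda>(u,v,t). (v, v + 2 * u)) s) = s" by (simp add: s)
  next
    fix s assume "s \<in> ?B"
    then obtain a w where s: "s = (a,w)" and h: "(a,w) \<in> PW" "a < w" "w < 2 * a" "4 dvd w - a" by auto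
    then obtain k where k: "w - a = 4 * k" unfolding dvd_def by blast
    have w: "w = a + 4 * k" using k by simp
    have "(2 * k, a, 2 * a - w) \<in> ?B'" using h unfolding w
      by (simp add: PW_def om_def algebra_simps)
    thus "(\<lambda>(a,w). ((w - a) div 2, a, 2 * a - w)) s \<in> ?B' \<and>
      (\<lambda>(u,v,t). (v, v + 2 * u)) ((\<lambda>(a,w). ((w - a) div 2, a, 2 * a - w)) s) = s"
      by (simp add: s w)
  qed
  finally show ?thesis by simp
qed

text \<open>Two reflections of the form do the work, in \<open>(1, -1, 2)\<close> of norm 4 and in
  \<open>(1, -1, 4)\<close> of norm -8. The first acts on the part beyond
  \<open>4 * u = 3 * t + 4 * v\<close>, the second on the part before it with
  \<open>t > u - 2 * v\<close>; the part with \<open>t < u - 2 * v\<close> is the second set with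
  \<open>u\<close> and \<open>v\<close> exchanged. Odd \<open>t\<close> and even
  \<open>u + v\<close> exclude fixed points, so only the face \<open>t = u - 2 * v\<close>
  contributes.\<close>

lemma balanced_parity:
  "even (card {(u,v,t). om u v t \<and> even (u + v) \<and> 0 < u \<and> 0 < v \<and> 0 < t \<and> t < 2 * u - v}
    + card {(u,v,t). om u v t \<and> even (u + v) \<and> 0 < u \<and> 0 < t \<and> t < v - 2 * u}
    + card {(a,w) \<in> PW. a < w \<and> w < 2 * a \<and> \<not> 4 dvd w - a})" (is "even (card ?Q1 + card ?Q2 + card ?B)")
proof -
  let ?L = "{(u,v,t). om u v t \<and> even (u + v) \<and> 0 < v \<and> 0 < t \<and> 3 * t + 4 * v < 4 * u}"
  let ?G = "{(u,v,t). om u v t \<and> even (u + v) \<and> 0 < u \<and> 0 < v \<and> 0 < t \<and> t < 2 * u - v \<and> 4 * u < 3 * t + 4 * v}"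
  let ?Q2' = "{(u,v,t). om u v t \<and> even (u + v) \<and> 0 < v \<and> 0 < t \<and> t < u - 2 * v}"
  let ?B' = "{(u,v,t). om u v t \<and> even (u + v) \<and> 0 < v \<and> 0 < t \<and> t = u - 2 * v}"
  let ?Psi = "{(u,v,t). om u v t \<and> even (u + v) \<and> 0 < v \<and> 0 < t \<and> u - 2 * v < t \<and> 3 * t + 4 * v < 4 * u}"
  have f: "finite ?L" "finite ?G" "finite ?Q2'" "finite ?B'" "finite ?Psi" by (rule finite_om_sub; auto)+
  have "(u,v,t) \<in> ?Q1 \<longleftrightarrow> (u,v,t) \<in> ?L \<union> ?G" for u v t
  proof -
    have "3 * t + 4 * v \<noteq> 4 * u" if "om u v t" using om_odd[OF that] by presburger
    thus ?thesis by auto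
  qed
  hence Q1: "?Q1 = ?L \<union> ?G" by auto
  have c1: "card ?Q1 = card ?L + card ?G" unfolding Q1
    by (rule card_Un_disjoint) (use f in auto)
  have "even (card ?G)"
  proof (rule even_card_involution[OF f(2), where f = "\<lambda>(u,v,t). (2 * v + t - u, 2 * u - t - v, 3 * t + 4 * v - 4 * u)"])
    fix s assume "s \<in> ?G"
    then obtain u v t where s: "s = (u,v,t)" and h: "om u v t" "even (u + v)" "0 < u" "0 < v" "0 < t" "t < 2 * u - v" "4 * u < 3 * t + 4 * v"
      by auto
    have "om (2 * v + t - u) (2 * u - t - v) (3 * t + 4 * v - 4 * u)"
      using h(1) by (simp add: om_def algebra_simps)
    thus "(\<lambda>(u,v,t). (2 * v + t - u, 2 * u - t - v, 3 * t + 4 * v - 4 * u)) s \<in> ?G"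
      using h(2-) om_odd[OF h(1)] by (auto simp: s)
    show "(\<lambda>(u,v,t). (2 * v + t - u, 2 * u - t - v, 3 * t + 4 * v - 4 * u))
      ((\<lambda>(u,v,t). (2 * v + t - u, 2 * u - t - v, 3 * t + 4 * v - 4 * u)) s) = s" by (simp add: s)
    have "2 * v + t - u \<noteq> u" using om_odd[OF h(1)] by presburger
    thus "(\<lambda>(u,v,t). (2 * v + t - u, 2 * u - t - v, 3 * t + 4 * v - 4 * u)) s \<noteq> s" by (simp add: s)
  qed
  have L: "?L = ?Q2' \<union> (?B' \<union> ?Psi)" by auto
  have "card ?L = card ?Q2' + card (?B' \<union> ?Psi)" unfolding L
    by (rule card_Un_disjoint) (use f in auto)
  also have "card (?B' \<union> ?Psi) = card ?B' + card ?Psi"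
    by (rule card_Un_disjoint) (use f in auto)
  also have "card ?Q2' = card ?Q2"
    by (rule card_eq_by_inverse[of _ "\<lambda>(u,v,t). (v,u,t)" _ "\<lambda>(u,v,t). (v,u,t)"]) (auto simp: om_swap)
  also have "card ?B' = card ?B"
  proof (rule card_eq_by_inverse[of _ "\<lambda>(u,v,t). (u, u + 2 * v)" _ "\<lambda>(a,w). (a, (w - a) div 2, 2 * a - w)"])
    fix s assume "s \<in> ?B'"
    then obtain u v where s: "s = (u,v,u - 2 * v)" and h: "om u v (u - 2 * v)" "even (u + v)" "0 < v" "0 < u - 2 * v" by auto
    have "odd u" using om_odd[OF h(1)] by simp
    hence "odd v" using h(2) by simp
    hence "\<not> 4 dvd 2 * v" by presburger
    hence "(u, u + 2 * v) \<in> ?B" using h by (auto simp: PW_def om_def algebra_simps)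
    thus "(\<lambda>(u,v,t). (u, u + 2 * v)) s \<in> ?B \<and>
      (\<lambda>(a,w). (a, (w - a) div 2, 2 * a - w)) ((\<lambda>(u,v,t). (u, u + 2 * v)) s) = s" by (simp add: s)
  next
    fix s assume "s \<in> ?B"
    then obtain a w where s: "s = (a,w)" and h: "(a,w) \<in> PW" "a < w" "w < 2 * a" "\<not> 4 dvd w - a" by auto
    note o = PW_odd[OF h(1)]
    hence "even (w - a)" by simp
    then obtain k where k: "w - a = 2 * k" unfolding dvd_def by blast
    have w: "w = a + 2 * k" using k by simp
    have "odd k" using h(4) k by (auto elim!: evenE)
    hence "(a, k, 2 * a - w) \<in> ?B'" using h o unfolding w
      by (simp add: PW_def om_def algebra_simps)
    thus "(\<lambda>(a,w). (a, (w - a) div 2, 2 * a - w)) s \<in> ?B' \<and>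
      (\<lambda>(u,v,t). (u, u + 2 * v)) ((\<lambda>(a,w). (a, (w - a) div 2, 2 * a - w)) s) = s"
      by (simp add: s w)
  qed
  finally have cL: "card ?L = card ?Q2 + (card ?B + card ?Psi)" .
  have "even (card ?Psi)"
  proof (rule even_card_involution[OF f(5), where f = "\<lambda>(u,v,t). (2 * u - v - t, t - u + 2 * v, 4 * u - 4 * v - 3 * t)"])
    fix s assume "s \<in> ?Psi"
    then obtain u v t where s: "s = (u,v,t)" and h: "om u v t" "even (u + v)" "0 < v" "0 < t" "u - 2 * v < t" "3 * t + 4 * v < 4 * u"
      by auto
    have "om (2 * u - v - t) (t - u + 2 * v) (4 * u - 4 * v - 3 * t)"
      using h(1) by (simp add: om_def algebra_simps)
    thus "(\<lambda>(u,v,t). (2 * u - v - t, t - u + 2 * v, 4 * u - 4 * v - 3 * t)) s \<in> ?Psi"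
      using h(2-) by (auto simp: s)
    show "(\<lambda>(u,v,t). (2 * u - v - t, t - u + 2 * v, 4 * u - 4 * v - 3 * t))
      ((\<lambda>(u,v,t). (2 * u - v - t, t - u + 2 * v, 4 * u - 4 * v - 3 * t)) s) = s" by (simp add: s)
    have "2 * u - v - t \<noteq> u" using om_odd[OF h(1)] h(2) by presburger
    thus "(\<lambda>(u,v,t). (2 * u - v - t, t - u + 2 * v, 4 * u - 4 * v - 3 * t)) s \<noteq> s" by (simp add: s)
  qed
  with cL c1 \<open>even (card ?G)\<close> show ?thesis by auto
qed

text \<open>Exactly one of \<open>odd v\<close> and \<open>even u\<close> holds if and only if
  \<open>u + v\<close> is even. So the leftovers with \<open>odd v\<close> and those with
  \<open>even u\<close> combine modulo 2 into the two sets of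
  \<open>balanced_parity\<close>.\<close>

lemma diag_Tern_parity:
  "even (card {(y,x,z) \<in> Tern. 4 * z \<le> \<bar>x - y\<bar>} + card {(a,b,c,l) \<in> Quad. 8 dvd a + b \<and> c = l}
    + card Wo + card {(a,w) \<in> PW. a < w} + card {(a,w) \<in> PW. w < a \<and> (a + w) mod 4 = 2})"
proof -
  let ?T3 = "{(u,v,t). om u v t \<and> even u \<and> 0 < u \<and> 0 < t \<and> t < 2 * v \<and> 2 * u \<le> \<bar>t - v\<bar>}"
  let ?T3a = "{(u,v,t). om u v t \<and> even u \<and> 0 < u \<and> 2 * u + v \<le> t \<and> t < 2 * v}"
  let ?T3b = "{(u,v,t). om u v t \<and> even u \<and> 0 < u \<and> 0 < t \<and> t \<le> v - 2 * u}"
  let ?P1 = "{(u,v,t). om u v t \<and> 0 < u \<and> odd v \<and> 0 < t \<and> t < v - 2 * u}"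
  let ?P2 = "{(u,v,t). om u v t \<and> 0 < u \<and> odd v \<and> 0 < v \<and> 0 < t \<and> t < 2 * u - v}"
  let ?P3 = "{(u,v,t). om u v t \<and> even u \<and> 0 < u \<and> 0 < t \<and> t < v - 2 * u}"
  let ?P4 = "{(u,v,t). om u v t \<and> even u \<and> 0 < u \<and> 0 < v \<and> 0 < t \<and> t < 2 * u - v}"
  let ?Q1 = "{(u,v,t). om u v t \<and> even (u + v) \<and> 0 < u \<and> 0 < v \<and> 0 < t \<and> t < 2 * u - v}"
  let ?Q2 = "{(u,v,t). om u v t \<and> even (u + v) \<and> 0 < u \<and> 0 < t \<and> t < v - 2 * u}"
  let ?R = "{(u,v,t). om u v t \<and> 0 < u \<and> odd v \<and> 0 < t \<and> 2 * u - v < t \<and> t < 2 * u}"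
  let ?S = "{(u,v,t). om u v t \<and> odd v \<and> 0 \<le> u \<and> 2 * u - v < t \<and> t < 2 * u}"
  let ?b1 = "card {(a,w) \<in> PW. w < a \<and> (a + w) mod 4 = 2}"
  let ?b2 = "card {(a,w) \<in> PW. 2 * a < w}"
  let ?b3 = "card {(a,w) \<in> PW. a < w \<and> w < 2 * a \<and> 4 dvd w - a}"
  let ?b4 = "card {(a,w) \<in> PW. a < w \<and> w < 2 * a \<and> \<not> 4 dvd w - a}"
  have f: "finite ?T3a" "finite ?T3b" "finite ?P1" "finite ?P3" "finite ?Q2"
    by (rule finite_om_sub'; auto)+
  have f': "finite ?P2" "finite ?P4" "finite ?Q1" by (rule finite_om_sub; auto)+
  have T3: "?T3 = ?T3a \<union> ?T3b" by auto
  have t: "card ?T3 = card ?T3a + card ?T3b" unfolding T3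
    by (rule card_Un_disjoint) (use f in auto)
  have "(?P1 - ?P3) \<union> (?P3 - ?P1) = ?Q2" by auto
  hence q2: "even (card ?P1 + card ?P3) = even (card ?Q2)"
    by (simp only: even_card_sym_diff[OF f(3,4)])
  have "(?P2 - ?P4) \<union> (?P4 - ?P2) = ?Q1" by auto
  hence q1: "even (card ?P2 + card ?P4) = even (card ?Q1)"
    by (simp only: even_card_sym_diff[OF f'(1,2)])
  have "{(a,w) \<in> PW. a < w} = {(a,w) \<in> PW. 2 * a < w} \<union>
     ({(a,w) \<in> PW. a < w \<and> w < 2 * a \<and> 4 dvd w - a} \<union> {(a,w) \<in> PW. a < w \<and> w < 2 * a \<and> \<not> 4 dvd w - a})"
    (is "?W = ?W2 \<union> (?W3 \<union> ?W4)")
  proof -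
    have "a < w \<longleftrightarrow> 2 * a < w \<or> (a < w \<and> w < 2 * a)" if "(a,w) \<in> PW" for a w
    proof -
      have "w \<noteq> 2 * a" using PW_odd(2)[OF that] by auto
      moreover have "0 < a" using that by (simp add: PW_def)
      ultimately show ?thesis by linarith
    qed
    thus ?thesis by auto
  qed
  moreover have "card (?W2 \<union> (?W3 \<union> ?W4)) = card ?W2 + card (?W3 \<union> ?W4)"
    by (rule card_Un_disjoint) (use finite_PW' in auto)
  moreover have "card (?W3 \<union> ?W4) = card ?W3 + card ?W4"
    by (rule card_Un_disjoint) (use finite_PW' in auto)
  ultimately have b: "card ?W = ?b2 + ?b3 + ?b4" by simp
  have "even (t3 + d + wo + w + b1)"
    if "t3 = a + b" "a = s" "s = b1 + p1 + r" "wo = r + b2 + p2" "b = b3 + p3" "d = p4"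
      "even (p1 + p3) = even q2" "even (p2 + p4) = even q1" "even (q1 + q2 + b4)" "w = b2 + b3 + b4"
    for t3 a b s b1 p1 r wo b2 p2 b3 p3 d p4 q1 q2 b4 w :: nat
    using that(7-9) unfolding that(1-6,10) by auto
  from this[OF t card_T3a T3a_parts Wo_parts T3b_parts card_diag_om q2 q1 balanced_parity b]
  show ?thesis unfolding card_Tern_om .
qed

end

section \<open>Boundary terms\<close>

lemma card_multiples_4: "card {k::int. L < 4 * k \<and> 4 * k < R} = nat ((R - 1) div 4 - L div 4)"
proof -
  have "{k::int. L < 4 * k \<and> 4 * k < R} = {L div 4 + 1..(R - 1) div 4}" by auto
  thus ?thesis by simp
qed

text \<open>The two quotient terms count the possible \<open>z = 2 * k\<close> over a fixed
  factorisation in \<open>Edge1\<close> and in \<open>Edge2\<close>. Writing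
  \<open>a = 8 * A + i\<close> and \<open>w = 4 * W + j\<close>, the contributions of
  \<open>A\<close> and \<open>W\<close> add up to an even number, and a finite check over
  \<open>i\<close> and \<open>j\<close> remains.\<close>

lemma edge_parity:
  fixes a w :: int
  assumes "odd a" "odd w" "0 < a" "0 < w" "a \<noteq> w"
  shows "even (nat ((a - 1) div 4 - max 0 (a - w) div 4) + nat ((a + w - 1) div 4 - max 0 (w - a) div 4)
     + of_bool (a mod 8 = 1 \<or> a mod 8 = 7) + of_bool (a < w) + (of_bool (w < a \<and> (a + w) mod 4 = 2) :: nat))"
proof -
  have n: "even (nat x + nat y + k + k' + k'') \<longleftrightarrow> even (x + y + int k + int k' + int k'')"
    if "0 \<le> x" "0 \<le> y" for x y k k' k''
    using that by (simp add: even_nat_iff)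
  define A i W j where defs: "A = a div 8" "i = a mod 8" "W = w div 4" "j = w mod 4"
  have a: "a = 8 * A + i" and w: "w = 4 * W + j" by (simp_all add: defs)
  have ij: "i \<in> {1,3,5,7}" "j \<in> {1,3}" using assms(1,2) unfolding defs by (simp, presburger)+
  have d: "(4 * x + y) div 4 = x + y div 4" for x y :: int by simp
  have d1: "(a - 1) div 4 = 2 * A + (i - 1) div 4" "(a + w - 1) div 4 = 2 * A + W + (i + j - 1) div 4"
    "(w - a) div 4 = W - 2 * A + (j - i) div 4" "(a - w) div 4 = 2 * A - W + (i - j) div 4"
    using d[of "2 * A" "i - 1"] d[of "2 * A + W" "i + j - 1"] d[of "W - 2 * A" "j - i"] d[of "2 * A - W" "i - j"]
    unfolding a w by (simp_all add: algebra_simps)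
  have m: "(a + w) mod 4 = (i + j) mod 4" "a mod 8 = i"
  proof -
    have "(4 * x + y) mod 4 = y mod 4" for x y :: int by simp
    from this[of "2 * A + W" "i + j"] show "(a + w) mod 4 = (i + j) mod 4"
      unfolding a w by (simp add: algebra_simps)
  qed (simp add: defs)
  have nn: "0 \<le> (a - 1) div 4 - max 0 (a - w) div 4" "0 \<le> (a + w - 1) div 4 - max 0 (w - a) div 4"
    using assms(3,4) by (simp_all add: zdiv_mono1)
  show ?thesis
  proof (cases "a < w")
    case True
    hence mx: "max 0 (a - w) div 4 = 0" "max 0 (w - a) = w - a" "\<not> w < a" by simp_all
    have "even (2 * A + (i - 1) div 4 + (2 * A + W + (i + j - 1) div 4 - (W - 2 * A + (j - i) div 4))
        + (if i = 1 \<or> i = 7 then 1 else 0) + 1)"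
      using ij by auto
    thus ?thesis unfolding n[OF nn] unfolding mx d1 m using ij mx(3) True
      by (elim insertE emptyE) (simp_all only: refl simp_thms of_bool_def if_True if_False, simp_all)
  next
    case False
    hence mx: "max 0 (w - a) div 4 = 0" "max 0 (a - w) = a - w" "w < a" using assms(5) by simp_all
    have "even (2 * A + (i - 1) div 4 - (2 * A - W + (i - j) div 4) + (2 * A + W + (i + j - 1) div 4)
        + (if i = 1 \<or> i = 7 then 1 else 0) + (if (i + j) mod 4 = 2 then 1 else 0))"
      using ij by auto
    thus ?thesis unfolding n[OF nn] unfolding mx d1 m using ij mx(3) False
      by (elim insertE emptyE) (simp_all only: refl simp_thms of_bool_def if_True if_False, simp_all)
  qed
qed

context three_mod_four begin

lemma sum_PW_card: "card {(a,w) \<in> PW. Q a w} = (\<Sum>(a,w)\<in>PW. of_bool (Q a w))"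
proof -
  have "(\<Sum>(a,w)\<in>PW. of_bool (Q a w)) = (\<Sum>x\<in>PW. if case x of (a,w) \<Rightarrow> Q a w then 1 else (0::nat))"
    by (rule sum.cong) auto
  also have "\<dots> = card (PW \<inter> {x. case x of (a,w) \<Rightarrow> Q a w})"
    using finite_PW by (subst sum.If_cases) auto
  also have "PW \<inter> {x. case x of (a,w) \<Rightarrow> Q a w} = {(a,w) \<in> PW. Q a w}" by auto
  finally show ?thesis by simp
qed

lemma card_fibres_PW:
  assumes "finite S" "\<And>a w k. (a,w,k) \<in> S \<longleftrightarrow> (a,w) \<in> PW \<and> L a w < 4 * k \<and> 4 * k < R a w"
  shows "card S = (\<Sum>(a,w)\<in>PW. nat ((R a w - 1) div 4 - L a w div 4))"
proof -
  have f: "finite {k::int. L a w < 4 * k \<and> 4 * k < R a w}" for a w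
    by (rule finite_subset[of _ "{L a w div 4..R a w div 4}"]) auto
  have "card S = card (SIGMA x:PW. case x of (a,w) \<Rightarrow> {k. L a w < 4 * k \<and> 4 * k < R a w})"
    by (rule card_eq_by_inverse[of _ "\<lambda>(a,w,k). ((a,w),k)" _ "\<lambda>((a,w),k). (a,w,k)"])
       (use assms(2) in auto)
  also have "\<dots> = (\<Sum>x\<in>PW. card (case x of (a,w) \<Rightarrow> {k. L a w < 4 * k \<and> 4 * k < R a w}))"
    by (rule card_SigmaI) (use finite_PW f in auto)
  also have "\<dots> = (\<Sum>(a,w)\<in>PW. nat ((R a w - 1) div 4 - L a w div 4))"
    by (rule sum.cong) (auto simp: card_multiples_4)
  finally show ?thesis .
qed

lemma card_Edge:
  "card Edge1 = (\<Sum>(a,w)\<in>PW. nat ((a - 1) div 4 - max 0 (a - w) div 4))"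
  "card Edge2 = (\<Sum>(a,w)\<in>PW. nat ((a + w - 1) div 4 - max 0 (w - a) div 4))"
proof -
  let ?A = "{(a,w,k). (a,w) \<in> PW \<and> max 0 (a - w) < 4 * k \<and> 4 * k < a}"
  let ?B = "{(a,w,k). (a,w) \<in> PW \<and> max 0 (w - a) < 4 * k \<and> 4 * k < a + w}"
  have A: "(\<lambda>(a,w,z). (a,w,z div 2)) s \<in> ?A \<and> (\<lambda>(a,w,k). (a,w,2*k)) ((\<lambda>(a,w,z). (a,w,z div 2)) s) = s"
    if "s \<in> Edge1" for s
    using that by (auto simp: Edge1_def PW_def elim!: evenE)
  have B: "(\<lambda>(a,w,z). (a,w,z div 2)) s \<in> ?B \<and> (\<lambda>(a,w,k). (a,w,2*k)) ((\<lambda>(a,w,z). (a,w,z div 2)) s) = s"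
    if "s \<in> Edge2" for s
    using that by (auto simp: Edge2_def PW_def elim!: evenE)
  have A': "(\<lambda>(a,w,k). (a,w,2*k)) s \<in> Edge1 \<and> (\<lambda>(a,w,z). (a,w,z div 2)) ((\<lambda>(a,w,k). (a,w,2*k)) s) = s"
    if "s \<in> ?A" for s
    using that PW_odd by (auto simp: Edge1_def) (auto simp: PW_def)
  have B': "(\<lambda>(a,w,k). (a,w,2*k)) s \<in> Edge2 \<and> (\<lambda>(a,w,z). (a,w,z div 2)) ((\<lambda>(a,w,k). (a,w,2*k)) s) = s"
    if "s \<in> ?B" for s
    using that PW_odd by (auto simp: Edge2_def) (auto simp: PW_def)
  have f: "finite S" if "\<And>a w k. (a,w,k) \<in> S \<Longrightarrow> (a,w) \<in> PW \<and> 0 < 4 * k \<and> 4 * k < a + w" for S :: "(int \<times> int \<times> int) set"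
  proof (rule finite_subset)
    show "S \<subseteq> {1..M} \<times> {1..M} \<times> {0..2 * M}"
    proof
      fix s assume "s \<in> S"
      then obtain a w k where s: "s = (a,w,k)" and "(a,w,k) \<in> S" by (cases s) auto
      hence h: "0 < a" "0 < w" "a * (a + 2 * w) = M" "0 < 4 * k" "4 * k < a + w"
        using that[of a w k] by (auto simp: PW_def)
      thus "s \<in> {1..M} \<times> {1..M} \<times> {0..2 * M}"
        using pos_factors_le[of a "a + 2 * w"] by (auto simp: s)
    qed
  qed auto
  have fA: "finite ?A" by (rule f) (auto simp: PW_def)
  have fB: "finite ?B" by (rule f) auto
  have "card Edge1 = card ?A" by (rule card_eq_by_inverse[OF A A'])
  also have "\<dots> = (\<Sum>(a,w)\<in>PW. nat ((a - 1) div 4 - max 0 (a - w) div 4))"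
    by (rule card_fibres_PW[OF fA]) auto
  finally show "card Edge1 = \<dots>" .
  have "card Edge2 = card ?B" by (rule card_eq_by_inverse[OF B B'])
  also have "\<dots> = (\<Sum>(a,w)\<in>PW. nat ((a + w - 1) div 4 - max 0 (w - a) div 4))"
    by (rule card_fibres_PW[OF fB]) auto
  finally show "card Edge2 = \<dots>" .
qed

text \<open>The hypothesis rules out \<open>a = w\<close>, where \<open>a * (a + 2 * w)\<close> is
  \<open>3 * a * a\<close>; \<open>edge_parity\<close> can then be summed over all
  factorisations.\<close>

lemma Edge_parity:
  assumes "\<And>x. M \<noteq> 3 * x * x"
  shows "even (card Edge1 + card Edge2 + card {(a,w) \<in> PW. a mod 8 = 1 \<or> a mod 8 = 7}
    + card {(a,w) \<in> PW. a < w} + card {(a,w) \<in> PW. w < a \<and> (a + w) mod 4 = 2})"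
proof -
  have "even (\<Sum>(a,w)\<in>PW. nat ((a - 1) div 4 - max 0 (a - w) div 4) + nat ((a + w - 1) div 4 - max 0 (w - a) div 4)
     + of_bool (a mod 8 = 1 \<or> a mod 8 = 7) + of_bool (a < w) + of_bool (w < a \<and> (a + w) mod 4 = 2))"
  proof (rule dvd_sum)
    fix s assume "s \<in> PW"
    then obtain a w where s: "s = (a,w)" "(a,w) \<in> PW" by (cases s) auto
    hence "0 < a" "0 < w" "a \<noteq> w" using assms[of a] by (auto simp: PW_def algebra_simps)
    thus "even (case s of (a,w) \<Rightarrow> nat ((a - 1) div 4 - max 0 (a - w) div 4) + nat ((a + w - 1) div 4 - max 0 (w - a) div 4)
     + of_bool (a mod 8 = 1 \<or> a mod 8 = 7) + of_bool (a < w) + (of_bool (w < a \<and> (a + w) mod 4 = 2)::nat))"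
      using edge_parity[OF PW_odd[OF s(2)]] unfolding s by simp
  qed
  thus ?thesis unfolding card_Edge sum_PW_card by (simp only: sum.distrib case_prod_unfold)
qed

end

section \<open>Windows of residues\<close>

lemma ex_floor_sqrt: "0 \<le> (m::int) \<Longrightarrow> \<exists>r\<ge>0. r * r \<le> m \<and> m < (r + 1) * (r + 1)"
proof (induction m rule: int_ge_induct)
  case base
  show ?case by (intro exI[of _ 0]) simp
next
  case (step m)
  then obtain r where r: "0 \<le> r" "r * r \<le> m" "m < (r + 1) * (r + 1)" by blast
  show ?case
  proof (cases "m + 1 = (r + 1) * (r + 1)")
    case True
    hence "m + 1 < (r + 1 + 1) * (r + 1 + 1)" using r(1) by (simp add: algebra_simps)
    thus ?thesis using r True by (intro exI[of _ "r + 1"]) auto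
  next
    case False
    thus ?thesis using r by (intro exI[of _ r]) auto
  qed
qed

lemma mult_mod4_eq1:
  fixes a b :: int assumes "a * b mod 4 = 1" shows "4 dvd b - a"
proof -
  have "(a mod 4) * (b mod 4) mod 4 = 1" using assms by (simp add: mod_mult_eq)
  hence "(a mod 4 = 1 \<and> b mod 4 = 1) \<or> (a mod 4 = 3 \<and> b mod 4 = 3)"
    using mod4_cases[of a] mod4_cases[of b] by auto
  thus ?thesis by presburger
qed

text \<open>Chosen for its behaviour on odd numbers: it ignores the sign, flips when 4 times an odd
  number is added and is unchanged when 4 times an even number is added. For odd \<open>v\<close> it
  therefore distinguishes \<open>t + 2 * v\<close> from \<open>t - 2 * v\<close>, for even
  \<open>v\<close> it does not.\<close>

definition pm1 :: "int \<Rightarrow> bool" where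
  "pm1 g \<longleftrightarrow> g mod 8 = 1 \<or> g mod 8 = 7"

lemma pm1_minus: "pm1 (- g) \<longleftrightarrow> pm1 g"
  unfolding pm1_def by presburger

lemma pm1_odd: "pm1 g \<Longrightarrow> odd g"
  unfolding pm1_def by presburger

lemma pm1_add_odd: assumes "odd g" "odd v" shows "pm1 (g + 4 * v) \<longleftrightarrow> \<not> pm1 g"
proof -
  obtain k where v: "v = 2 * k + 1" using assms(2) by (elim oddE)
  have "g + 4 * v = (g + 4) + 8 * k" unfolding v by simp
  hence "(g + 4 * v) mod 8 = (g + 4) mod 8" by (simp only: mod_mult_self2)
  moreover have "(g + 4) mod 8 = 1 \<or> (g + 4) mod 8 = 7 \<longleftrightarrow> \<not> pm1 g"
    using assms(1) unfolding pm1_def by presburger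
  ultimately show ?thesis by (simp add: pm1_def)
qed

lemma pm1_add_even: assumes "even v" shows "pm1 (g + 4 * v) \<longleftrightarrow> pm1 g"
proof -
  obtain k where v: "v = 2 * k" using assms by (elim evenE)
  show ?thesis unfolding v pm1_def by (simp add: algebra_simps)
qed

context three_mod_four begin

text \<open>Here \<open>M\<close> is \<open>(a + w)^2 - w^2\<close> with \<open>a + w\<close> even.
  The first square is 0 or 4 modulo 16, the second is 1 modulo 16 for \<open>w\<close> congruent to
  1 or 7 modulo 8, and 9 otherwise.\<close>

lemma PW_sqrt_mod: assumes "(a,w) \<in> PW" shows "(w mod 8 = 1 \<or> w mod 8 = 7) \<longleftrightarrow> (M mod 16 = 3 \<or> M mod 16 = 15)"
proof -
  have e: "M = a * (a + 2 * w)" using assms by (simp add: PW_def)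
  have o: "odd a" "odd w" using PW_odd[OF assms] .
  define i j where ij: "i = a mod 16" "j = w mod 16"
  define A W where AW: "A = a div 16" "W = w div 16"
  have aw: "a = 16 * A + i" "w = 16 * W + j" by (simp_all add: ij AW)
  have "M = i * (i + 2 * j) + 16 * (A * (a + 2 * w) + i * (A + 2 * W))"
    unfolding e aw by (simp add: algebra_simps)
  hence e': "M mod 16 = i * (i + 2 * j) mod 16" by (simp only: mod_mult_self2)
  have ij': "i \<in> {1,3,5,7,9,11,13,15}" "j \<in> {1,3,5,7,9,11,13,15}" "w mod 8 = j mod 8"
    using o unfolding ij by (simp, presburger, simp, presburger, simp add: mod_mod_cancel)
  have t: "\<forall>i\<in>{1,3,5,7,9,11,13,15::int}. \<forall>j\<in>{1,3,5,7,9,11,13,15::int}.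
      (j mod 8 = 1 \<or> j mod 8 = 7) = (i * (i + 2 * j) mod 16 = 3 \<or> i * (i + 2 * j) mod 16 = 15)"
    by simp
  show ?thesis using bspec[OF bspec[OF t ij'(1)] ij'(2)] by (simp only: e' ij'(3))
qed

text \<open>Counting \<open>Win\<close> in two ways, by the sign changes of \<open>v\<close> and \<open>t\<close> and along the fibres of
  \<open>g = t - 2v\<close>, evaluates the parity of \<open>Wo\<close>.\<close>

definition Win :: "(int \<times> int \<times> int) set" where
  "Win = {(u,v,t). om u v t \<and> - 2 * u < t \<and> t < 2 * u \<and> 0 < t - 2 * v \<and> pm1 (t - 2 * v)}"

lemma finite_Win: "finite Win"
  by (rule finite_om_sub) (auto simp: Win_def)

text \<open>The four choices of signs for \<open>v\<close> and \<open>t\<close> give the values plus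
  or minus \<open>t\<close> plus or minus \<open>2 * v\<close>. As \<open>t + 2 * v\<close> and
  \<open>t - 2 * v\<close> differ by 4 times an odd number, \<open>pm1\<close> singles out one of
  them up to sign, and positivity fixes the sign. Each element of \<open>Wo\<close> thus has exactly
  one signed version in \<open>Win\<close>.\<close>

lemma Win_odd: "card {(u,v,t) \<in> Win. odd v} = card Wo"
proof -
  let ?f = "\<lambda>(u::int,v::int,t::int). (u, \<bar>v\<bar>, \<bar>t\<bar>)"
  let ?g = "\<lambda>(u::int,v::int,t::int). if pm1 (t + 2 * v) then (u, - v, t)
     else if 0 < t - 2 * v then (u, v, t) else (u, - v, - t)"
  show ?thesis
  proof (rule card_eq_by_inverse[of _ ?f _ ?g])
    fix s assume "s \<in> {(u,v,t) \<in> Win. odd v}"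
    then obtain u v t where s: "s = (u,v,t)" and h: "om u v t" "- 2 * u < t" "t < 2 * u" "0 < t - 2 * v"
       "pm1 (t - 2 * v)" "odd v" by (auto simp: Win_def)
    have o: "odd t" using om_odd[OF h(1)] .
    have nz: "t \<noteq> 0" "v \<noteq> 0" using o h(6) by auto
    have "?f s \<in> Wo" using h nz by (auto simp: s Wo_def om_def)
    moreover have "?g (?f s) = s"
    proof (cases "0 < t")
      case True
      show ?thesis
      proof (cases "0 < v")
        case True
        have "\<not> pm1 (t + 2 * v)" using pm1_add_odd[OF pm1_odd[OF h(5)] h(6)] h(5) by (simp add: algebra_simps)
        thus ?thesis using \<open>0 < t\<close> True h(4) by (simp add: s)
      next
        case False
        hence "\<bar>v\<bar> = - v" using nz by simp
        thus ?thesis using \<open>0 < t\<close> h(5) by (simp add: s)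
      qed
    next
      case False
      hence t: "\<bar>t\<bar> = - t" and v: "\<bar>v\<bar> = - v" "v < 0" using h(4) nz by auto
      have "pm1 (- (t - 2 * v) + 4 * - v) \<longleftrightarrow> \<not> pm1 (- (t - 2 * v))"
        by (rule pm1_add_odd) (use pm1_odd[OF h(5)] h(6) in auto)
      hence "\<not> pm1 (- t + 2 * - v)" using h(5) pm1_minus[of "t - 2 * v"] by (simp add: algebra_simps)
      moreover have "\<not> 0 < - t - 2 * - v" using h(4) by simp
      ultimately show ?thesis unfolding s by (simp only: prod.case t v if_False minus_minus)
    qed
    ultimately show "?f s \<in> Wo \<and> ?g (?f s) = s" ..
  next
    fix s assume "s \<in> Wo"
    then obtain u v t where s: "s = (u,v,t)" and h: "om u v t" "0 < u" "odd v" "0 < v" "0 < t" "t < 2 * u"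
      by (auto simp: Wo_def)
    have o: "odd t" using om_odd[OF h(1)] .
    have m: "om u (- v) t" "om u (- v) (- t)" using h(1) by (simp_all add: om_def)
    show "?g s \<in> {(u,v,t) \<in> Win. odd v} \<and> ?f (?g s) = s"
    proof (cases "pm1 (t + 2 * v)")
      case True
      thus ?thesis using h m by (auto simp: s Win_def)
    next
      case False
      have "pm1 (t + 2 * v + 4 * - v) \<longleftrightarrow> \<not> pm1 (t + 2 * v)"
        by (rule pm1_add_odd) (use o h(3) in auto)
      with False have a: "pm1 (t - 2 * v)" "pm1 (2 * v - t)"
        using pm1_minus[of "t - 2 * v"] by (simp_all add: algebra_simps)
      have "t \<noteq> 2 * v" using o by auto
      with False a show ?thesis using h m by (auto simp: s Win_def)
    qed
  qed
qed

lemma Win_zero: "card {(u,v,t) \<in> Win. v = 0} = card {(a,w) \<in> PW. pm1 w}"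
proof (rule card_eq_by_inverse[of _ "\<lambda>(u,v,t). (2 * u - t, t)" _ "\<lambda>(a,w). ((a + w) div 2, 0, w)"])
  fix s assume "s \<in> {(u,v,t) \<in> Win. v = 0}"
  thus "(\<lambda>(u,v,t). (2 * u - t, t)) s \<in> {(a,w) \<in> PW. pm1 w} \<and>
     (\<lambda>(a,w). ((a + w) div 2, 0, w)) ((\<lambda>(u,v,t). (2 * u - t, t)) s) = s"
    by (auto simp: Win_def PW_def om_def algebra_simps)
next
  fix s assume "s \<in> {(a,w) \<in> PW. pm1 w}"
  then obtain a w where s: "s = (a,w)" and h: "(a,w) \<in> PW" "pm1 w" by auto
  have "even (a + w)" using PW_odd[OF h(1)] by simp
  then obtain k where k: "a + w = 2 * k" unfolding dvd_def by blast
  have a: "a = 2 * k - w" using k by simp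
  have "(k, 0, w) \<in> Win" using h unfolding a by (auto simp: Win_def PW_def om_def algebra_simps)
  thus "(\<lambda>(a,w). ((a + w) div 2, 0, w)) s \<in> {(u,v,t) \<in> Win. v = 0} \<and>
     (\<lambda>(u,v,t). (2 * u - t, t)) ((\<lambda>(a,w). ((a + w) div 2, 0, w)) s) = s"
    by (simp add: s a)
qed

text \<open>For even \<open>v\<close> all sign choices satisfy \<open>pm1\<close> or none does, so
  exactly two of the four lie in \<open>Win\<close>, namely those with positive
  \<open>t - 2 * v\<close>; the involution exchanges these two.\<close>

lemma Win_even: "even (card {(u,v,t) \<in> Win. even v \<and> v \<noteq> 0})"
proof (rule even_card_involution[where f = "\<lambda>(u,v,t). if 0 < t + 2 * v then (u, - v, t) else (u, v, - t)"])
  show "finite {(u,v,t) \<in> Win. even v \<and> v \<noteq> 0}" by (rule finite_subset[OF _ finite_Win]) auto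
  fix s assume "s \<in> {(u,v,t) \<in> Win. even v \<and> v \<noteq> 0}"
  then obtain u v t where s: "s = (u,v,t)" and h: "om u v t" "- 2 * u < t" "t < 2 * u" "0 < t - 2 * v"
       "pm1 (t - 2 * v)" "even v" "v \<noteq> 0" by (auto simp: Win_def)
  have o: "odd t" using om_odd[OF h(1)] .
  hence "t + 2 * v \<noteq> 0" "t \<noteq> 0" by presburger+
  moreover have "pm1 (t + 2 * v)" "pm1 (- t - 2 * v)"
    using pm1_add_even[OF h(6), of "t - 2 * v"] h(5) pm1_minus[of "t + 2 * v"] by (simp_all add: algebra_simps)
  moreover have "om u (- v) t" "om u v (- t)" using h(1) by (simp_all add: om_def)
  ultimately show "(\<lambda>(u,v,t). if 0 < t + 2 * v then (u, - v, t) else (u, v, - t)) s \<in> {(u,v,t) \<in> Win. even v \<and> v \<noteq> 0}"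
    "(\<lambda>(u,v,t). if 0 < t + 2 * v then (u, - v, t) else (u, v, - t))
       ((\<lambda>(u,v,t). if 0 < t + 2 * v then (u, - v, t) else (u, v, - t)) s) = s"
    "(\<lambda>(u,v,t). if 0 < t + 2 * v then (u, - v, t) else (u, v, - t)) s \<noteq> s"
    using h by (auto simp: s Win_def)
qed

lemma Win_Wo_parity: "even (card Win) \<longleftrightarrow> even (card Wo + card {(a,w) \<in> PW. pm1 w})"
proof -
  let ?A = "{(u,v,t) \<in> Win. odd v}" and ?B = "{(u,v,t) \<in> Win. v = 0}" and ?C = "{(u,v,t) \<in> Win. even v \<and> v \<noteq> 0}"
  have f: "finite ?A" "finite ?B" "finite ?C" by (rule finite_subset[OF _ finite_Win]; auto)+
  have W: "Win = ?A \<union> (?B \<union> ?C)" by blast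
  have "card (?B \<union> ?C) = card ?B + card ?C"
    by (rule card_Un_disjoint[OF f(2,3)]) blast
  moreover have "card (?A \<union> (?B \<union> ?C)) = card ?A + card (?B \<union> ?C)"
    by (rule card_Un_disjoint[OF f(1) finite_UnI[OF f(2,3)]]) auto
  ultimately have "card Win = card Wo + (card {(a,w) \<in> PW. pm1 w} + card ?C)"
    by (subst W) (simp only: Win_odd Win_zero)
  moreover have "even (card ?C)" by (rule Win_even)
  ultimately show ?thesis by (simp only: even_add simp_thms)
qed

text \<open>With \<open>g = t - 2 * v\<close> the equation is
  \<open>4 * u * u - M = g * (g + 4 * v)\<close>, so \<open>g\<close> and \<open>u\<close> determine
  \<open>v\<close> and \<open>t\<close>. The bounds on \<open>t\<close> translate by
  \<open>(2 * u + g)^2 - M = 2 * g * (2 * u + t)\<close> and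
  \<open>M - (2 * u - g)^2 = 2 * g * (2 * u - t)\<close>.\<close>

lemma Win_fibre: "card Win = card {(g,u). 0 < g \<and> pm1 g \<and> g dvd 4 * u * u - M
     \<and> (2 * u - g) * (2 * u - g) < M \<and> M < (2 * u + g) * (2 * u + g)}" (is "_ = card ?Z")
  and finite_Win_fibre: "finite {(g,u). 0 < g \<and> pm1 g \<and> g dvd 4 * u * u - M
     \<and> (2 * u - g) * (2 * u - g) < M \<and> M < (2 * u + g) * (2 * u + g)}"
proof -
  let ?f = "\<lambda>(u::int,v::int,t::int). (t - 2 * v, u)"
  let ?h = "\<lambda>(g,u). ((4 * u * u - M) div g - g) div 4"
  let ?g = "\<lambda>(g,u). (u, ?h (g,u), g + 2 * ?h (g,u))"
  have 1: "?f s \<in> ?Z \<and> ?g (?f s) = s" if sW: "s \<in> Win" for s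
  proof -
    obtain u v t where s: "s = (u,v,t)" and h: "om u v t" "- 2 * u < t" "t < 2 * u" "0 < t - 2 * v"
       "pm1 (t - 2 * v)" using sW by (auto simp: Win_def)
    define g where "g = t - 2 * v"
    have t: "t = g + 2 * v" by (simp add: g_def)
    have g: "0 < g" using h by (simp add: g_def)
    have e: "4 * u * u - M = g * (g + 4 * v)" using h(1) unfolding om_def t by (simp add: algebra_simps)
    have "0 < 2 * g * (2 * u - t)" "0 < 2 * g * (2 * u + t)" using g h by simp_all
    hence "(2 * u - g) * (2 * u - g) < M" "M < (2 * u + g) * (2 * u + g)"
      using e unfolding t by (simp_all add: algebra_simps)
    moreover have "g dvd 4 * u * u - M" unfolding e by simp
    moreover have "(4 * u * u - M) div g = g + 4 * v" unfolding e using g by simp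
    ultimately show ?thesis using h g by (auto simp: s g_def[symmetric] t)
  qed
  have 2: "?g s \<in> Win \<and> ?f (?g s) = s" if sZ: "s \<in> ?Z" for s
  proof -
    obtain g u where s: "s = (g,u)" and h: "0 < g" "pm1 g" "g dvd 4 * u * u - M"
      "(2 * u - g) * (2 * u - g) < M" "M < (2 * u + g) * (2 * u + g)" using sZ by auto
    obtain k where k: "4 * u * u - M = g * k" using h(3) by (elim dvdE)
    \<comment> \<open>Integrality of \<open>v\<close> costs nothing: a product that is 1 modulo 4
      has factors congruent modulo 4.\<close>
    have "g * k = 4 * (u * u) - M" using k by simp
    hence "g * k mod 4 = 1" using M_mod4 by presburger
    hence "4 dvd k - g" by (rule mult_mod4_eq1)
    then obtain v where v: "k - g = 4 * v" by (elim dvdE)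
    have kk: "k = g + 4 * v" using v by simp
    have hv: "?h (g,u) = v" unfolding prod.case k using h(1) v by simp
    have om: "om u v (g + 2 * v)" using k unfolding om_def kk by (simp add: algebra_simps)
    have "0 < 2 * g * (2 * u - (g + 2 * v))" "0 < 2 * g * (2 * u + (g + 2 * v))"
      using h(4,5) k unfolding kk by (simp_all add: algebra_simps)
    hence "0 < 2 * u - (g + 2 * v)" "0 < 2 * u + (g + 2 * v)"
      using h(1) by (simp_all only: zero_less_mult_iff) auto
    thus ?thesis using h om unfolding s prod.case hv[unfolded prod.case] by (simp add: Win_def)
  qed
  show "card Win = card ?Z" by (rule card_eq_by_inverse[OF 1 2])
  show "finite ?Z" by (rule finite_by_inverse[OF finite_Win 2])
qed


lemma M_nonsquare: "x * x \<noteq> M"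
proof
  assume "x * x = M"
  hence e: "x * x mod 4 = 3" using M_mod4 by simp
  show False using mult_mod4_eq3(4)[OF e] by simp
qed

lemma square_bounds:
  assumes "0 \<le> r" "r * r \<le> M" "M < (r + 1) * (r + 1)"
  shows "x * x < M \<longleftrightarrow> - r \<le> x \<and> x \<le> r" "M < x * x \<longleftrightarrow> x \<le> - r - 1 \<or> r + 1 \<le> x"
proof -
  have 1: "x * x < M" if "- r \<le> x" "x \<le> r"
  proof -
    have "\<bar>x\<bar> * \<bar>x\<bar> \<le> r * r" using that by (intro mult_mono) auto
    thus ?thesis using assms(2) M_nonsquare[of x] by simp
  qed
  have 2: "M < x * x" if "x \<le> - r - 1 \<or> r + 1 \<le> x"
  proof -
    have "(r + 1) * (r + 1) \<le> \<bar>x\<bar> * \<bar>x\<bar>" using that assms(1) by (intro mult_mono) auto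
    thus ?thesis using assms(3) by simp
  qed
  show "x * x < M \<longleftrightarrow> - r \<le> x \<and> x \<le> r" "M < x * x \<longleftrightarrow> x \<le> - r - 1 \<or> r + 1 \<le> x"
    using 1 2 by fastforce+
qed

text \<open>For fixed \<open>g\<close> the two inequalities on \<open>u\<close> cut out a complete residue system modulo \<open>g\<close> when
  \<open>g\<^sup>2 < M\<close>, on which \<open>u \<mapsto> - u\<close> acts with fixed points only if \<open>g dvd M\<close>; for larger \<open>g\<close> the
  reflection \<open>u \<mapsto> g - u\<close> has none.\<close>

lemma Win_parity: "even (card Win) \<longleftrightarrow> even (card {(a,w) \<in> PW. pm1 a})"
proof -
  obtain r where r: "0 \<le> r" "r * r \<le> M" "M < (r + 1) * (r + 1)"
    using ex_floor_sqrt[of M] M_pos by auto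
  define Z where "Z = {(g,u). 0 < g \<and> pm1 g \<and> g dvd 4 * u * u - M
     \<and> (2 * u - g) * (2 * u - g) < M \<and> M < (2 * u + g) * (2 * u + g)}"
  \<comment> \<open>With \<open>r\<close> the integer part of the square root of \<open>M\<close>,
    \<open>lo g\<close> is the least \<open>u\<close> with \<open>2 * u + g \<ge> r + 1\<close>. For
    \<open>g \<le> r\<close> the window consists of the \<open>g\<close> consecutive integers from
    \<open>lo g\<close> on, so \<open>- u\<close> can be reduced modulo \<open>g\<close> back into
    it.\<close>
  define lo where "lo = (\<lambda>g::int. (r + 2 - g) div 2)"
  define f where "f = (\<lambda>(g::int,u::int). (g, if g \<le> r then lo g + ((- u - lo g) mod g) else g - u))"
  have Z: "(g,u) \<in> Z \<longleftrightarrow> 0 < g \<and> pm1 g \<and> g dvd 4 * u * u - M \<and>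
      (if g \<le> r then lo g \<le> u \<and> u < lo g + g else g - r \<le> 2 * u \<and> 2 * u \<le> r + g)" for g u
    unfolding Z_def lo_def using square_bounds[OF r] by auto
  have step: "f (g,u) \<in> Z \<and> f (f (g,u)) = (g,u) \<and> (f (g,u) = (g,u) \<longrightarrow> g \<le> r \<and> g dvd u)" if "(g,u) \<in> Z" for g u
  proof -
    have h: "0 < g" "pm1 g" "g dvd 4 * u * u - M" using that by (auto simp: Z)
    have odd: "odd g" using pm1_odd[OF h(2)] .
    show ?thesis
    proof (cases "g \<le> r")
      case True
      have b: "lo g \<le> u" "u < lo g + g" using that True by (auto simp: Z)
      define v where "v = lo g + ((- u - lo g) mod g)"
      have fv: "f (g,u) = (g,v)" using True by (simp add: f_def v_def)
      obtain k where k: "v = - u - g * k"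
      proof -
        have "v = - u - g * ((- u - lo g) div g)" unfolding v_def
          using mult_div_mod_eq[of g "- u - lo g"] by linarith
        thus ?thesis using that by blast
      qed
      have e: "4 * v * v - M = 4 * u * u - M + g * (4 * k * (2 * u + g * k))"
        unfolding k by (simp add: algebra_simps)
      have "g dvd 4 * v * v - M" unfolding e using h(3) by (intro dvd_add) simp_all
      moreover have "lo g \<le> v" "v < lo g + g" using h(1) by (simp_all add: v_def)
      ultimately have "f (g,u) \<in> Z" using h True by (simp add: fv Z)
      moreover have "(- v - lo g) mod g = u - lo g"
      proof -
        have "- v - lo g = u - lo g + g * k" unfolding k by simp
        hence "(- v - lo g) mod g = (u - lo g) mod g" by (simp only: mod_mult_self2)
        thus ?thesis using b by simp
      qed
      hence "f (f (g,u)) = (g,u)" using True unfolding fv by (simp add: f_def)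
      moreover have "g dvd u" if "f (g,u) = (g,u)"
      proof -
        have "2 * u = g * (- k)" using that k by (simp add: fv)
        hence "g dvd 2 * u" by (metis dvd_triv_left)
        thus ?thesis using odd by (simp add: coprime_dvd_mult_right_iff)
      qed
      ultimately show ?thesis using True by simp
    next
      case False
      have e: "4 * (g - u) * (g - u) - M = 4 * u * u - M + g * (4 * g - 8 * u)" by (simp add: algebra_simps)
      have "g dvd 4 * (g - u) * (g - u) - M" unfolding e using h(3) by (intro dvd_add) simp_all
      hence "f (g,u) \<in> Z" using that False by (auto simp: f_def Z)
      moreover have "g - u \<noteq> u" using odd by auto
      ultimately show ?thesis using False by (simp add: f_def)
    qed
  qed
  have "even (card Z) \<longleftrightarrow> even (card {s \<in> Z. f s = s})"
    by (rule even_card_fixpoints) (use finite_Win_fibre step in \<open>auto simp: Z_def[symmetric]\<close>)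
  also have "card {s \<in> Z. f s = s} = card {(a,w) \<in> PW. pm1 a}"
  proof (rule card_eq_by_inverse[of _ "\<lambda>(g,u). (g, (M div g - g) div 2)" _ "\<lambda>(a,w). (a, lo a + ((- lo a) mod a))"])
    fix s assume s: "s \<in> {s \<in> Z. f s = s}"
    then obtain g u where s': "s = (g,u)" and gu: "(g,u) \<in> Z" "f (g,u) = (g,u)" by (cases s) auto
    have h: "0 < g" "pm1 g" "g dvd 4 * u * u - M" using gu by (auto simp: Z)
    have g: "g \<le> r" "g dvd u" using step gu by blast+
    have "g dvd 4 * u * u - (4 * u * u - M)" 
      by (rule dvd_diff[OF dvd_mult[OF g(2)] h(3)])
    hence "g dvd M" by (simp only: diff_diff_eq2 add_diff_cancel_left')
    then obtain b where b: "M = g * b" by (elim dvdE)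
    have "odd g" "odd b" using mult_mod4_eq3[of g b] M_mod4 b by auto
    hence "even (b - g)" by simp
    then obtain w where w: "b = g + 2 * w" by (metis add_diff_cancel_left' diff_add_cancel add.commute evenE)
    have "g * g < M" using square_bounds(1)[OF r, of g] h(1) g(1) by simp
    hence "0 < g * (2 * w)" unfolding b w by (simp add: algebra_simps)
    hence w0: "0 < w" using h(1) by (simp add: zero_less_mult_iff)
    hence "(g,w) \<in> PW" using h(1) b unfolding PW_def w by simp
    moreover have "(M div g - g) div 2 = w" using h(1) by (simp add: b w)
    moreover have "lo g + (- lo g) mod g = u"
    proof -
      obtain k where "u = g * k" using g(2) by (elim dvdE)
      hence "- lo g = (u - lo g) + g * (- k)" by simp
      hence "(- lo g) mod g = (u - lo g) mod g" by (simp only: mod_mult_self2)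
      thus ?thesis using gu(1) g(1) by (simp add: Z)
    qed
    ultimately show "(\<lambda>(g,u). (g, (M div g - g) div 2)) s \<in> {(a,w) \<in> PW. pm1 a} \<and>
      (\<lambda>(a,w). (a, lo a + ((- lo a) mod a))) ((\<lambda>(g,u). (g, (M div g - g) div 2)) s) = s"
      using h by (simp add: s')
  next
    fix s assume "s \<in> {(a,w) \<in> PW. pm1 a}"
    then obtain a w where s: "s = (a,w)" and h: "0 < a" "0 < w" "a * (a + 2 * w) = M" "pm1 a"
      by (auto simp: PW_def)
    define u where "u = lo a + ((- lo a) mod a)"
    have "a * a < M" unfolding h(3)[symmetric] using h(1,2) by simp
    hence ar: "a \<le> r" using square_bounds(1)[OF r, of a] by simp
    have "u = a * - (- lo a div a)" unfolding u_def using mult_div_mod_eq[of a "- lo a"] by linarith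
    then obtain k where k: "u = a * k" by blast
    have "a dvd 4 * u * u - M" unfolding k h(3)[symmetric] by simp
    moreover have b: "lo a \<le> u" "u < lo a + a" using h(1) by (simp_all add: u_def)
    ultimately have "(a,u) \<in> Z" using h(1,4) ar by (simp add: Z)
    moreover have "(- u - lo a) mod a = u - lo a"
    proof -
      have "- u - lo a = (u - lo a) + a * (- 2 * k)" unfolding k by simp
      hence "(- u - lo a) mod a = (u - lo a) mod a" by (simp only: mod_mult_self2)
      thus ?thesis using b by simp
    qed
    hence "f (a,u) = (a,u)" using ar by (simp add: f_def)
    moreover have "(M div a - a) div 2 = w" unfolding h(3)[symmetric] using h(1) by simp
    moreover have "(a,w) \<in> PW" using h by (simp add: PW_def)
    ultimately show "(\<lambda>(a,w). (a, lo a + ((- lo a) mod a))) s \<in> {s \<in> Z. f s = s} \<and>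
      (\<lambda>(g,u). (g, (M div g - g) div 2)) ((\<lambda>(a,w). (a, lo a + ((- lo a) mod a))) s) = s"
      by (simp add: s u_def)
  qed
  finally show ?thesis unfolding Win_fibre Z_def[symmetric] .
qed

lemma card_PW_pm1: "card {(a,w) \<in> PW. pm1 w} = 0 \<or> card {(a,w) \<in> PW. pm1 w} = card PW"
proof (cases "M mod 16 = 3 \<or> M mod 16 = 15")
  case True
  hence "{(a,w) \<in> PW. pm1 w} = PW" using PW_sqrt_mod by (auto simp: pm1_def)
  thus ?thesis by simp
next
  case False
  hence "{(a,w) \<in> PW. pm1 w} = {}" using PW_sqrt_mod by (auto simp: pm1_def)
  thus ?thesis by (simp only: card.empty refl disj_not1 simp_thms)
qed

text \<open>The counts on faces occur both in \<open>diag_Tern_parity\<close> and in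
  \<open>Edge_parity\<close> and cancel, leaving \<open>Wo\<close> and the factorisations with
  \<open>pm1 a\<close>. The two evaluations of \<open>Win\<close> replace these by the
  factorisations with \<open>pm1 w\<close>, which are none or all of \<open>PW\<close>.\<close>

theorem Quad_Trip_parity:
  assumes "\<And>x. M \<noteq> 3 * x * x" "even (card PW)"
  shows "even (card {(a,b,c,l) \<in> Quad. odd c} + card Trip)"
proof -
  have "even (card {(a,w) \<in> PW. pm1 w})" using card_PW_pm1 assms(2) by auto
  hence "even (card Wo + card {(a,w) \<in> PW. pm1 a})"
    using Win_Wo_parity Win_parity by simp
  thus ?thesis
    using Quad_parity diag_Tern_parity Edge_parity[OF assms(1)] unfolding pm1_def
    by (auto simp: even_add)
qed

end

section \<open>Coefficients modulo 4\<close>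

text \<open>The series \<open>1 / (1 - q^(2 * j + 1))\<close>.\<close>

definition geom :: "nat \<Rightarrow> int fps" where
  "geom j = Abs_fps (\<lambda>m. of_bool ((2 * j + 1) dvd m))"

definition geom_tail :: "nat \<Rightarrow> int fps" where
  "geom_tail j = fps_X ^ (2 * j + 1) * geom j"

lemma geom_inverse: "(1 - fps_X ^ (2 * j + 1)) * geom j = 1"
proof (rule fps_ext)
  fix m
  have "(2 * j + 1) dvd m - (2 * j + 1) \<longleftrightarrow> (2 * j + 1) dvd m" if "2 * j + 1 \<le> m"
    using that by (simp add: dvd_minus_self)
  moreover have "(2 * j + 1) dvd m \<longleftrightarrow> m = 0" if "m < 2 * j + 1"
    using that by (auto dest: dvd_imp_le)
  ultimately show "fps_nth ((1 - fps_X ^ (2 * j + 1)) * geom j) m = fps_nth 1 m"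
    by (auto simp: left_diff_distrib fps_X_power_mult_nth geom_def simp del: power_Suc)
qed

lemma geom_tail_nth: "fps_nth (geom_tail j) m = of_bool (0 < m \<and> (2 * j + 1) dvd m)"
proof -
  have "(2 * j + 1) dvd m - (2 * j + 1) \<longleftrightarrow> (2 * j + 1) dvd m" if "2 * j + 1 \<le> m"
    using that by (simp add: dvd_minus_self)
  moreover have "(2 * j + 1) dvd m \<longleftrightarrow> m = 0" if "m < 2 * j + 1"
    using that by (auto dest: dvd_imp_le)
  ultimately show ?thesis
    by (auto simp: geom_tail_def fps_X_power_mult_nth geom_def simp del: power_Suc)
qed

lemma qpoch_geom: "qpoch fps_X (fps_X\<^sup>2) n * (\<Prod>j<n. geom j) = (1 :: int fps)"
proof -
  have "fps_X * fps_X\<^sup>2 ^ j = (fps_X ^ (2 * j + 1) :: int fps)" for j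
    by (simp add: power_mult)
  thus ?thesis unfolding qpoch_def by (simp only: prod.distrib[symmetric] geom_inverse prod.neutral_const)
qed

lemma qpoch_geom_tail: "qpoch (- fps_X) (fps_X\<^sup>2) n * (\<Prod>j<n. geom j) = (\<Prod>j<n. 1 + 2 * geom_tail j)"
proof -
  have "(1 - - fps_X * fps_X\<^sup>2 ^ j) * geom j = 1 + 2 * geom_tail j" for j
  proof -
    have "fps_X * fps_X\<^sup>2 ^ j = (fps_X ^ (2 * j + 1) :: int fps)" by (simp add: power_mult)
    hence "(1 - - fps_X * fps_X\<^sup>2 ^ j) * geom j = (1 - fps_X ^ (2 * j + 1)) * geom j + 2 * geom_tail j"
      by (simp add: geom_tail_def algebra_simps del: power_Suc)
    thus ?thesis by (simp only: geom_inverse)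
  qed
  thus ?thesis unfolding qpoch_def by (simp only: prod.distrib[symmetric])
qed

text \<open>For \<open>j < n\<close> the denominator factor \<open>1 - q^(2 * j + 1)\<close> pairs
  with the numerator factor \<open>1 + q^(2 * j + 1)\<close> to give
  \<open>1 + 2 * geom_tail j\<close>; only the denominator factor with \<open>j = n\<close> stays
  unpaired.\<close>

lemma V1_term_geom: "V1_term n = fps_X ^ ((n + 1)\<^sup>2) * geom n * (\<Prod>j<n. 1 + 2 * geom_tail j)"
proof -
  let ?D = "qpoch fps_X (fps_X\<^sup>2) (n + 1) :: int fps" and ?I = "fps_right_inverse (qpoch fps_X (fps_X\<^sup>2) (n + 1)) 1 :: int fps"
  have "?I = ?I * (?D * (\<Prod>j<n+1. geom j))" by (simp only: qpoch_geom mult_1_right)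
  also have "\<dots> = (?D * ?I) * (\<Prod>j<n+1. geom j)" by (simp only: mult_ac)
  also have "\<dots> = (\<Prod>j<n+1. geom j)" by (simp only: V1_denominator_inverse mult_1_left)
  finally have I: "?I = (\<Prod>j<n. geom j) * geom n" by simp
  show ?thesis unfolding V1_term_def I qpoch_geom_tail[symmetric] by (simp only: mult_ac)
qed

lemma prod_one_plus_double:
  fixes h :: "nat \<Rightarrow> 'a::comm_ring_1"
  shows "\<exists>r. (\<Prod>j<n. 1 + 2 * h j) = 1 + 2 * (\<Sum>j<n. h j) + 4 * r"
proof (induction n)
  case (Suc n)
  then obtain r where "(\<Prod>j<n. 1 + 2 * h j) = 1 + 2 * (\<Sum>j<n. h j) + 4 * r" by blast
  hence "(\<Prod>j<Suc n. 1 + 2 * h j) = 1 + 2 * (\<Sum>j<Suc n. h j) + 4 * (r + (\<Sum>j<n. h j) * h n + 2 * r * h n)"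
    by (simp add: algebra_simps)
  thus ?case by blast
qed (auto intro: exI[of _ 0])

lemma fps_nth_2_mult: "fps_nth (2 * f) N = 2 * fps_nth (f :: int fps) N"
  and fps_nth_4_mult: "fps_nth (4 * f) N = 4 * fps_nth (f :: int fps) N"
  by (simp_all add: fps_numeral_fps_const)

lemma V1_term_nth_mod4:
  "[fps_nth (V1_term n) N = fps_nth (fps_X ^ ((n + 1)\<^sup>2) * geom n) N
      + 2 * (\<Sum>j<n. fps_nth (fps_X ^ ((n + 1)\<^sup>2) * (geom n * geom_tail j)) N)] (mod 4)"
proof -
  let ?E = "fps_X ^ ((n + 1)\<^sup>2) :: int fps"
  obtain r where r: "(\<Prod>j<n. 1 + 2 * geom_tail j) = 1 + 2 * (\<Sum>j<n. geom_tail j) + 4 * r"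
    using prod_one_plus_double by blast
  have "V1_term n = ?E * geom n + 2 * (\<Sum>j<n. ?E * (geom n * geom_tail j)) + 4 * (?E * geom n * r)"
    unfolding V1_term_geom r by (simp add: algebra_simps sum_distrib_left)
  hence "fps_nth (V1_term n) N = fps_nth (?E * geom n) N + 2 * (\<Sum>j<n. fps_nth (?E * (geom n * geom_tail j)) N)
     + 4 * fps_nth (?E * geom n * r) N"
    by (simp only: fps_add_nth fps_nth_2_mult fps_nth_4_mult fps_sum_nth)
  thus ?thesis by (simp add: cong_def)
qed

lemma first_nth: "fps_nth (fps_X ^ ((n + 1)\<^sup>2) * geom n) N = of_bool ((n+1)\<^sup>2 \<le> N \<and> (2 * n + 1) dvd N - (n+1)\<^sup>2)"
  by (simp add: fps_X_power_mult_nth geom_def)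

text \<open>The exponent \<open>i\<close> is taken from \<open>geom n\<close>, the rest from
  \<open>geom_tail j\<close>. The latter has no constant term, hence the strict inequality, which
  later becomes \<open>0 < l\<close>.\<close>

lemma second_nth: "fps_nth (fps_X ^ ((n + 1)\<^sup>2) * (geom n * geom_tail j)) N
   = int (card {i. (n+1)\<^sup>2 + i < N \<and> (2 * n + 1) dvd i \<and> (2 * j + 1) dvd N - (n+1)\<^sup>2 - i})"
proof (cases "N < (n+1)\<^sup>2")
  case True
  hence "{i. (n+1)\<^sup>2 + i < N \<and> (2 * n + 1) dvd i \<and> (2 * j + 1) dvd N - (n+1)\<^sup>2 - i} = {}" by auto
  thus ?thesis using True by (simp only: fps_X_power_mult_nth if_True card.empty of_nat_0)
next
  case False
  define K where "K = N - (n+1)\<^sup>2"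
  have "fps_nth (fps_X ^ ((n + 1)\<^sup>2) * (geom n * geom_tail j)) N = fps_nth (geom n * geom_tail j) K"
    using False by (simp add: fps_X_power_mult_nth K_def)
  also have "\<dots> = (\<Sum>i=0..K. of_bool (i < K \<and> (2 * n + 1) dvd i \<and> (2 * j + 1) dvd K - i))"
    unfolding fps_mult_nth by (intro sum.cong) (auto simp: geom_def geom_tail_nth)
  also have "\<dots> = int (card {i \<in> {0..K}. i < K \<and> (2 * n + 1) dvd i \<and> (2 * j + 1) dvd K - i})"
    by (subst sum_of_bool_eq) (auto intro!: arg_cong[where f = card])
  also have "{i \<in> {0..K}. i < K \<and> (2 * n + 1) dvd i \<and> (2 * j + 1) dvd K - i}
     = {i. (n+1)\<^sup>2 + i < N \<and> (2 * n + 1) dvd i \<and> (2 * j + 1) dvd N - (n+1)\<^sup>2 - i}"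
    using False by (auto simp: K_def)
  finally show ?thesis .
qed

context three_mod_four begin

text \<open>Putting \<open>a = 2 * n + 1\<close> and \<open>w = 2 * m + 1\<close> turns
  \<open>N = (n + 1)^2 + (2 * n + 1) * m\<close> into \<open>a * (a + 2 * w) = 4 * N - 1\<close>;
  this is where \<open>M = 4 * N - 1\<close> comes from.\<close>

lemma card_PW_coeffs:
  assumes "M = 4 * int N - 1"
  shows "card PW = card {n. (n+1)\<^sup>2 \<le> N \<and> (2 * n + 1) dvd N - (n+1)\<^sup>2}"
proof (rule card_eq_by_inverse[of _ "\<lambda>(a,w). nat (a div 2)" _
     "\<lambda>n. (2 * int n + 1, 2 * int ((N - (n+1)\<^sup>2) div (2 * n + 1)) + 1)"])
  fix s assume "s \<in> PW"
  then obtain a w where s: "s = (a,w)" and aw: "(a,w) \<in> PW" by (cases s) auto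
  have h: "0 < a" "0 < w" "a * (a + 2 * w) = M" using aw by (auto simp: PW_def)
  obtain a' w' where o: "a = 2 * a' + 1" "w = 2 * w' + 1" using PW_odd[OF aw] by (elim oddE)
  define n m where nm: "n = nat a'" "m = nat w'"
  have nm': "a = 2 * int n + 1" "w = 2 * int m + 1" using o h by (simp_all add: nm)
  have "4 * int N = 4 * int ((n+1)\<^sup>2 + (2 * n + 1) * m)"
    using h(3) assms unfolding nm' by (simp add: power2_eq_square algebra_simps)
  hence N: "N = (n+1)\<^sup>2 + (2 * n + 1) * m"
    by (simp only: mult_cancel_left zero_neq_numeral[symmetric] of_nat_eq_iff simp_thms)
  have "nat (a div 2) = n" unfolding nm' by simp
  moreover have "N - (n+1)\<^sup>2 = (2 * n + 1) * m" unfolding N by simp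
  moreover have "(n+1)\<^sup>2 \<le> N" unfolding N by simp
  moreover have "(2 * n + 1) * m div (2 * n + 1) = m" by (rule nonzero_mult_div_cancel_left) simp
  ultimately show "(\<lambda>(a,w). nat (a div 2)) s \<in> {n. (n+1)\<^sup>2 \<le> N \<and> (2 * n + 1) dvd N - (n+1)\<^sup>2} \<and>
     (\<lambda>n. (2 * int n + 1, 2 * int ((N - (n+1)\<^sup>2) div (2 * n + 1)) + 1)) ((\<lambda>(a,w). nat (a div 2)) s) = s"
    unfolding s prod.case by (simp only: mem_Collect_eq dvd_triv_left nm' simp_thms)
next
  fix n assume "n \<in> {n. (n+1)\<^sup>2 \<le> N \<and> (2 * n + 1) dvd N - (n+1)\<^sup>2}"
  hence h: "(n+1)\<^sup>2 \<le> N" "(2 * n + 1) dvd N - (n+1)\<^sup>2" by auto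
  then obtain m where m: "N - (n+1)\<^sup>2 = (2 * n + 1) * m" by (elim dvdE)
  hence N: "N = (n+1)\<^sup>2 + (2 * n + 1) * m" using h by simp
  have d: "(N - (n+1)\<^sup>2) div (2 * n + 1) = m"
    unfolding m by (rule nonzero_mult_div_cancel_left) simp
  have "(2 * int n + 1) * (2 * int n + 1 + 2 * (2 * int m + 1)) = M"
    unfolding assms N by (simp add: power2_eq_square algebra_simps)
  hence "(2 * int n + 1, 2 * int m + 1) \<in> PW" by (simp add: PW_def)
  thus "(2 * int n + 1, 2 * int ((N - (n+1)\<^sup>2) div (2 * n + 1)) + 1) \<in> PW \<and>
     (\<lambda>(a,w). nat (a div 2)) (2 * int n + 1, 2 * int ((N - (n+1)\<^sup>2) div (2 * n + 1)) + 1) = n"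
    unfolding d by simp
qed

text \<open>The dictionary is \<open>a = 2 * n + 1\<close>, \<open>c = 2 * j + 1\<close>,
  \<open>i = (2 * n + 1) * m\<close>, and \<open>l\<close> is the cofactor of
  \<open>2 * j + 1\<close>. Since \<open>a * b\<close> is 3 modulo 4, \<open>b\<close> is congruent
  to \<open>a + 2\<close> modulo 4 and has the form \<open>2 * n + 3 + 4 * m\<close>.\<close>

lemma card_Quad_coeffs:
  assumes "M = 4 * int N - 1"
  shows "card {(a,b,c,l) \<in> Quad. odd c} = card (SIGMA n:{..N}. SIGMA j:{..<n}.
     {i. (n+1)\<^sup>2 + i < N \<and> (2 * n + 1) dvd i \<and> (2 * j + 1) dvd N - (n+1)\<^sup>2 - i})"
proof (rule card_eq_by_inverse[of _ "\<lambda>(a,b,c,l). (nat (a div 2), nat (c div 2), nat (a * ((b - a) div 4)))" _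
     "\<lambda>(n,j,i). (2 * int n + 1, 2 * int n + 3 + 4 * int (i div (2 * n + 1)), 2 * int j + 1, int ((N - (n+1)\<^sup>2 - i) div (2 * j + 1)))"])
  fix s assume "s \<in> {(a,b,c,l) \<in> Quad. odd c}"
  then obtain a b c l where s: "s = (a,b,c,l)" and Q: "(a,b,c,l) \<in> Quad" and c: "odd c" by auto
  have h: "0 < c" "c < a" "a < b" "0 < l" "a * b + 4 * c * l = M" using Q by (auto simp: Quad_def)
  note o = mult_mod4_eq3[OF Quad_mod4[OF Q]]
  obtain a' where a': "a = 2 * a' + 1" using o(1) by (elim oddE)
  obtain c' where c': "c = 2 * c' + 1" using c by (elim oddE)
  define b' where "b' = (b - a) div 4"
  have b': "b = a + 2 + 4 * b'" using o(3,4) \<open>odd a\<close> unfolding b'_def by presburger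
  define n m j k where nm: "n = nat a'" "m = nat b'" "j = nat c'" "k = nat l"
  have nm': "a = 2 * int n + 1" "b' = int m" "c = 2 * int j + 1" "l = int k" using a' b' c' h by (simp_all add: nm)
  define i where "i = (2 * n + 1) * m"
  have "4 * int N = 4 * int ((n+1)\<^sup>2 + i + (2 * j + 1) * k)"
    using h(5) assms unfolding b' nm' i_def by (simp add: power2_eq_square algebra_simps)
  hence N: "N = (n+1)\<^sup>2 + i + (2 * j + 1) * k"
    by (simp only: mult_cancel_left zero_neq_numeral[symmetric] of_nat_eq_iff simp_thms)
  have "k > 0" using h(4) nm'(4) by simp
  hence "(n+1)\<^sup>2 + i < N" unfolding N by simp
  moreover have "n \<le> (n+1)\<^sup>2" by (simp add: power2_eq_square)
  moreover have "j < n" using h(2) nm' by simp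
  moreover have e: "N - (n+1)\<^sup>2 - i = (2 * j + 1) * k" unfolding N by simp
  ultimately have m: "(n, j, i) \<in> (SIGMA n:{..N}. SIGMA j:{..<n}.
     {i. (n+1)\<^sup>2 + i < N \<and> (2 * n + 1) dvd i \<and> (2 * j + 1) dvd N - (n+1)\<^sup>2 - i})"
    using dvd_triv_left[of "2 * n + 1" m, folded i_def] dvd_triv_left[of "2 * j + 1" k] by auto
  have bd: "(b - a) div 4 = int m" using nm'(2) by (simp only: b'_def)
  have f: "nat (a div 2) = n" "nat (c div 2) = j" using nm' by simp_all
  have f': "nat (a * ((b - a) div 4)) = i" unfolding bd by (simp add: nm'(1) i_def nat_mult_distrib nat_add_distrib)
  have d: "i div (2 * n + 1) = m" "(N - (n+1)\<^sup>2 - i) div (2 * j + 1) = k"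
    unfolding e by (simp only: i_def, rule nonzero_mult_div_cancel_left, simp)
      (rule nonzero_mult_div_cancel_left, simp)
  show "(\<lambda>(a,b,c,l). (nat (a div 2), nat (c div 2), nat (a * ((b - a) div 4)))) s \<in> (SIGMA n:{..N}. SIGMA j:{..<n}.
     {i. (n+1)\<^sup>2 + i < N \<and> (2 * n + 1) dvd i \<and> (2 * j + 1) dvd N - (n+1)\<^sup>2 - i}) \<and>
   (\<lambda>(n,j,i). (2 * int n + 1, 2 * int n + 3 + 4 * int (i div (2 * n + 1)), 2 * int j + 1, int ((N - (n+1)\<^sup>2 - i) div (2 * j + 1))))
   ((\<lambda>(a,b,c,l). (nat (a div 2), nat (c div 2), nat (a * ((b - a) div 4)))) s) = s"
    unfolding s prod.case f f' d using m b' nm' by simp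
next
  fix s assume "s \<in> (SIGMA n:{..N}. SIGMA j:{..<n}.
     {i. (n+1)\<^sup>2 + i < N \<and> (2 * n + 1) dvd i \<and> (2 * j + 1) dvd N - (n+1)\<^sup>2 - i})"
  then obtain n j i where s: "s = (n,j,i)" and h: "j < n" "(n+1)\<^sup>2 + i < N"
    "(2 * n + 1) dvd i" "(2 * j + 1) dvd N - (n+1)\<^sup>2 - i" by auto
  from h(3) obtain m where m: "i = (2 * n + 1) * m" by (elim dvdE)
  from h(4) obtain k where k: "N - (n+1)\<^sup>2 - i = (2 * j + 1) * k" by (elim dvdE)
  have N: "N = (n+1)\<^sup>2 + i + (2 * j + 1) * k" using k h(2) by linarith
  have k0: "0 < k" using h(2) unfolding N by (cases k) auto
  have d: "i div (2 * n + 1) = m" "(N - (n+1)\<^sup>2 - i) div (2 * j + 1) = k"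
    unfolding k by (simp only: m, rule nonzero_mult_div_cancel_left, simp)
      (rule nonzero_mult_div_cancel_left, simp)
  have "(2 * int n + 1) * (2 * int n + 3 + 4 * int m) + 4 * (2 * int j + 1) * int k = M"
    unfolding assms N m by (simp add: power2_eq_square algebra_simps)
  hence Q: "(2 * int n + 1, 2 * int n + 3 + 4 * int m, 2 * int j + 1, int k) \<in> Quad"
    using h(1) k0 by (simp add: Quad_def)
  have "(2 * int n + 3 + 4 * int m - (2 * int n + 1)) div 4 = int m" by simp
  hence "nat ((2 * int n + 1) * ((2 * int n + 3 + 4 * int m - (2 * int n + 1)) div 4)) = i"
    unfolding m by (simp only:) (simp add: nat_mult_distrib nat_add_distrib)
  thus "(\<lambda>(n,j,i). (2 * int n + 1, 2 * int n + 3 + 4 * int (i div (2 * n + 1)), 2 * int j + 1, int ((N - (n+1)\<^sup>2 - i) div (2 * j + 1)))) s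
       \<in> {(a,b,c,l) \<in> Quad. odd c} \<and>
   (\<lambda>(a,b,c,l). (nat (a div 2), nat (c div 2), nat (a * ((b - a) div 4)))) 
   ((\<lambda>(n,j,i). (2 * int n + 1, 2 * int n + 3 + 4 * int (i div (2 * n + 1)), 2 * int j + 1, int ((N - (n+1)\<^sup>2 - i) div (2 * j + 1)))) s) = s"
    unfolding s prod.case d using Q by simp
qed

theorem N_V1_mod4:
  assumes "M = 4 * N - 1"
  shows "[N_V1 N = int (card PW) + 2 * int (card {(a,b,c,l) \<in> Quad. odd c})] (mod 4)"
proof -
  define K where "K = nat N"
  have NK: "N = int K" using assms M_pos by (simp add: K_def)
  have MK: "M = 4 * int K - 1" using assms NK by simp
  let ?S = "\<lambda>n j. {i. (n+1)\<^sup>2 + i < K \<and> (2 * n + 1) dvd i \<and> (2 * j + 1) dvd K - (n+1)\<^sup>2 - i}"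
  have fin: "finite (?S n j)" for n j by (rule finite_subset[of _ "{..K}"]) auto
  have "N_V1 N = (\<Sum>n\<le>K. fps_nth (V1_term n) K)"
    by (simp add: N_V1_def NK nth_V1)
  also have "[\<dots> = (\<Sum>n\<le>K. fps_nth (fps_X ^ ((n + 1)\<^sup>2) * geom n) K
      + 2 * (\<Sum>j<n. fps_nth (fps_X ^ ((n + 1)\<^sup>2) * (geom n * geom_tail j)) K))] (mod 4)"
    by (intro cong_sum V1_term_nth_mod4)
  also have "(\<Sum>n\<le>K. fps_nth (fps_X ^ ((n + 1)\<^sup>2) * geom n) K
      + 2 * (\<Sum>j<n. fps_nth (fps_X ^ ((n + 1)\<^sup>2) * (geom n * geom_tail j)) K))
    = (\<Sum>n\<le>K. of_bool ((n+1)\<^sup>2 \<le> K \<and> (2 * n + 1) dvd K - (n+1)\<^sup>2))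
      + 2 * int (\<Sum>n\<le>K. \<Sum>j<n. card (?S n j))"
    by (simp only: first_nth second_nth sum.distrib sum_distrib_left of_nat_sum)
  also have "(\<Sum>n\<le>K. of_bool ((n+1)\<^sup>2 \<le> K \<and> (2 * n + 1) dvd K - (n+1)\<^sup>2)) = int (card PW)"
  proof -
    have "n \<le> K" if "(n+1)\<^sup>2 \<le> K" for n using that by (simp add: power2_eq_square)
    hence "{..K} \<inter> {n. (n+1)\<^sup>2 \<le> K \<and> (2 * n + 1) dvd K - (n+1)\<^sup>2} = {n. (n+1)\<^sup>2 \<le> K \<and> (2 * n + 1) dvd K - (n+1)\<^sup>2}"
      by blast
    thus ?thesis unfolding card_PW_coeffs[OF MK] by (subst sum_of_bool_eq) simp_all
  qed
  also have "(\<Sum>n\<le>K. \<Sum>j<n. card (?S n j)) = card {(a,b,c,l) \<in> Quad. odd c}"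
    unfolding card_Quad_coeffs[OF MK] using fin by (simp add: card_SigmaI)
  finally show ?thesis .
qed

end

section \<open>Products of lattices in the complex plane\<close>

definition subgrp :: "complex set \<Rightarrow> bool" where
  "subgrp S \<longleftrightarrow> 0 \<in> S \<and> (\<forall>x\<in>S. \<forall>y\<in>S. x - y \<in> S)"

lemma subgrp_0: "subgrp S \<Longrightarrow> 0 \<in> S"
  and subgrp_diff: "subgrp S \<Longrightarrow> x \<in> S \<Longrightarrow> y \<in> S \<Longrightarrow> x - y \<in> S"
  by (simp_all add: subgrp_def)

lemma subgrp_minus: "subgrp S \<Longrightarrow> x \<in> S \<Longrightarrow> - x \<in> S"
  using subgrp_diff[of S 0 x] subgrp_0 by simp

lemma subgrp_add: "subgrp S \<Longrightarrow> x \<in> S \<Longrightarrow> y \<in> S \<Longrightarrow> x + y \<in> S"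
  using subgrp_diff[of S x "- y"] subgrp_minus by simp

lemma subgrp_of_int_mult: assumes "subgrp S" "x \<in> S" shows "of_int n * x \<in> S"
proof (induction n rule: int_induct[where k = 0])
  case base
  show ?case using subgrp_0[OF assms(1)] by simp
next
  case (step1 i)
  thus ?case using subgrp_add[OF assms(1)] assms(2) by (simp add: algebra_simps)
next
  case (step2 i)
  thus ?case using subgrp_diff[OF assms(1)] assms(2) by (simp add: algebra_simps)
qed

text \<open>The additive group generated by the products, as for ideals. Closure under differences
  suffices: it yields zero, negatives and sums.\<close>

inductive_set lmult :: "complex set \<Rightarrow> complex set \<Rightarrow> complex set" for S T where
  prod: "a \<in> S \<Longrightarrow> b \<in> T \<Longrightarrow> a * b \<in> lmult S T"
| diff: "x \<in> lmult S T \<Longrightarrow> y \<in> lmult S T \<Longrightarrow> x - y \<in> lmult S T"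

definition scl :: "complex \<Rightarrow> complex set \<Rightarrow> complex set" where
  "scl c S = (\<lambda>x. c * x) ` S"

lemma subgrp_lmult: "subgrp S \<Longrightarrow> subgrp T \<Longrightarrow> subgrp (lmult S T)"
  using lmult.prod[of 0 S 0 T] by (auto simp: subgrp_def intro: lmult.diff)

lemma lmult_least: "subgrp R \<Longrightarrow> (\<And>a b. a \<in> S \<Longrightarrow> b \<in> T \<Longrightarrow> a * b \<in> R) \<Longrightarrow> lmult S T \<subseteq> R"
proof
  fix x assume R: "subgrp R" "\<And>a b. a \<in> S \<Longrightarrow> b \<in> T \<Longrightarrow> a * b \<in> R" and "x \<in> lmult S T"
  from this(3) show "x \<in> R" by induction (use R in \<open>auto intro: subgrp_diff\<close>)
qed

lemma lmult_comm: "lmult S T = lmult T S"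
proof -
  have "lmult S T \<subseteq> lmult T S" for S T
  proof
    fix x assume "x \<in> lmult S T"
    thus "x \<in> lmult T S"
    proof induction
      case (prod a b)
      have "b * a \<in> lmult T S" using prod by (intro lmult.prod)
      thus ?case by (simp only: mult.commute)
    qed (rule lmult.diff)
  qed
  from this[of S T] this[of T S] show ?thesis by (rule subset_antisym)
qed

lemma lmult_assoc:
  assumes "subgrp S" "subgrp T" "subgrp U"
  shows "lmult (lmult S T) U = lmult S (lmult T U)"
proof -
  have *: "lmult (lmult S T) U \<subseteq> lmult S (lmult T U)" if "subgrp S" "subgrp T" "subgrp U" for S T U
  proof (rule lmult_least)
    show g: "subgrp (lmult S (lmult T U))" using that by (intro subgrp_lmult)
    fix x u assume "x \<in> lmult S T" and u: "u \<in> U"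
    thus "x * u \<in> lmult S (lmult T U)"
    proof (induction x)
      case (prod a b)
      have "a * (b * u) \<in> lmult S (lmult T U)" using prod u by (intro lmult.prod)
      thus ?case by (simp only: mult.assoc)
    next
      case (diff x y)
      thus ?case using g u by (simp add: left_diff_distrib subgrp_diff)
    qed
  qed
  show ?thesis
  proof
    show "lmult (lmult S T) U \<subseteq> lmult S (lmult T U)" using * assms by blast
    show "lmult S (lmult T U) \<subseteq> lmult (lmult S T) U"
      using *[OF assms(3,2,1), unfolded lmult_comm[of U T] lmult_comm[of T S]]
      by (simp only: lmult_comm[of S "lmult T U"] lmult_comm[of "lmult S T" U])
  qed
qed

lemma subgrp_scl: assumes "subgrp S" shows "subgrp (scl c S)"
  unfolding subgrp_def scl_def
proof (intro conjI ballI)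
  show "0 \<in> (\<lambda>x. c * x) ` S" using subgrp_0[OF assms] by (intro image_eqI[of _ _ 0]) auto
  fix x y assume "x \<in> (\<lambda>x. c * x) ` S" "y \<in> (\<lambda>x. c * x) ` S"
  then obtain x' y' where "x = c * x'" "y = c * y'" "x' \<in> S" "y' \<in> S" by blast
  thus "x - y \<in> (\<lambda>x. c * x) ` S"
    using subgrp_diff[OF assms, of x' y'] by (intro image_eqI[of _ _ "x' - y'"]) (auto simp: right_diff_distrib)
qed

lemma subgrp_cnj: assumes "subgrp S" shows "subgrp (cnj ` S)"
  unfolding subgrp_def
proof (intro conjI ballI)
  show "0 \<in> cnj ` S" using subgrp_0[OF assms] by (intro image_eqI[of _ _ 0]) auto
  fix x y assume "x \<in> cnj ` S" "y \<in> cnj ` S"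
  then obtain x' y' where "x = cnj x'" "y = cnj y'" "x' \<in> S" "y' \<in> S" by blast
  thus "x - y \<in> cnj ` S"
    using subgrp_diff[OF assms, of x' y'] by (intro image_eqI[of _ _ "x' - y'"]) auto
qed

lemma scl_I: "x \<in> S \<Longrightarrow> c * x \<in> scl c S"
  unfolding scl_def by (rule imageI)

lemma scl_scl: "scl c (scl d S) = scl (c * d) S"
  by (simp add: scl_def image_image mult.assoc)

lemma scl_1: "scl 1 S = S"
  by (simp add: scl_def)

lemma lmult_scl_left:
  assumes "subgrp S" "subgrp T"
  shows "lmult (scl c S) T = scl c (lmult S T)"
proof
  show "lmult (scl c S) T \<subseteq> scl c (lmult S T)"
  proof (rule lmult_least)
    show "subgrp (scl c (lmult S T))" using assms by (intro subgrp_scl subgrp_lmult)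
    fix a b assume "a \<in> scl c S" "b \<in> T"
    thus "a * b \<in> scl c (lmult S T)" by (auto simp: scl_def mult.assoc intro!: imageI lmult.prod)
  qed
  show "scl c (lmult S T) \<subseteq> lmult (scl c S) T"
  proof
    fix z assume "z \<in> scl c (lmult S T)"
    then obtain x where z: "z = c * x" and "x \<in> lmult S T" by (auto simp: scl_def)
    from this(2) have "c * x \<in> lmult (scl c S) T"
    proof induction
      case (prod a b)
      have "c * a * b \<in> lmult (scl c S) T" using prod by (intro lmult.prod scl_I)
      thus ?case by (simp only: mult.assoc)
    next
      case (diff x y)
      thus ?case by (simp add: right_diff_distrib lmult.diff)
    qed
    thus "z \<in> lmult (scl c S) T" by (simp only: z)
  qed
qed

lemma lmult_scl_right:
  assumes "subgrp S" "subgrp T"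
  shows "lmult S (scl c T) = scl c (lmult S T)"
  using lmult_scl_left[OF assms(2,1), of c] by (simp only: lmult_comm)

lemma cnj_scl: "cnj ` scl c S = scl (cnj c) (cnj ` S)"
  by (auto simp: scl_def image_image)

lemma cnj_lmult: "cnj ` lmult S T = lmult (cnj ` S) (cnj ` T)"
proof -
  have *: "cnj ` lmult S T \<subseteq> lmult (cnj ` S) (cnj ` T)" for S T
  proof
    fix z assume "z \<in> cnj ` lmult S T"
    then obtain x where z: "z = cnj x" and "x \<in> lmult S T" by blast
    from this(2) have "cnj x \<in> lmult (cnj ` S) (cnj ` T)"
      by induction (auto intro: lmult.intros)
    thus "z \<in> lmult (cnj ` S) (cnj ` T)" by (simp only: z)
  qed
  have cc: "cnj ` cnj ` S = S" for S by (simp add: image_image)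
  have "cnj ` lmult (cnj ` S) (cnj ` T) \<subseteq> lmult S T" using *[of "cnj ` S" "cnj ` T"] by (simp only: cc)
  hence "cnj ` cnj ` lmult (cnj ` S) (cnj ` T) \<subseteq> cnj ` lmult S T" by (rule image_mono)
  thus ?thesis using * by (simp only: cc subset_antisym)
qed

text \<open>Homothety. For the invertible lattices introduced below, this is equality of ideal
  classes.\<close>

definition sim :: "complex set \<Rightarrow> complex set \<Rightarrow> bool" where
  "sim S T \<longleftrightarrow> (\<exists>c. c \<noteq> 0 \<and> T = scl c S)"

lemma sim_refl: "sim S S"
  unfolding sim_def by (intro exI[of _ 1]) (simp add: scl_1)

lemma sim_scl: "c \<noteq> 0 \<Longrightarrow> sim S (scl c S)"
  unfolding sim_def by blast

lemma sim_sym: "sim S T \<Longrightarrow> sim T S"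
proof -
  assume "sim S T"
  then obtain c where c: "c \<noteq> 0" "T = scl c S" by (auto simp: sim_def)
  hence "S = scl (inverse c) T" by (simp add: scl_scl scl_1)
  thus "sim T S" using c(1) unfolding sim_def by (intro exI[of _ "inverse c"]) auto
qed

lemma sim_trans: "sim S T \<Longrightarrow> sim T U \<Longrightarrow> sim S U"
proof -
  assume "sim S T" "sim T U"
  then obtain c d where "c \<noteq> 0" "T = scl c S" "d \<noteq> 0" "U = scl d T" by (auto simp: sim_def)
  thus "sim S U" unfolding sim_def by (intro exI[of _ "d * c"]) (simp add: scl_scl)
qed

lemma sim_lmult:
  assumes "subgrp S" "subgrp T" "sim S S'" "sim T T'"
  shows "sim (lmult S T) (lmult S' T')"
proof -
  obtain c d where "c \<noteq> 0" "S' = scl c S" "d \<noteq> 0" "T' = scl d T" using assms by (auto simp: sim_def)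
  thus ?thesis using assms(1,2) unfolding sim_def
    by (intro exI[of _ "c * d"]) (simp add: lmult_scl_left lmult_scl_right subgrp_scl scl_scl mult.commute)
qed

section \<open>The quadratic order of discriminant \<open>- M\<close> and the lattices of binary
  forms\<close>

context three_mod_four begin

definition rt :: complex where
  "rt = Complex 0 (sqrt (of_int M))"

lemma rt_sq: "rt * rt = - of_int M"
  using M_pos by (simp add: rt_def complex_eq_iff)

lemma cnj_rt: "cnj rt = - rt"
  by (simp add: rt_def complex_eq_iff)

definition tau :: "int \<Rightarrow> complex" where
  "tau b = (of_int b + rt) / 2"

lemma Re_tau: "Re (tau b) = of_int b / 2" and Im_tau: "Im (tau b) = sqrt (of_int M) / 2"
  by (simp_all add: tau_def rt_def)

lemma cnj_tau: "cnj (tau b) = of_int b - tau b"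
  by (simp add: tau_def cnj_rt field_simps)

lemma tau_shift: "tau (b + 2 * j) = tau b + of_int j"
  by (simp add: tau_def field_simps)

lemma tau_sq: "4 * (k * l) = b * b + M \<Longrightarrow> tau b * tau b = of_int b * tau b - of_int (k * l)"
proof -
  assume "4 * (k * l) = b * b + M"
  hence "of_int (4 * (k * l)) = (of_int (b * b + M) :: complex)" by (rule arg_cong)
  hence e: "of_int k * of_int l * 4 = of_int b * of_int b - rt * rt" by (simp add: rt_sq mult_ac)
  have t: "2 * tau b = of_int b + rt" by (simp add: tau_def)
  have "4 * (tau b * tau b) = (2 * tau b) * (2 * tau b)" by simp
  also have "\<dots> = 2 * of_int b * (2 * tau b) - of_int k * of_int l * 4"
    unfolding t e by (simp add: algebra_simps)
  finally have "4 * (tau b * tau b) = 4 * (of_int b * tau b - of_int (k * l))" by (simp add: algebra_simps)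
  thus ?thesis by (simp only: mult_cancel_left) simp
qed

lemma tau_cnj: "4 * (k * l) = b * b + M \<Longrightarrow> tau b * cnj (tau b) = of_int (k * l)"
  unfolding cnj_tau by (simp add: right_diff_distrib tau_sq)

text \<open>For \<open>form k b l\<close> this is an ideal of the quadratic order \<open>Om\<close>
  of discriminant \<open>- M\<close>, and the norm on it is \<open>k\<close> times the binary form
  \<open>(k, b, l)\<close>.\<close>

definition Lt :: "int \<Rightarrow> int \<Rightarrow> complex set" where
  "Lt k b = {of_int (x * k) + of_int y * tau b | x y. True}"

abbreviation Om :: "complex set" where "Om \<equiv> Lt 1 1"

lemma Lt_I: "of_int (x * k) + of_int y * tau b \<in> Lt k b"
  unfolding Lt_def by blast

lemma Lt_E: assumes "z \<in> Lt k b" obtains x y where "z = of_int (x * k) + of_int y * tau b"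
  using assms by (auto simp: Lt_def)

lemma Lt_unique: "of_int x + of_int y * tau b = of_int x' + of_int y' * tau b \<longleftrightarrow> x = x' \<and> y = y'"
proof
  assume h: "of_int x + of_int y * tau b = of_int x' + of_int y' * tau b"
  have "of_int y * sqrt (of_int M) = of_int y' * sqrt (of_int M)"
    using arg_cong[OF h, of Im] by (simp add: Im_tau)
  hence "y = y'" using M_pos by simp
  thus "x = x' \<and> y = y'" using h by simp
qed simp

lemma subgrp_Lt: "subgrp (Lt k b)"
  unfolding subgrp_def
proof (intro conjI ballI)
  show "0 \<in> Lt k b" using Lt_I[of 0 k 0 b] by simp
  fix z w assume "z \<in> Lt k b" "w \<in> Lt k b"
  then obtain x y x' y' where z: "z = of_int (x * k) + of_int y * tau b" and w: "w = of_int (x' * k) + of_int y' * tau b"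
    by (elim Lt_E)
  have "z - w = of_int ((x - x') * k) + of_int (y - y') * tau b" unfolding z w by (simp add: algebra_simps)
  thus "z - w \<in> Lt k b" by (simp only: Lt_I)
qed

lemma Lt_gen: "of_int k \<in> Lt k b" "tau b \<in> Lt k b"
  using Lt_I[of 1 k 0 b] Lt_I[of 0 k 1 b] by simp_all

lemma Lt_least: assumes "subgrp R" "of_int k \<in> R" "tau b \<in> R" shows "Lt k b \<subseteq> R"
proof
  fix z assume "z \<in> Lt k b"
  then obtain x y where z: "z = of_int (x * k) + of_int y * tau b" by (elim Lt_E)
  have "of_int x * of_int k + of_int y * tau b \<in> R"
    using assms by (intro subgrp_add subgrp_of_int_mult)
  thus "z \<in> R" by (simp add: z)
qed

lemma Lt_shift: "Lt k (b + 2 * (j * k)) = Lt k b"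
proof -
  have *: "Lt k (b + 2 * (j * k)) \<subseteq> Lt k b" for b j
  proof (rule Lt_least[OF subgrp_Lt Lt_gen(1)])
    have "of_int (j * k) + of_int 1 * tau b \<in> Lt k b" by (rule Lt_I)
    thus "tau (b + 2 * (j * k)) \<in> Lt k b" by (simp add: tau_shift add_ac)
  qed
  show ?thesis using *[of b j] *[of "b + 2 * (j * k)" "- j"] by (simp add: algebra_simps subset_antisym)
qed

lemma Lt_minus: "Lt k (- b) = cnj ` Lt k b"
proof -
  have t: "tau (- b) = - cnj (tau b)" by (simp add: tau_def cnj_rt field_simps)
  show ?thesis
  proof
    show "Lt k (- b) \<subseteq> cnj ` Lt k b"
    proof (rule Lt_least)
      show g: "subgrp (cnj ` Lt k b)" by (intro subgrp_cnj subgrp_Lt)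
      show "of_int k \<in> cnj ` Lt k b" using Lt_gen(1)[of k b] by (intro image_eqI[of _ _ "of_int k"]) auto
      show "tau (- b) \<in> cnj ` Lt k b" unfolding t using Lt_gen(2)[of b k] by (intro subgrp_minus[OF g] imageI)
    qed
    show "cnj ` Lt k b \<subseteq> Lt k (- b)"
    proof
      fix z assume "z \<in> cnj ` Lt k b"
      then obtain x y where "z = cnj (of_int (x * k) + of_int y * tau b)" by (auto elim: Lt_E)
      hence "z = of_int (x * k) + of_int (- y) * tau (- b)" by (simp add: t)
      thus "z \<in> Lt k (- b)" by (simp only: Lt_I)
    qed
  qed
qed

lemma Om_odd: "odd b \<Longrightarrow> Lt 1 b = Om"
proof -
  assume "odd b"
  then obtain j where "b = 1 + 2 * (j * 1)" by (auto elim: oddE)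
  thus ?thesis by (simp only: Lt_shift)
qed

lemma cnj_Om: "cnj ` Om = Om"
  using Lt_minus[of 1 1] Om_odd[of "-1"] by simp

lemma cnj_Om': "a \<in> Om \<Longrightarrow> cnj a \<in> Om"
  using cnj_Om by blast

definition form :: "int \<Rightarrow> int \<Rightarrow> int \<Rightarrow> bool" where
  "form k b l \<longleftrightarrow> 0 < k \<and> 4 * (k * l) = b * b + M"

lemma form_odd: "form k b l \<Longrightarrow> odd b"
proof -
  assume "form k b l"
  hence "b * b = 4 * (k * l) - M" by (simp add: form_def)
  moreover have "odd M" using M_mod4 by presburger
  ultimately have "odd (b * b)" by presburger
  thus ?thesis by simp
qed

lemma Om_mult_Lt: assumes "form k b l" "a \<in> Om" "x \<in> Lt k b" shows "a * x \<in> Lt k b"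
proof -
  have e: "4 * (k * l) = b * b + M" using assms(1) by (simp add: form_def)
  have "a \<in> Lt 1 b" using assms(2) Om_odd[OF form_odd[OF assms(1)]] by simp
  then obtain u v where a: "a = of_int (u * 1) + of_int v * tau b" by (elim Lt_E)
  obtain y z where x: "x = of_int (y * k) + of_int z * tau b" using assms(3) by (elim Lt_E)
  have "a * x = of_int (u * (y * k)) + of_int (u * z + v * (y * k)) * tau b + of_int (v * z) * (tau b * tau b)"
    unfolding a x by (simp add: algebra_simps)
  also have "\<dots> = of_int ((u * y - v * z * l) * k) + of_int (u * z + v * (y * k) + v * z * b) * tau b"
    unfolding tau_sq[OF e] by (simp add: algebra_simps)
  finally show ?thesis by (simp only: Lt_I)
qed

text \<open>These are the invertible modules over \<open>Om\<close>: the product with the conjugate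
  is principal, generated by a norm \<open>r\<close>. In this formulation invertibility passes to
  products and multiples at once, and the conjugate lattice represents the inverse class.\<close>

definition isLat :: "complex set \<Rightarrow> bool" where
  "isLat S \<longleftrightarrow> subgrp S \<and> (\<forall>a\<in>Om. \<forall>x\<in>S. a * x \<in> S) \<and> (\<exists>r>0. lmult S (cnj ` S) = scl (of_real r) Om)"

lemma isLat_subgrp: "isLat S \<Longrightarrow> subgrp S"
  by (simp add: isLat_def)

lemma one_Om: "1 \<in> Om"
  using Lt_gen(1)[of 1 1] by simp

lemma lmult_Om: assumes "subgrp S" "\<forall>a\<in>Om. \<forall>x\<in>S. a * x \<in> S" shows "lmult Om S = S"
proof
  show "lmult Om S \<subseteq> S" using assms by (intro lmult_least) auto
  show "S \<subseteq> lmult Om S" using lmult.prod[OF one_Om, of _ S] by auto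
qed

lemma isLat_lmult_Om: "isLat S \<Longrightarrow> lmult Om S = S"
  by (simp add: lmult_Om isLat_def)

lemma form_Om: "form 1 1 ((M + 1) div 4)"
  using M_mod4 unfolding form_def by presburger

lemma lmult_Om_Om: "lmult Om Om = Om"
  by (rule lmult_Om) (use subgrp_Lt Om_mult_Lt[OF form_Om] in auto)

lemma lmult_module: assumes "subgrp S" "subgrp T" "\<forall>a\<in>Om. \<forall>x\<in>S. a * x \<in> S" "a \<in> Om" "x \<in> lmult S T"
  shows "a * x \<in> lmult S T"
  using assms(5)
proof induction
  case (prod s t)
  have "(a * s) * t \<in> lmult S T" using prod assms by (intro lmult.prod) auto
  thus ?case by (simp only: mult.assoc)
next
  case (diff x y)
  thus ?case by (simp add: right_diff_distrib lmult.diff)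
qed

lemma isLat_lmult: assumes "isLat S" "isLat T" shows "isLat (lmult S T)"
proof -
  have g: "subgrp S" "subgrp T" "subgrp (cnj ` S)" "subgrp (cnj ` T)"
    using assms by (auto intro: isLat_subgrp subgrp_cnj)
  obtain r r' where r: "r > 0" "lmult S (cnj ` S) = scl (of_real r) Om"
    and r': "r' > 0" "lmult T (cnj ` T) = scl (of_real r') Om" using assms by (auto simp: isLat_def)
  have "lmult (lmult S T) (cnj ` lmult S T) = lmult S (lmult T (lmult (cnj ` S) (cnj ` T)))"
    unfolding cnj_lmult using g by (simp only: lmult_assoc subgrp_lmult)
  also have "lmult T (lmult (cnj ` S) (cnj ` T)) = lmult (lmult T (cnj ` T)) (cnj ` S)"
    using g by (simp only: lmult_comm[of "cnj ` S"] lmult_assoc)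
  also have "lmult S (lmult (lmult T (cnj ` T)) (cnj ` S)) = lmult (lmult T (cnj ` T)) (lmult S (cnj ` S))"
    using g by (simp only: lmult_comm[of "lmult T (cnj ` T)" "cnj ` S"] lmult_comm[of "lmult T (cnj ` T)" "lmult S (cnj ` S)"] lmult_assoc subgrp_lmult)
  also have "\<dots> = scl (of_real (r' * r)) Om"
    unfolding r r' by (simp add: lmult_scl_left lmult_scl_right subgrp_Lt subgrp_scl scl_scl lmult_Om_Om mult.commute)
  finally have "lmult (lmult S T) (cnj ` lmult S T) = scl (of_real (r' * r)) Om" .
  moreover have "0 < r' * r" using r r' by simp
  ultimately show ?thesis unfolding isLat_def
    using subgrp_lmult[OF g(1,2)] lmult_module[OF g(1,2)] assms(1)[unfolded isLat_def] by blast
qed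

lemma isLat_cnj: assumes "isLat S" shows "isLat (cnj ` S)"
proof -
  have "lmult (cnj ` S) (cnj ` cnj ` S) = lmult S (cnj ` S)" by (simp add: image_image lmult_comm)
  moreover have "a * cnj x \<in> cnj ` S" if "a \<in> Om" "x \<in> S" for a x
    using that assms cnj_Om'[of a] by (intro image_eqI[of _ _ "cnj a * x"]) (auto simp: isLat_def)
  ultimately show ?thesis using assms by (auto simp: isLat_def subgrp_cnj)
qed

lemma isLat_scl: assumes "isLat S" "c \<noteq> 0" shows "isLat (scl c S)"
proof -
  obtain r where r: "r > 0" "lmult S (cnj ` S) = scl (of_real r) Om" using assms by (auto simp: isLat_def)
  have g: "subgrp S" "subgrp (cnj ` S)" using assms by (auto intro: isLat_subgrp subgrp_cnj)
  have "lmult (scl c S) (cnj ` scl c S) = scl (c * cnj c * of_real r) Om"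
    unfolding cnj_scl using g by (simp add: lmult_scl_left lmult_scl_right subgrp_scl scl_scl r mult_ac)
  also have "c * cnj c * of_real r = of_real ((cmod c)\<^sup>2 * r)" by (simp add: complex_norm_square[symmetric] del: of_real_power)
  finally have 1: "lmult (scl c S) (cnj ` scl c S) = scl (of_real ((cmod c)\<^sup>2 * r)) Om" .
  have 2: "0 < (cmod c)\<^sup>2 * r" using r assms by simp
  have 3: "a * x \<in> scl c S" if "a \<in> Om" "x \<in> scl c S" for a x
  proof -
    from that(2) obtain y where y: "x = c * y" "y \<in> S" by (auto simp: scl_def)
    have "c * (a * y) \<in> scl c S" using that(1) y(2) assms(1) by (intro scl_I) (auto simp: isLat_def)
    thus ?thesis by (simp add: y mult_ac)
  qed
  show ?thesis unfolding isLat_def using 1 2 3 subgrp_scl[OF g(1)] by blast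
qed

text \<open>The product contains \<open>k * k\<close>, the trace term \<open>k * b\<close> and
  \<open>tau b\<close> times its conjugate, which is \<open>k * l\<close>. A Bezout relation for the
  coefficients combines them to \<open>k\<close>: primitive forms give invertible lattices.\<close>

lemma Lt_norm:
  assumes "form k b l" "u * k + v * b + w * l = 1"
  shows "lmult (Lt k b) (cnj ` Lt k b) = scl (of_int k) Om"
proof
  have e: "4 * (k * l) = b * b + M" using assms(1) by (simp add: form_def)
  note Ob = Om_odd[OF form_odd[OF assms(1)]]
  have t: "tau b \<in> Om" using Lt_gen(2)[of b 1] Ob by simp
  have i: "of_int x \<in> Om" for x using subgrp_of_int_mult[OF subgrp_Lt one_Om, of x] by simp
  have gO: "subgrp (scl (of_int k) Om)" by (intro subgrp_scl subgrp_Lt)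
  show "lmult (Lt k b) (cnj ` Lt k b) \<subseteq> scl (of_int k) Om"
  proof (rule lmult_least[OF gO])
    fix z w assume "z \<in> Lt k b" "w \<in> cnj ` Lt k b"
    then obtain x y x' y' where z: "z = of_int (x * k) + of_int y * tau b"
      and w: "w = cnj (of_int (x' * k) + of_int y' * tau b)" by (auto elim!: Lt_E)
    have "z * w = of_int (x * k * x' * k) + of_int (x * k * y') * cnj (tau b) + of_int (y * x' * k) * tau b
        + of_int (y * y') * (tau b * cnj (tau b))"
      unfolding z w by (simp add: algebra_simps)
    also have "\<dots> = of_int k * (of_int (x * x' * k) + of_int (x * y') * cnj (tau b) + of_int (y * x') * tau b + of_int (y * y' * l))"
      unfolding tau_cnj[OF e] by (simp add: algebra_simps)
    finally have "z * w = of_int k * (of_int (x * x' * k) + of_int (x * y') * cnj (tau b) + of_int (y * x') * tau b + of_int (y * y' * l))" .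
    moreover have "\<dots> \<in> scl (of_int k) Om"
      using t cnj_Om'[OF t] by (intro scl_I subgrp_add subgrp_of_int_mult subgrp_Lt i)
    ultimately show "z * w \<in> scl (of_int k) Om" by simp
  qed
  let ?P = "lmult (Lt k b) (cnj ` Lt k b)"
  have gP: "subgrp ?P" by (intro subgrp_lmult subgrp_cnj subgrp_Lt)
  have kc: "of_int k \<in> cnj ` Lt k b" using Lt_gen(1)[of k b] by (intro image_eqI[of _ _ "of_int k"]) auto
  have tc: "cnj (tau b) \<in> cnj ` Lt k b" using Lt_gen(2) by blast
  have kk: "of_int k * of_int k \<in> ?P" using Lt_gen kc by (intro lmult.prod)
  have tk: "tau b * of_int k \<in> ?P" using Lt_gen kc by (intro lmult.prod)
  have kt: "of_int k * cnj (tau b) \<in> ?P" using Lt_gen tc by (intro lmult.prod)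
  have tt: "tau b * cnj (tau b) \<in> ?P" using Lt_gen tc by (intro lmult.prod)
  have "of_int u * (of_int k * of_int k) + of_int v * (tau b * of_int k + of_int k * cnj (tau b))
      + of_int w * (tau b * cnj (tau b)) \<in> ?P"
    by (rule subgrp_add[OF gP subgrp_add[OF gP subgrp_of_int_mult[OF gP kk]
          subgrp_of_int_mult[OF gP subgrp_add[OF gP tk kt]]] subgrp_of_int_mult[OF gP tt]])
  also have "of_int u * (of_int k * of_int k) + of_int v * (tau b * of_int k + of_int k * cnj (tau b))
      + of_int w * (tau b * cnj (tau b)) = of_int ((u * k + v * b + w * l) * k)"
    unfolding tau_cnj[OF e] unfolding cnj_tau by (simp add: algebra_simps)
  finally have k: "of_int k \<in> ?P" by (simp add: assms(2))
  show "scl (of_int k) Om \<subseteq> ?P"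
  proof
    fix z assume "z \<in> scl (of_int k) Om"
    then obtain y where z: "z = of_int k * y" and "y \<in> Lt 1 b" unfolding Ob by (auto simp: scl_def)
    then obtain x' y' where y: "y = of_int (x' * 1) + of_int y' * tau b" by (elim Lt_E)
    have "of_int x' * of_int k + of_int y' * (tau b * of_int k) \<in> ?P"
      by (rule subgrp_add[OF gP subgrp_of_int_mult[OF gP k] subgrp_of_int_mult[OF gP tk]])
    thus "z \<in> ?P" unfolding z y by (simp add: algebra_simps)
  qed
qed

lemma isLat_Lt: assumes "form k b l" "u * k + v * b + w * l = 1" shows "isLat (Lt k b)"
  unfolding isLat_def
proof (intro conjI ballI)
  show "subgrp (Lt k b)" by (rule subgrp_Lt)
  show "a * x \<in> Lt k b" if "a \<in> Om" "x \<in> Lt k b" for a x using Om_mult_Lt[OF assms(1)] that .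
  show "\<exists>r>0. lmult (Lt k b) (cnj ` Lt k b) = scl (of_real r) Om"
    using Lt_norm[OF assms] assms(1) by (intro exI[of _ "of_int k"]) (simp add: form_def)
qed

end

section \<open>Reduction theory\<close>

lemma int_subgroup_principal:
  fixes Y :: "int set"
  assumes "k \<in> Y" "0 < k" "\<And>x y. x \<in> Y \<Longrightarrow> y \<in> Y \<Longrightarrow> x - y \<in> Y"
  obtains j where "0 < j" "j \<in> Y" "\<And>v. v \<in> Y \<Longrightarrow> j dvd v"
proof -
  have "\<exists>j. (0 < j \<and> j \<in> Y) \<and> (\<forall>i. 0 < i \<and> i \<in> Y \<longrightarrow> nat j \<le> nat i)"
    by (rule ex_has_least_nat[of "\<lambda>j. 0 < j \<and> j \<in> Y" k nat]) (use assms in simp)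
  then obtain j where j: "0 < j" "j \<in> Y" "\<And>i. 0 < i \<Longrightarrow> i \<in> Y \<Longrightarrow> j \<le> i" by fastforce
  have 0: "0 \<in> Y" using assms(3)[OF assms(1,1)] by simp
  have m: "- x \<in> Y" if "x \<in> Y" for x using assms(3)[OF 0 that] by simp
  have mult: "v - n * j \<in> Y" if "v \<in> Y" for v n
  proof (induction n rule: int_induct[where k = 0])
    case (step1 i)
    have e: "v - i * j - j = v - (i + 1) * j" by (simp add: algebra_simps)
    show ?case using assms(3)[OF step1(2) j(2)] unfolding e .
  next
    case (step2 i)
    have e: "v - i * j - - j = v - (i - 1) * j" by (simp add: algebra_simps)
    show ?case using assms(3)[OF step2(2) m[OF j(2)]] unfolding e .
  qed (use that in simp)
  have "j dvd v" if "v \<in> Y" for v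
  proof (rule ccontr)
    assume "\<not> j dvd v"
    hence "0 < v mod j" "v mod j < j"
      using pos_mod_sign[OF j(1), of v] pos_mod_bound[OF j(1), of v] by (simp_all add: dvd_eq_mod_eq_0 order_less_le)
    moreover have "v mod j \<in> Y" using mult[OF that, of "v div j"] by (simp add: minus_div_mult_eq_mod)
    ultimately show False using j(3) by fastforce
  qed
  with j show thesis by (intro that)
qed

text \<open>Because \<open>\<bar>b\<bar> \<le> k\<close>, the form is at least
  \<open>k * q + (l - k) * (y * y)\<close> with
  \<open>q = x * x - \<bar>x * y\<bar> + y * y\<close>. Moreover \<open>4 * q\<close> is a square
  plus \<open>3 * y * y\<close>, and also a square plus \<open>3 * x * x\<close>, so
  \<open>q \<ge> 1\<close> away from the origin.\<close>

lemma reduced_form_values: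
  fixes k b l x y :: int
  assumes "\<bar>b\<bar> \<le> k" "k \<le> l" "0 < k"
  shows "(x,y) \<noteq> (0,0) \<Longrightarrow> k \<le> k * (x * x) + b * (x * y) + l * (y * y)"
    and "y \<noteq> 0 \<Longrightarrow> k < l \<Longrightarrow> k < k * (x * x) + b * (x * y) + l * (y * y)"
proof -
  have s: "0 \<le> z * z" "z \<noteq> 0 \<Longrightarrow> 1 \<le> z * z" for z :: int
    using not_sum_squares_lt_zero[of z 0] by (auto simp: int_one_le_iff_zero_less zero_less_mult_iff)
  define q where "q = x * x - \<bar>x * y\<bar> + y * y"
  have q: "1 \<le> q" if "(x,y) \<noteq> (0,0)"
  proof -
    have "4 * q = (2 * \<bar>x\<bar> - \<bar>y\<bar>) * (2 * \<bar>x\<bar> - \<bar>y\<bar>) + 3 * (y * y)"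
      by (simp add: q_def algebra_simps abs_mult)
    moreover have "4 * q = (2 * \<bar>y\<bar> - \<bar>x\<bar>) * (2 * \<bar>y\<bar> - \<bar>x\<bar>) + 3 * (x * x)"
      by (simp add: q_def algebra_simps abs_mult)
    moreover have "x \<noteq> 0 \<or> y \<noteq> 0" using that by auto
    ultimately show ?thesis using s(2)[of x] s(2)[of y] s(1)[of "2 * \<bar>x\<bar> - \<bar>y\<bar>"] s(1)[of "2 * \<bar>y\<bar> - \<bar>x\<bar>"]
      by linarith
  qed
  have "\<bar>b * (x * y)\<bar> \<le> k * \<bar>x * y\<bar>" unfolding abs_mult[of b] using assms(1) by (intro mult_right_mono) auto
  hence "- (k * \<bar>x * y\<bar>) \<le> b * (x * y)" by linarith
  hence v: "k * q + (l - k) * (y * y) \<le> k * (x * x) + b * (x * y) + l * (y * y)"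
    by (simp add: q_def algebra_simps)
  have kq: "k \<le> k * q" if "(x,y) \<noteq> (0,0)" using q[OF that] assms(3) by (simp add: mult_le_cancel_left1)
  show "k \<le> k * (x * x) + b * (x * y) + l * (y * y)" if "(x,y) \<noteq> (0,0)"
  proof -
    have "0 \<le> (l - k) * (y * y)" using assms(2) s(1)[of y] by simp
    thus ?thesis using v kq[OF that] by linarith
  qed
  show "k < k * (x * x) + b * (x * y) + l * (y * y)" if "y \<noteq> 0" "k < l"
  proof -
    have "0 < (l - k) * (y * y)" using that s(2)[of y] by simp
    thus ?thesis using v kq that by fastforce
  qed
qed

lemma bezout3_int: "gcd (k::int) (gcd b l) = 1 \<Longrightarrow> \<exists>u v w. u * k + v * b + w * l = 1"
proof -
  assume g: "gcd k (gcd b l) = 1"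
  obtain v w where vw: "v * b + w * l = gcd b l" using bezout_int by blast
  obtain u t where "u * k + t * gcd b l = gcd k (gcd b l)" using bezout_int by blast
  hence "u * k + t * (v * b + w * l) = 1" unfolding g vw .
  hence "u * k + (t * v) * b + (t * w) * l = 1" by (simp only: distrib_left mult.assoc add.assoc)
  thus ?thesis by blast
qed

context three_mod_four begin

lemma scl_Lt_E: assumes "z \<in> scl c (Lt k b)" obtains x y where "z = c * (of_int (x * k) + of_int y * tau b)"
proof -
  obtain w where w: "z = c * w" "w \<in> Lt k b" using assms by (auto simp: scl_def)
  obtain x y where "w = of_int (x * k) + of_int y * tau b" using w(2) by (elim Lt_E)
  thus thesis using that w(1) by blast
qed

definition Red :: "(int \<times> int \<times> int) set" where
  "Red = {(k,b,l). form k b l \<and> - k < b \<and> b \<le> k \<and> k \<le> l \<and> (k = l \<longrightarrow> 0 < b)}"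

definition RedP :: "(int \<times> int \<times> int) set" where
  "RedP = {(k,b,l). form k b l \<and> - k < b \<and> b \<le> k \<and> k \<le> l \<and> (k = l \<longrightarrow> 0 < b) \<and> gcd k (gcd b l) = 1}"

lemma real_Om: assumes "z \<in> Om" "Im z = 0" obtains u where "z = of_int u"
proof -
  obtain x y where z: "z = of_int (x * 1) + of_int y * tau 1" using assms(1) by (elim Lt_E)
  have "y = 0" using assms(2) M_pos by (simp add: z Im_tau)
  thus thesis using that[of x] by (simp add: z)
qed

lemma real_scl_Om: assumes "z \<in> scl (of_real r) Om" "Im z = 0" obtains u where "z = of_real r * of_int u"
proof (cases "r = 0")
  case True
  thus ?thesis using assms(1) that[of 0] by (auto simp: scl_def)
next
  case False
  obtain w where w: "z = of_real r * w" "w \<in> Om" using assms(1) by (auto simp: scl_def)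
  have "Im w = 0" using assms(2) False by (simp add: w)
  then obtain u where "w = of_int u" using real_Om w(2) by blast
  thus ?thesis using that w by blast
qed

lemma mult_cnj_cmod: "z * cnj z = of_real ((cmod z)\<^sup>2)"
  by (metis complex_norm_square of_real_power)

text \<open>Norms of elements of \<open>S\<close> are integer multiples of \<open>r\<close>, so a
  shortest nonzero element exists. Dividing by it makes 1 shortest and turns the norm of the lattice
  into \<open>1 / k\<close>, where \<open>k\<close> is the integer belonging to that
  element.\<close>

lemma ex_normalized:
  assumes "isLat S"
  obtains k T where "0 < k" "sim S T" "isLat T" "1 \<in> T" "\<forall>x\<in>T. x \<noteq> 0 \<longrightarrow> 1 \<le> cmod x"
    "lmult T (cnj ` T) = scl (of_real (1 / of_int k)) Om"
proof -
  obtain r where r: "r > 0" "lmult S (cnj ` S) = scl (of_real r) Om" using assms by (auto simp: isLat_def)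
  have g: "subgrp S" "subgrp (cnj ` S)" using assms by (auto intro: isLat_subgrp subgrp_cnj)
  have norm: "\<exists>u. (cmod x)\<^sup>2 = r * of_int u" if "x \<in> S" for x
  proof -
    have "x * cnj x \<in> scl (of_real r) Om" unfolding r(2)[symmetric] using that by (intro lmult.prod) auto
    moreover have "Im (x * cnj x) = 0" unfolding mult_cnj_cmod by (rule Im_complex_of_real)
    ultimately obtain u where "x * cnj x = of_real r * of_int u" by (rule real_scl_Om)
    hence "complex_of_real ((cmod x)\<^sup>2) = of_real (r * of_int u)" unfolding mult_cnj_cmod by simp
    thus ?thesis unfolding of_real_eq_iff by blast
  qed
  have "\<exists>x\<in>S. x \<noteq> 0"
  proof (rule ccontr)
    assume "\<not> (\<exists>x\<in>S. x \<noteq> 0)"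
    hence "lmult S (cnj ` S) \<subseteq> {0}" by (intro lmult_least) (auto simp: subgrp_def)
    moreover have "of_real r * 1 \<in> scl (of_real r) Om" by (intro scl_I one_Om)
    ultimately show False using r by auto
  qed
  then obtain x1 where x1: "x1 \<in> S \<and> x1 \<noteq> 0" by blast
  \<comment> \<open>The quotients are integers by \<open>norm\<close>; floor and \<open>nat\<close>
    only make them available to the least-element principle.\<close>
  have "\<exists>x0. (x0 \<in> S \<and> x0 \<noteq> 0) \<and> (\<forall>y. y \<in> S \<and> y \<noteq> 0 \<longrightarrow> nat \<lfloor>(cmod x0)\<^sup>2 / r\<rfloor> \<le> nat \<lfloor>(cmod y)\<^sup>2 / r\<rfloor>)"
    by (rule ex_has_least_nat[of "\<lambda>x. x \<in> S \<and> x \<noteq> 0", OF x1])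
  then obtain x0 where x0: "x0 \<in> S" "x0 \<noteq> 0"
    and least: "\<And>y. y \<in> S \<Longrightarrow> y \<noteq> 0 \<Longrightarrow> nat \<lfloor>(cmod x0)\<^sup>2 / r\<rfloor> \<le> nat \<lfloor>(cmod y)\<^sup>2 / r\<rfloor>" by blast
  obtain k where k: "(cmod x0)\<^sup>2 = r * of_int k" using norm[OF x0(1)] by blast
  have "0 < r * of_int k" unfolding k[symmetric] using x0 by simp
  hence k0: "0 < k" using r(1) by (simp add: zero_less_mult_iff)
  define T where "T = scl (1 / x0) S"
  have c: "1 / x0 \<noteq> 0" using x0 by simp
  have "lmult T (cnj ` T) = scl (of_real (1 / of_int k)) Om"
  proof -
    have "lmult T (cnj ` T) = scl (1 / x0 * cnj (1 / x0) * of_real r) Om"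
      unfolding T_def cnj_scl using g by (simp add: lmult_scl_left lmult_scl_right subgrp_scl scl_scl r mult_ac)
    also have "1 / x0 * cnj (1 / x0) * of_real r = of_real ((cmod (1 / x0))\<^sup>2 * r)"
      unfolding mult_cnj_cmod by simp
    also have "(cmod (1 / x0))\<^sup>2 * r = 1 / of_int k"
      using r(1) by (simp add: norm_divide power_divide k)
    finally show ?thesis .
  qed
  moreover have "1 \<in> T" using scl_I[OF x0(1), of "1 / x0"] x0(2) by (simp add: T_def)
  moreover have "1 \<le> cmod z" if z: "z \<in> T" "z \<noteq> 0" for z
  proof -
    obtain y where y: "z = 1 / x0 * y" "y \<in> S" using z(1) by (auto simp: T_def scl_def)
    have y0: "y \<noteq> 0" using z y by auto
    obtain u where u: "(cmod y)\<^sup>2 = r * of_int u" using norm[OF y(2)] by blast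
    have "0 < r * of_int u" unfolding u[symmetric] using y0 by simp
    hence u0: "0 < u" using r(1) by (simp add: zero_less_mult_iff)
    have "k \<le> u" using least[OF y(2) y0] r(1) k0 u0 unfolding k u by simp
    hence "(cmod x0)\<^sup>2 \<le> (cmod y)\<^sup>2" unfolding k u using r(1) by simp
    hence "cmod x0 \<le> cmod y" by (rule power2_le_imp_le) simp
    thus ?thesis using x0 by (simp add: y norm_mult norm_divide field_simps)
  qed
  moreover have "sim S T" "isLat T" unfolding T_def using c assms by (simp_all add: sim_scl isLat_scl)
  ultimately show thesis using k0 by (intro that[of k T] ballI impI)
qed

text \<open>Multiplication by the conjugate of \<open>tau b\<close> takes the basis element
  \<open>tau b\<close> to \<open>k * l\<close> and \<open>k\<close> to
  \<open>- k * tau (- b)\<close>. On forms this exchanges the outer coefficients.\<close>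

lemma Lt_swap: assumes "form k b l" shows "scl (cnj (tau b)) (Lt k b) = scl (of_int k) (Lt l (- b))"
proof -
  have e: "4 * (k * l) = b * b + M" using assms by (simp add: form_def)
  have t: "tau (- b) = - cnj (tau b)" by (simp add: tau_def cnj_rt field_simps)
  have *: "cnj (tau b) * (of_int (x * k) + of_int y * tau b) = of_int k * (of_int (y * l) + of_int (- x) * tau (- b))" for x y
  proof -
    have "cnj (tau b) * (of_int (x * k) + of_int y * tau b) = of_int (x * k) * cnj (tau b) + of_int y * (tau b * cnj (tau b))"
      by (simp add: algebra_simps)
    thus ?thesis unfolding tau_cnj[OF e] t by (simp add: algebra_simps)
  qed
  show ?thesis
  proof
    show "scl (cnj (tau b)) (Lt k b) \<subseteq> scl (of_int k) (Lt l (- b))"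
    proof
      fix z assume "z \<in> scl (cnj (tau b)) (Lt k b)"
      then obtain x y where "z = cnj (tau b) * (of_int (x * k) + of_int y * tau b)" by (elim scl_Lt_E)
      thus "z \<in> scl (of_int k) (Lt l (- b))" unfolding * by (simp only: scl_I Lt_I)
    qed
    show "scl (of_int k) (Lt l (- b)) \<subseteq> scl (cnj (tau b)) (Lt k b)"
    proof
      fix z assume "z \<in> scl (of_int k) (Lt l (- b))"
      then obtain x y where "z = of_int k * (of_int (x * l) + of_int (- (- y)) * tau (- b))"
        unfolding minus_minus by (elim scl_Lt_E)
      thus "z \<in> scl (cnj (tau b)) (Lt k b)" unfolding *[symmetric] by (simp only: scl_I Lt_I)
    qed
  qed
qed

lemma tau_nz: "tau b \<noteq> 0"
  using M_pos by (auto simp: complex_eq_iff Im_tau)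

text \<open>Minimality of 1 makes the real elements of \<open>T\<close> the integers, so
  \<open>T\<close> is spanned by 1 and one further element \<open>t\<close>. The product with the
  conjugate being \<open>Om\<close> divided by \<open>k\<close> puts \<open>k\<close> times
  \<open>T\<close> inside \<open>Om\<close>; being all of it, it forces the coefficient of
  \<open>tau 1\<close> in \<open>k * t\<close> to be 1 and the form to be primitive.\<close>

lemma normalized_is_Lt:
  assumes "isLat T" "1 \<in> T" "\<forall>x\<in>T. x \<noteq> 0 \<longrightarrow> 1 \<le> cmod x" "0 < k"
    and "lmult T (cnj ` T) = scl (of_real (1 / of_int k)) Om"
  shows "\<exists>b l. scl (of_int k) T = Lt k b \<and> form k b l \<and> - k < b \<and> b \<le> k \<and> k \<le> l \<and> gcd k (gcd b l) = 1"
proof -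
  have k: "(of_int k :: complex) \<noteq> 0" using assms(4) by simp
  have g: "subgrp T" using assms(1) by (rule isLat_subgrp)
  have one: "1 \<in> cnj ` T" using assms(2) by (intro image_eqI[of _ _ 1]) auto
  have int: "of_int n \<in> T" for n using subgrp_of_int_mult[OF g assms(2), of n] by simp
  have N: "z \<in> lmult T (cnj ` T) \<longleftrightarrow> (\<exists>u v. of_int k * z = of_int u + of_int v * tau 1)" for z
  proof
    assume "z \<in> lmult T (cnj ` T)"
    then obtain w where "z = of_real (1 / of_int k) * w" "w \<in> Om" unfolding assms(5) by (auto simp: scl_def)
    thus "\<exists>u v. of_int k * z = of_int u + of_int v * tau 1" using k by (auto elim!: Lt_E)
  next
    assume "\<exists>u v. of_int k * z = of_int u + of_int v * tau 1"
    then obtain u v where "of_int k * z = of_int (u * 1) + of_int v * tau 1" by auto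
    hence "of_int k * z \<in> Om" by (simp only: Lt_I)
    hence "of_real (1 / of_int k) * (of_int k * z) \<in> lmult T (cnj ` T)" unfolding assms(5) by (rule scl_I)
    thus "z \<in> lmult T (cnj ` T)" using k by simp
  qed
  have coords: "\<exists>u v. of_int k * z = of_int u + of_int v * tau 1" if "z \<in> T" for z
    unfolding N[symmetric] using lmult.prod[OF that one] by simp
  have real_int: "\<exists>n. z = of_int n" if z: "z \<in> T" "Im z = 0" for z
  proof -
    have "z - of_int \<lfloor>Re z\<rfloor> \<in> T" using g z(1) int by (rule subgrp_diff)
    moreover have "z - of_int \<lfloor>Re z\<rfloor> = of_real (Re z - of_int \<lfloor>Re z\<rfloor>)" using z(2) by (simp add: complex_eq_iff)
    moreover have "cmod (of_real (Re z - of_int \<lfloor>Re z\<rfloor>)) < 1" by (simp only: norm_of_real) linarith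
    ultimately have "z - of_int \<lfloor>Re z\<rfloor> = 0" using assms(3) by fastforce
    thus ?thesis by (metis eq_iff_diff_eq_0)
  qed
  \<comment> \<open>\<open>Y\<close> collects the coefficients of \<open>tau 1\<close> in
    \<open>k\<close> times \<open>T\<close>; a generator \<open>j\<close> of this group yields the
    second basis vector.\<close>
  define Y where "Y = {v. \<exists>u. (of_int u + of_int v * tau 1) / of_int k \<in> T}"
  have "\<forall>a\<in>Om. \<forall>x\<in>T. a * x \<in> T" using assms(1) by (simp add: isLat_def)
  hence "tau 1 * 1 \<in> T" using assms(2) Lt_gen(2)[of 1 1] by blast
  hence "k \<in> Y" unfolding Y_def using k by (auto intro!: exI[of _ 0])
  moreover have "x - y \<in> Y" if "x \<in> Y" "y \<in> Y" for x y
  proof -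
    from that obtain u u' where "(of_int u + of_int x * tau 1) / of_int k \<in> T" "(of_int u' + of_int y * tau 1) / of_int k \<in> T"
      unfolding Y_def by blast
    from subgrp_diff[OF g this] have "(of_int (u - u') + of_int (x - y) * tau 1) / of_int k \<in> T"
      by (simp add: algebra_simps diff_divide_distrib add_divide_distrib)
    thus ?thesis unfolding Y_def by blast
  qed
  ultimately obtain j where j: "0 < j" "j \<in> Y" "\<And>v. v \<in> Y \<Longrightarrow> j dvd v"
    using int_subgroup_principal[OF _ assms(4)] by blast
  have basis: "\<exists>n q. z = of_int n + of_int q * t"
    if t: "t \<in> T" "of_int k * t = of_int u + of_int j * tau 1" and z: "z \<in> T" for t u z
  proof -
    obtain u' v where uv: "of_int k * z = of_int u' + of_int v * tau 1" using coords[OF z] by blast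
    hence "z = (of_int u' + of_int v * tau 1) / of_int k" using k by (simp add: field_simps)
    hence "v \<in> Y" using z unfolding Y_def by blast
    hence "j dvd v" by (rule j(3))
    then obtain q where q: "v = j * q" by (elim dvdE)
    have "of_int k * (z - of_int q * t) = of_int k * z - of_int q * (of_int k * t)" by (simp add: algebra_simps)
    also have "\<dots> = of_int (u' - q * u)" unfolding uv t(2) by (simp add: q algebra_simps)
    finally have "Im (of_int k * (z - of_int q * t)) = 0" by simp
    hence "Im (z - of_int q * t) = 0" using assms(4) by simp
    moreover have "z - of_int q * t \<in> T" using g z t(1) by (intro subgrp_diff subgrp_of_int_mult)
    ultimately obtain n where "z - of_int q * t = of_int n" using real_int by blast
    hence "z = of_int n + of_int q * t" by (simp add: algebra_simps)
    thus ?thesis by blast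
  qed
  have tt: "\<exists>l. of_int k * (t * cnj t) = of_int l" if "t \<in> T" for t
  proof -
    have "t * cnj t \<in> scl (of_real (1 / of_int k)) Om" unfolding assms(5)[symmetric] using that by (intro lmult.prod) auto
    moreover have "Im (t * cnj t) = 0" by simp
    ultimately obtain l where "t * cnj t = of_real (1 / of_int k) * of_int l" by (rule real_scl_Om)
    thus ?thesis using k by auto
  qed
  \<comment> \<open>In the basis \<open>1, t\<close>, after multiplication by \<open>k\<close>,
    every element of the product lattice has a coefficient of \<open>tau 1\<close> divisible by
    \<open>j\<close>; yet \<open>tau 1 / k\<close> belongs to it.\<close>
  have "j dvd 1"
  proof -
    obtain u where u: "(of_int u + of_int j * tau 1) / of_int k \<in> T" using j(2) by (auto simp: Y_def)
    define t where "t = (of_int u + of_int j * tau 1) / of_int k"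
    have t: "t \<in> T" "of_int k * t = of_int u + of_int j * tau 1" using u k by (simp_all add: t_def)
    have kct: "of_int k * cnj t = of_int (u + j) + of_int (- j) * tau 1"
    proof -
      have "of_int k * cnj t = cnj (of_int k * t)" by simp
      thus ?thesis unfolding t(2) by (simp add: cnj_tau algebra_simps)
    qed
    obtain l where l: "of_int k * (t * cnj t) = of_int l" using tt[OF t(1)] by blast
    define R where "R = {z. \<exists>u v. of_int k * z = of_int u + of_int (j * v) * tau 1}"
    have gR: "subgrp R" unfolding subgrp_def
    proof (intro conjI ballI)
      show "0 \<in> R" unfolding R_def by (auto intro!: exI[of _ 0])
      fix x y assume "x \<in> R" "y \<in> R"
      then obtain u v u' v' where "of_int k * x = of_int u + of_int (j * v) * tau 1" "of_int k * y = of_int u' + of_int (j * v') * tau 1"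
        unfolding R_def by blast
      hence "of_int k * (x - y) = of_int (u - u') + of_int (j * (v - v')) * tau 1" by (simp add: algebra_simps)
      thus "x - y \<in> R" unfolding R_def by blast
    qed
    have "lmult T (cnj ` T) \<subseteq> R"
    proof (rule lmult_least[OF gR])
      fix x y assume "x \<in> T" "y \<in> cnj ` T"
      then obtain y' where y: "y = cnj y'" "y' \<in> T" by blast
      obtain n q n' q' where x: "x = of_int n + of_int q * t" and y': "y' = of_int n' + of_int q' * t"
        using basis[OF t \<open>x \<in> T\<close>] basis[OF t y(2)] by blast
      have "of_int k * (x * y) = of_int (n * n' * k) + of_int (n * q') * (of_int k * cnj t) + of_int (n' * q) * (of_int k * t)
         + of_int (q * q') * (of_int k * (t * cnj t))" unfolding x y y' by (simp add: algebra_simps)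
      also have "\<dots> = of_int (n * n' * k + n * q' * (u + j) + n' * q * u + q * q' * l) + of_int (j * (n' * q - n * q')) * tau 1"
        unfolding kct t(2) l by (simp add: algebra_simps)
      finally show "x * y \<in> R" unfolding R_def by blast
    qed
    moreover have "tau 1 / of_int k \<in> lmult T (cnj ` T)"
      unfolding N using k by (intro exI[of _ 0] exI[of _ 1]) simp
    ultimately obtain u' v' where "of_int k * (tau 1 / of_int k) = of_int u' + of_int (j * v') * tau 1"
      unfolding R_def by blast
    hence "of_int 0 + of_int 1 * tau 1 = of_int u' + of_int (j * v') * tau 1" using k by simp
    hence "1 = j * v'" unfolding Lt_unique by simp
    thus ?thesis by (rule dvdI)
  qed
  hence j1: "j = 1" using j(1) by simp
  obtain u where u: "(of_int u + of_int 1 * tau 1) / of_int k \<in> T" using j(2) by (auto simp: Y_def j1)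
  \<comment> \<open>Adding an integer to \<open>t\<close> changes \<open>b\<close> by a multiple of
    \<open>2 * k\<close>. This is the representative of \<open>1 + 2 * u\<close> that is greater
    than \<open>- k\<close> and at most \<open>k\<close>.\<close>
  define b where "b = k - (k - (1 + 2 * u)) mod (2 * k)"
  have b: "- k < b" "b \<le> k"
    using assms(4) pos_mod_bound[of "2 * k" "k - (1 + 2 * u)"] pos_mod_sign[of "2 * k" "k - (1 + 2 * u)"] by (simp_all add: b_def)
  obtain q where q: "b = 1 + 2 * (u + q * k)"
  proof -
    have "b = 1 + 2 * (u + ((k - (1 + 2 * u)) div (2 * k)) * k)"
      unfolding b_def using div_mult_mod_eq[of "k - (1 + 2 * u)" "2 * k"] by (simp add: algebra_simps)
    thus thesis by (rule that)
  qed
  define t where "t = tau b / of_int k"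
  have tb: "tau b = of_int (u + q * k) + of_int j * tau 1"
    unfolding q tau_shift by (simp add: j1)
  have kt: "of_int k * t = tau b" using k by (simp add: t_def)
  have "t = (of_int u + of_int 1 * tau 1) / of_int k + of_int q" using k by (simp add: t_def tb j1 field_simps)
  hence tT: "t \<in> T" using subgrp_add[OF g u int] by simp
  have bas: "\<exists>n q. z = of_int n + of_int q * t" if "z \<in> T" for z
    by (rule basis[OF tT _ that]) (unfold kt, rule tb)
  have eq: "scl (of_int k) T = Lt k b"
  proof
    show "scl (of_int k) T \<subseteq> Lt k b"
    proof
      fix z assume "z \<in> scl (of_int k) T"
      then obtain y where y: "z = of_int k * y" "y \<in> T" by (auto simp: scl_def)
      obtain n q where "y = of_int n + of_int q * t" using bas[OF y(2)] by blast
      hence "z = of_int (n * k) + of_int q * (of_int k * t)" unfolding y by (simp add: algebra_simps)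
      thus "z \<in> Lt k b" unfolding kt by (simp only: Lt_I)
    qed
    show "Lt k b \<subseteq> scl (of_int k) T"
    proof (rule Lt_least)
      show "subgrp (scl (of_int k) T)" using g by (rule subgrp_scl)
      show "of_int k \<in> scl (of_int k) T" using scl_I[OF assms(2), of "of_int k"] by simp
      show "tau b \<in> scl (of_int k) T" using scl_I[OF tT, of "of_int k"] by (simp only: kt)
    qed
  qed
  obtain l where l: "of_int k * (t * cnj t) = of_int l" using tt[OF tT] by blast
  have "tau b * cnj (tau b) = of_int k * (of_int k * (t * cnj t))" unfolding kt[symmetric] by simp
  hence tbl: "tau b * cnj (tau b) = of_int (k * l)" unfolding l by simp
  have "4 * (tau b * cnj (tau b)) = of_int b * of_int b - rt * rt" by (simp add: tau_def cnj_rt field_simps)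
  hence "of_int (4 * (k * l)) = (of_int (b * b + M) :: complex)" unfolding tbl rt_sq by simp
  hence e: "4 * (k * l) = b * b + M" by (simp only: of_int_eq_iff)
  have form: "form k b l" using e assms(4) by (simp add: form_def)
  \<comment> \<open>The squared modulus of \<open>t\<close> is \<open>l / k\<close>, so minimality
    of 1 says precisely \<open>k \<le> l\<close>.\<close>
  have "1 \<le> cmod t" using bspec[OF assms(3) tT] tau_nz[of b] k by (simp add: t_def)
  hence "1 \<le> (cmod t)\<^sup>2" by simp
  moreover have "of_int k * (cmod t)\<^sup>2 = of_int l"
  proof -
    have "complex_of_real (of_int k * (cmod t)\<^sup>2) = of_real (of_int l)" using l unfolding mult_cnj_cmod by simp
    thus ?thesis by (simp only: of_real_eq_iff)
  qed
  ultimately have "of_int k * 1 \<le> (of_int l :: real)" using assms(4) by (metis mult_left_mono of_int_0_le_iff order_less_imp_le)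
  hence kl: "k \<le> l" by simp
  \<comment> \<open>The device used for \<open>j\<close> again: the gcd divides the integer part of
    \<open>k\<close> times any element of the product lattice, and \<open>1 / k\<close> is such an
    element.\<close>
  have "gcd k (gcd b l) = 1"
  proof -
    define R where "R = {z. \<exists>u v. of_int k * z = of_int u + of_int v * tau b \<and> gcd k (gcd b l) dvd u}"
    let ?g = "gcd k (gcd b l)"
    have gR: "subgrp R" unfolding subgrp_def
    proof (intro conjI ballI)
      show "0 \<in> R" unfolding R_def by (auto intro!: exI[of _ 0])
      fix x y assume "x \<in> R" "y \<in> R"
      then obtain u v u' v' where "of_int k * x = of_int u + of_int v * tau b" "?g dvd u" "of_int k * y = of_int u' + of_int v' * tau b" "?g dvd u'"
        unfolding R_def by blast
      hence "of_int k * (x - y) = of_int (u - u') + of_int (v - v') * tau b" "?g dvd u - u'" by (simp_all add: algebra_simps)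
      thus "x - y \<in> R" unfolding R_def by blast
    qed
    have "lmult T (cnj ` T) \<subseteq> R"
    proof (rule lmult_least[OF gR])
      fix x y assume "x \<in> T" "y \<in> cnj ` T"
      then obtain y' where y: "y = cnj y'" "y' \<in> T" by blast
      obtain n q n' q' where x: "x = of_int n + of_int q * t" and y': "y' = of_int n' + of_int q' * t"
        using bas[OF \<open>x \<in> T\<close>] bas[OF y(2)] by blast
      have kct: "of_int k * cnj t = of_int b - tau b"
      proof -
        have "of_int k * cnj t = cnj (of_int k * t)" by simp
        thus ?thesis unfolding kt cnj_tau .
      qed
      have "of_int k * (x * y) = of_int (n * n' * k) + of_int (n * q') * (of_int k * cnj t) + of_int (n' * q) * (of_int k * t)
         + of_int (q * q') * (of_int k * (t * cnj t))" unfolding x y y' by (simp add: algebra_simps)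
      also have "\<dots> = of_int (n * n' * k + n * q' * b + q * q' * l) + of_int (n' * q - n * q') * tau b"
        unfolding kct kt l by (simp add: algebra_simps)
      finally have "of_int k * (x * y) = of_int (n * n' * k + n * q' * b + q * q' * l) + of_int (n' * q - n * q') * tau b" .
      moreover have "?g dvd n * n' * k + n * q' * b + q * q' * l"
        by (intro dvd_add dvd_mult) (auto intro: dvd_trans[OF gcd_dvd2])
      ultimately show "x * y \<in> R" unfolding R_def by blast
    qed
    moreover have "1 / of_int k \<in> lmult T (cnj ` T)"
      unfolding N using k by (intro exI[of _ 1] exI[of _ 0]) simp
    ultimately obtain u' v' where h: "of_int k * (1 / of_int k) = of_int u' + of_int v' * tau b" "?g dvd u'"
      unfolding R_def by blast
    have "of_int 1 + of_int 0 * tau b = of_int u' + of_int v' * tau b" using h(1) k by simp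
    hence "u' = 1" unfolding Lt_unique by simp
    thus ?thesis using h(2) by simp
  qed
  with eq form b kl show ?thesis by (intro exI[of _ b] exI[of _ l] conjI)
qed

text \<open>After normalisation the only possible defect is \<open>k = l\<close> with negative
  \<open>b\<close>. Exchanging the outer coefficients by \<open>Lt_swap\<close> then turns
  \<open>b\<close> into \<open>- b\<close>.\<close>

theorem ex_reduced: assumes "isLat S" shows "\<exists>k b l. (k,b,l) \<in> RedP \<and> sim S (Lt k b)"
proof -
  obtain k T where T: "0 < k" "sim S T" "isLat T" "1 \<in> T" "\<forall>x\<in>T. x \<noteq> 0 \<longrightarrow> 1 \<le> cmod x"
    "lmult T (cnj ` T) = scl (of_real (1 / of_int k)) Om" using assms by (rule ex_normalized)
  from normalized_is_Lt[OF T(3,4,5,1,6)]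
  obtain b l where h: "scl (of_int k) T = Lt k b" "form k b l" "- k < b" "b \<le> k" "k \<le> l" "gcd k (gcd b l) = 1"
    by (elim exE conjE)
  have "sim T (Lt k b)" unfolding h(1)[symmetric] using T(1) by (intro sim_scl) simp
  hence s: "sim S (Lt k b)" using T(2) sim_trans by blast
  show ?thesis
  proof (cases "k = l \<and> b < 0")
    case True
    have "sim (Lt k b) (scl (cnj (tau b)) (Lt k b))" using tau_nz by (intro sim_scl) simp
    moreover have "sim (scl (of_int k) (Lt k (- b))) (Lt k (- b))" using T(1) by (intro sim_sym[OF sim_scl]) simp
    ultimately have "sim (Lt k b) (Lt k (- b))" using Lt_swap[OF h(2)] True sim_trans by simp
    hence "sim S (Lt k (- b))" using s sim_trans by blast
    moreover have "(k, - b, l) \<in> RedP" using h True by (auto simp: RedP_def form_def)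
    ultimately show ?thesis by blast
  next
    case False
    have "b \<noteq> 0" using form_odd[OF h(2)] by auto
    hence "(k, b, l) \<in> RedP" using h False by (auto simp: RedP_def)
    thus ?thesis using s by blast
  qed
qed

lemma cmod_Lt: assumes "form k b l"
  shows "(cmod (of_int (x * k) + of_int y * tau b))\<^sup>2 = of_int (k * (k * (x * x) + b * (x * y) + l * (y * y)))"
proof -
  have e: "4 * (k * l) = b * b + M" using assms by (simp add: form_def)
  let ?z = "of_int (x * k) + of_int y * tau b"
  have "?z * cnj ?z = of_int (x * k * x * k) + of_int (x * k * y) * (tau b + cnj (tau b)) + of_int (y * y) * (tau b * cnj (tau b))"
    by (simp add: algebra_simps)
  also have "\<dots> = of_int (k * (k * (x * x) + b * (x * y) + l * (y * y)))"
    unfolding tau_cnj[OF e] unfolding cnj_tau by (simp add: algebra_simps)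
  finally have "complex_of_real ((cmod ?z)\<^sup>2) = of_real (of_int (k * (k * (x * x) + b * (x * y) + l * (y * y))))"
    unfolding mult_cnj_cmod by simp
  thus ?thesis by (simp only: of_real_eq_iff)
qed

lemma Lt_min:
  assumes "form k b l" "\<bar>b\<bar> \<le> k" "k \<le> l" "z \<in> Lt k b" "z \<noteq> 0"
  shows "(of_int k)\<^sup>2 \<le> (cmod z)\<^sup>2" and "k < l \<Longrightarrow> (cmod z)\<^sup>2 = (of_int k)\<^sup>2 \<Longrightarrow> z = of_int k \<or> z = - of_int k"
proof -
  have k: "0 < k" using assms(1) by (simp add: form_def)
  obtain x y where z: "z = of_int (x * k) + of_int y * tau b" using assms(4) by (elim Lt_E)
  have nz: "(x,y) \<noteq> (0,0)" using assms(5) z by auto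
  note v = reduced_form_values[OF assms(2,3) k, where x = x and y = y]
  have "k * k \<le> k * (k * (x * x) + b * (x * y) + l * (y * y))" using v(1)[OF nz] k by simp
  hence "real_of_int (k * k) \<le> of_int (k * (k * (x * x) + b * (x * y) + l * (y * y)))" by (simp only: of_int_le_iff)
  thus "(of_int k)\<^sup>2 \<le> (cmod z)\<^sup>2" unfolding z cmod_Lt[OF assms(1)] by (simp add: power2_eq_square)
  assume kl: "k < l" and "(cmod z)\<^sup>2 = (of_int k)\<^sup>2"
  hence "real_of_int (k * (k * (x * x) + b * (x * y) + l * (y * y))) = of_int (k * k)"
    unfolding z cmod_Lt[OF assms(1)] by (simp add: power2_eq_square)
  hence "k * (k * (x * x) + b * (x * y) + l * (y * y)) = k * k" by (simp only: of_int_eq_iff)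
  hence e: "k * (x * x) + b * (x * y) + l * (y * y) = k" using k by simp
  hence y: "y = 0" using v(2) kl by fastforce
  hence "x * x = 1" using e k by simp
  hence "x = 1 \<or> x = - 1" by (simp add: square_eq_1_iff)
  thus "z = of_int k \<or> z = - of_int k" using y by (auto simp: z)
qed

lemma scl_Om_inj: assumes "0 < r" "0 < r'" "scl (of_real r) Om = scl (of_real r') Om" shows "r = r'"
proof -
  have *: "r' \<le> r" if "0 < r" "0 < r'" "scl (of_real r) Om = scl (of_real r') Om" for r r'
  proof -
    have "of_real r * 1 \<in> scl (of_real r') Om" unfolding that(3)[symmetric] by (intro scl_I one_Om)
    then obtain u where "of_real r * 1 = complex_of_real r' * of_int u" by (rule real_scl_Om) simp
    hence "complex_of_real r = of_real (r' * of_int u)" by simp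
    hence u: "r = r' * of_int u" by (simp only: of_real_eq_iff)
    hence "0 < u" using that by (simp add: zero_less_mult_iff)
    hence "1 \<le> real_of_int u" by simp
    thus ?thesis unfolding u using that(2) by simp
  qed
  show ?thesis using *[OF assms] *[OF assms(2,1) assms(3)[symmetric]] by simp
qed

lemma sim_Lt_norm:
  assumes "form k b l" "gcd k (gcd b l) = 1" "form k' b' l'" "gcd k' (gcd b' l') = 1"
    and "Lt k' b' = scl c (Lt k b)" "c \<noteq> 0"
  shows "of_int k' = (cmod c)\<^sup>2 * of_int k"
proof -
  obtain u v w where 1: "u * k + v * b + w * l = 1" using bezout3_int[OF assms(2)] by blast
  obtain u' v' w' where 2: "u' * k' + v' * b' + w' * l' = 1" using bezout3_int[OF assms(4)] by blast
  have "scl (of_real (of_int k')) Om = lmult (Lt k' b') (cnj ` Lt k' b')" using Lt_norm[OF assms(3) 2] by simp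
  also have "\<dots> = scl (c * cnj c * of_int k) Om"
    unfolding assms(5) cnj_scl by (simp add: lmult_scl_left lmult_scl_right subgrp_scl subgrp_Lt subgrp_cnj scl_scl Lt_norm[OF assms(1) 1] mult_ac)
  also have "c * cnj c * of_int k = of_real ((cmod c)\<^sup>2 * of_int k)" unfolding mult_cnj_cmod by simp
  finally show ?thesis using assms(1,3,6) by (intro scl_Om_inj) (simp_all add: form_def)
qed

text \<open>A homothety by \<open>c\<close> sends the vector \<open>k\<close> to one of norm
  \<open>k * k'\<close>, while the shortest vectors of the target have norm \<open>k' * k'\<close>;
  so \<open>k' \<le> k\<close>, and equality follows by symmetry. If \<open>k' < l'\<close>, the
  only shortest vectors are \<open>k'\<close> and its negative, whence \<open>c\<close> is 1 or -1
  and \<open>b\<close> is fixed modulo \<open>2 * k\<close>. In the remaining case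
  \<open>k = l\<close> the discriminant gives \<open>b\<close> up to sign, and the convention
  \<open>0 < b\<close> decides.\<close>

theorem reduced_unique:
  assumes "(k,b,l) \<in> RedP" "(k',b',l') \<in> RedP" "sim (Lt k b) (Lt k' b')"
  shows "(k,b,l) = (k',b',l')"
proof -
  have half: "k' \<le> k \<and> (k' = k \<longrightarrow> k' < l' \<longrightarrow> b = b')"
    if "(k,b,l) \<in> RedP" "(k',b',l') \<in> RedP" "sim (Lt k b) (Lt k' b')" for k b l k' b' l'
  proof -
    have h: "form k b l" "- k < b" "b \<le> k" "gcd k (gcd b l) = 1"
      "form k' b' l'" "- k' < b'" "b' \<le> k'" "k' \<le> l'" "gcd k' (gcd b' l') = 1" using that(1,2) by (auto simp: RedP_def)
    have k: "0 < k" "0 < k'" using h by (simp_all add: form_def)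
    from that(3) obtain c where c: "c \<noteq> 0" "Lt k' b' = scl c (Lt k b)" by (auto simp: sim_def)
    have n: "of_int k' = (cmod c)\<^sup>2 * of_int k" by (rule sim_Lt_norm[OF h(1,4,5,9) c(2,1)])
    have ck: "c * of_int k \<in> Lt k' b'" unfolding c(2) by (intro scl_I Lt_gen)
    have ck0: "c * of_int k \<noteq> 0" using c k by simp
    have ab: "\<bar>b'\<bar> \<le> k'" using h by simp
    note m = Lt_min[OF h(5) ab h(8) ck ck0]
    have nn: "(cmod (c * of_int k))\<^sup>2 = of_int k' * of_int k"
      unfolding n by (simp add: norm_mult power_mult_distrib power2_eq_square)
    have "real_of_int k' * of_int k' \<le> of_int k' * of_int k" using m(1) unfolding nn by (simp add: power2_eq_square)
    hence "k' \<le> k" using k by simp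
    moreover have "b = b'" if e: "k' = k" "k' < l'"
    proof -
      have "c * of_int k = 1 * of_int k \<or> c * of_int k = - 1 * of_int k"
        using m(2)[OF e(2)] nn unfolding e(1) by (simp add: power2_eq_square)
      hence "c = 1 \<or> c = - 1" unfolding mult_cancel_right using k by auto
      hence "Lt k' b' \<subseteq> Lt k b"
      proof
        assume "c = - 1"
        hence "Lt k' b' = scl (- 1) (Lt k b)" using c(2) by simp
        thus ?thesis using subgrp_minus[OF subgrp_Lt] by (auto simp: scl_def)
      qed (use c(2) in \<open>simp add: scl_1\<close>)
      hence "tau b' \<in> Lt k b" using Lt_gen(2) by blast
      then obtain x y where xy: "tau b' = of_int (x * k) + of_int y * tau b" by (elim Lt_E)
      have "y = 1" using arg_cong[OF xy, of Im] M_pos by (simp add: Im_tau)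
      hence "tau b' = tau (b + 2 * (x * k))" unfolding tau_shift using xy by simp
      from arg_cong[OF this, of Re] have "real_of_int b' = of_int (b + 2 * (x * k))" unfolding Re_tau by simp
      hence bb: "b' = b + 2 * (x * k)" by (simp only: of_int_eq_iff)
      have "x = 0"
      proof (rule ccontr)
        assume "x \<noteq> 0"
        hence "k \<le> \<bar>x\<bar> * k" using k by (simp add: mult_le_cancel_right1)
        hence "k \<le> \<bar>x * k\<bar>" using k by (simp add: abs_mult)
        thus False using bb h e k by linarith
      qed
      thus ?thesis using bb by simp
    qed
    ultimately show ?thesis by blast
  qed
  have k: "k = k'" using half[OF assms] half[OF assms(2,1) sim_sym[OF assms(3)]] by simp
  have h: "4 * (k * l) = b * b + M" "4 * (k * l') = b' * b' + M" "0 < k" "k \<le> l" "k \<le> l'" "k = l \<longrightarrow> 0 < b" "k = l' \<longrightarrow> 0 < b'"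
    using assms(1,2) k by (auto simp: RedP_def form_def)
  have b: "b = b'"
  proof (cases "k < l \<or> k < l'")
    case True
    thus ?thesis using half[OF assms] half[OF assms(2,1) sim_sym[OF assms(3)]] k by auto
  next
    case False
    hence "l = k" "l' = k" "0 < b" "0 < b'" using h by auto
    hence "b * b = b' * b'" using h by simp
    thus ?thesis using \<open>0 < b\<close> \<open>0 < b'\<close> by (simp add: square_eq_iff)
  qed
  have "4 * (k * l) = 4 * (k * l')" unfolding h(1,2) b ..
  hence "k * l = k * l'" by (simp only: mult_cancel_left) simp
  hence "l = l'" using h(3) by simp
  thus ?thesis using k b by simp
qed

end

section \<open>The form class group\<close>

lemma (in comm_group) klein_dvd_order:
  assumes "finite (carrier G)" "a \<in> carrier G" "b \<in> carrier G" "a \<otimes> a = \<one>" "b \<otimes> b = \<one>"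
    and "a \<noteq> \<one>" "b \<noteq> \<one>" "a \<noteq> b"
  shows "4 dvd order G"
proof -
  define H where "H = {\<one>, a, b, a \<otimes> b}"
  note ab = assms(2,3)
  have l: "a \<otimes> (a \<otimes> x) = x" "b \<otimes> (b \<otimes> x) = x" "b \<otimes> (a \<otimes> x) = a \<otimes> (b \<otimes> x)" if "x \<in> carrier G" for x
    using ab that assms(4,5) by (simp_all add: m_assoc[symmetric] m_comm[of b a])
  have "subgroup H G"
  proof (rule subgroupI)
    show "H \<subseteq> carrier G" "H \<noteq> {}" using ab by (auto simp: H_def)
    have "inv a = a" "inv b = b" using ab assms(4,5) by (simp_all add: inv_equality)
    moreover from this have "inv (a \<otimes> b) = a \<otimes> b" using ab by (simp add: inv_mult)
    ultimately show "\<And>x. x \<in> H \<Longrightarrow> inv x \<in> H" by (auto simp: H_def)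
    show "\<And>x y. x \<in> H \<Longrightarrow> y \<in> H \<Longrightarrow> x \<otimes> y \<in> H"
      using ab l assms(4,5) by (auto simp: H_def m_assoc m_comm[of b a])
  qed
  hence "card (rcosets H) * card H = order G" by (rule lagrange)
  moreover have "card H = 4"
  proof -
    have "a \<otimes> b \<noteq> \<one>" using l(1)[OF ab(2)] ab assms(8) by (metis r_one)
    moreover have "a \<otimes> b \<noteq> a" "a \<otimes> b \<noteq> b" using ab assms(6,7) by (metis l_cancel_one r_cancel_one)+
    ultimately show ?thesis using assms(6-8) by (auto simp: H_def)
  qed
  ultimately show ?thesis by (metis dvd_triv_right)
qed

lemma (in group) order_four_dvd_order:
  assumes "finite (carrier G)" "c \<in> carrier G" "c \<otimes> c \<noteq> \<one>" "(c \<otimes> c) \<otimes> (c \<otimes> c) = \<one>"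
  shows "4 dvd order G"
proof -
  have "c [^] (2::nat) = c \<otimes> c" using assms(2) by (simp add: numeral_2_eq_2)
  moreover from this have "c [^] (4::nat) = (c \<otimes> c) \<otimes> (c \<otimes> c)"
    using assms(2) nat_pow_mult[of c 2 2] by simp
  ultimately have d: "ord c dvd 4" "\<not> ord c dvd 2" using assms by (simp_all add: pow_eq_id[symmetric])
  have "ord c \<le> 4" using dvd_imp_le[OF d(1)] by simp
  hence "ord c = 0 \<or> ord c = 1 \<or> ord c = 2 \<or> ord c = 3 \<or> ord c = 4" by linarith
  hence "ord c = 4" using d by auto
  thus ?thesis using ord_dvd_group_order[OF assms(2)] by simp
qed

context three_mod_four begin

definition lat :: "int \<times> int \<times> int \<Rightarrow> complex set" where
  "lat = (\<lambda>(k,b,l). Lt k b)"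

definition rd :: "complex set \<Rightarrow> int \<times> int \<times> int" where
  "rd S = (THE x. x \<in> RedP \<and> sim S (lat x))"

lemma isLat_gcd: assumes "form k b l" "gcd k (gcd b l) = 1" shows "isLat (Lt k b)"
  using bezout3_int[OF assms(2)] isLat_Lt[OF assms(1)] by blast

lemma isLat_lat: "x \<in> RedP \<Longrightarrow> isLat (lat x)"
  by (auto simp: RedP_def lat_def intro: isLat_gcd)

lemma rd_eqI: assumes "x \<in> RedP" "sim S (lat x)" shows "rd S = x"
  unfolding rd_def
proof (rule the_equality)
  fix y assume y: "y \<in> RedP \<and> sim S (lat y)"
  hence s: "sim (lat x) (lat y)" using sim_sym[OF assms(2)] sim_trans by blast
  obtain k b l k' b' l' where xy: "x = (k,b,l)" "y = (k',b',l')" by (cases x; cases y)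
  show "y = x" using reduced_unique[of k b l k' b' l'] y s assms(1) unfolding xy by (simp add: lat_def)
qed (use assms in auto)

lemma rd_RedP: "isLat S \<Longrightarrow> rd S \<in> RedP" and sim_rd: "isLat S \<Longrightarrow> sim S (lat (rd S))"
proof -
  assume "isLat S"
  then obtain x where x: "x \<in> RedP" "sim S (lat x)" using ex_reduced unfolding lat_def by fastforce
  thus "rd S \<in> RedP" "sim S (lat (rd S))" using rd_eqI[OF x] by simp_all
qed

lemma rd_lat: "x \<in> RedP \<Longrightarrow> rd (lat x) = x"
  by (intro rd_eqI sim_refl)

lemma rd_eq_iff: assumes "isLat S" "isLat T" shows "rd S = rd T \<longleftrightarrow> sim S T"
proof
  assume "rd S = rd T"
  thus "sim S T" using sim_rd[OF assms(1)] sim_sym[OF sim_rd[OF assms(2)]] sim_trans by metis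
next
  assume "sim S T"
  hence "sim S (lat (rd T))" using sim_rd[OF assms(2)] sim_trans by blast
  thus "rd S = rd T" using rd_RedP[OF assms(2)] by (intro rd_eqI)
qed

text \<open>The group lives on the primitive reduced forms themselves, one per class, so its order
  is literally \<open>card RedP\<close>. Composition is multiplication of lattices, which makes
  associativity immediate.\<close>

definition Cl :: "(int \<times> int \<times> int) monoid" where
  "Cl = \<lparr>carrier = RedP, mult = \<lambda>x y. rd (lmult (lat x) (lat y)), one = rd Om\<rparr>"

lemma Cl_simps: "carrier Cl = RedP" "mult Cl x y = rd (lmult (lat x) (lat y))" "one Cl = rd Om"
  by (simp_all add: Cl_def)

lemma isLat_Om: "isLat Om"
  by (rule isLat_gcd[OF form_Om]) simp

lemma Cl_mult_rd: assumes "isLat S" "isLat T" shows "mult Cl (rd S) (rd T) = rd (lmult S T)"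
  unfolding Cl_simps
proof (subst rd_eq_iff)
  show "isLat (lmult (lat (rd S)) (lat (rd T)))" "isLat (lmult S T)"
    using assms by (auto intro!: isLat_lmult isLat_lat rd_RedP)
  show "sim (lmult (lat (rd S)) (lat (rd T))) (lmult S T)"
    using assms by (intro sim_sym[OF sim_lmult] sim_rd isLat_subgrp)
qed

lemma rd_scl_Om: "c \<noteq> 0 \<Longrightarrow> rd (scl c Om) = rd Om"
  using rd_eq_iff[OF isLat_scl[OF isLat_Om] isLat_Om] sim_sym[OF sim_scl] by simp

lemma comm_group_Cl: "comm_group Cl"
proof (rule comm_groupI)
  show "\<one>\<^bsub>Cl\<^esub> \<in> carrier Cl" by (simp add: Cl_simps rd_RedP isLat_Om)
  show "x \<otimes>\<^bsub>Cl\<^esub> y \<in> carrier Cl" if "x \<in> carrier Cl" "y \<in> carrier Cl" for x y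
    using that by (simp add: Cl_simps rd_RedP isLat_lmult isLat_lat)
  show "x \<otimes>\<^bsub>Cl\<^esub> y \<otimes>\<^bsub>Cl\<^esub> z = x \<otimes>\<^bsub>Cl\<^esub> (y \<otimes>\<^bsub>Cl\<^esub> z)"
    if "x \<in> carrier Cl" "y \<in> carrier Cl" "z \<in> carrier Cl" for x y z
  proof -
    have m: "isLat (lat x)" "isLat (lat y)" "isLat (lat z)" using that by (simp_all add: Cl_simps isLat_lat)
    have "x \<otimes>\<^bsub>Cl\<^esub> y \<otimes>\<^bsub>Cl\<^esub> z = rd (lat x) \<otimes>\<^bsub>Cl\<^esub> rd (lat y) \<otimes>\<^bsub>Cl\<^esub> rd (lat z)"
      using that by (simp add: Cl_simps(1) rd_lat)
    also have "\<dots> = rd (lat x) \<otimes>\<^bsub>Cl\<^esub> (rd (lat y) \<otimes>\<^bsub>Cl\<^esub> rd (lat z))"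
      using m by (simp add: Cl_mult_rd isLat_lmult lmult_assoc isLat_subgrp)
    also have "\<dots> = x \<otimes>\<^bsub>Cl\<^esub> (y \<otimes>\<^bsub>Cl\<^esub> z)" using that by (simp add: Cl_simps(1) rd_lat)
    finally show ?thesis .
  qed
  show "x \<otimes>\<^bsub>Cl\<^esub> y = y \<otimes>\<^bsub>Cl\<^esub> x" for x y by (simp add: Cl_simps lmult_comm)
  show "\<one>\<^bsub>Cl\<^esub> \<otimes>\<^bsub>Cl\<^esub> x = x" if "x \<in> carrier Cl" for x
  proof -
    have x: "x \<in> RedP" using that by (simp add: Cl_simps)
    have "rd Om \<otimes>\<^bsub>Cl\<^esub> rd (lat x) = rd (lat x)"
      using x by (simp add: Cl_mult_rd isLat_Om isLat_lat isLat_lmult_Om)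
    thus ?thesis by (simp only: rd_lat[OF x] Cl_simps(3))
  qed
  show "\<exists>y\<in>carrier Cl. y \<otimes>\<^bsub>Cl\<^esub> x = \<one>\<^bsub>Cl\<^esub>" if "x \<in> carrier Cl" for x
  proof -
    have x: "x \<in> RedP" using that by (simp add: Cl_simps)
    have L: "isLat (lat x)" "isLat (cnj ` lat x)" using x by (simp_all add: isLat_lat isLat_cnj)
    obtain r where r: "r > 0" "lmult (lat x) (cnj ` lat x) = scl (of_real r) Om" using L(1) by (auto simp: isLat_def)
    have "rd (cnj ` lat x) \<otimes>\<^bsub>Cl\<^esub> rd (lat x) = rd (scl (of_real r) Om)"
      using L by (simp add: Cl_mult_rd lmult_comm[of "cnj ` lat x"] r)
    also have "\<dots> = \<one>\<^bsub>Cl\<^esub>" using r(1) by (simp add: rd_scl_Om Cl_simps)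
    finally show ?thesis using L(2) x rd_RedP by (auto simp: rd_lat Cl_simps(1))
  qed
qed

lemma finite_Red: "finite Red"
proof (rule finite_subset)
  show "Red \<subseteq> {0..M} \<times> {- M..M} \<times> {0..M * M + M}"
  proof
    fix x assume "x \<in> Red"
    then obtain k b l where x: "x = (k,b,l)" and h: "0 < k" "4 * (k * l) = b * b + M" "- k < b" "b \<le> k" "k \<le> l"
      by (auto simp: Red_def form_def)
    have "\<bar>b\<bar> * \<bar>b\<bar> \<le> k * k" using h by (intro mult_mono) auto
    hence bb: "b * b \<le> k * k" by simp
    have kl: "k * k \<le> k * l" using h by simp
    have "k \<le> k * k" using h pos_factors_le by blast
    hence k: "k \<le> M" using bb kl h(1,2) by linarith
    have "l \<le> k * l" "0 < k * l" using h pos_factors_le[of k l] by simp_all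
    moreover have "k * k \<le> M * M" using h(1) k by (intro mult_mono) auto
    ultimately have "l \<le> M * M + M" using h(2) bb kl M_pos by linarith
    thus "x \<in> {0..M} \<times> {- M..M} \<times> {0..M * M + M}" using h k by (auto simp: x)
  qed
qed auto

lemma finite_RedP: "finite RedP"
  by (rule finite_subset[OF _ finite_Red]) (auto simp: Red_def RedP_def)

section \<open>Ambiguous classes and elements of order 4\<close>

text \<open>Changing the middle coefficient from \<open>d\<close> to \<open>- d\<close> is a shift
  by \<open>2 * d\<close>, so \<open>Lt d d\<close> is its own conjugate and its square is its norm,
  a principal lattice. Coprimality of \<open>d\<close> and \<open>e\<close> makes
  \<open>(d, d, (d + e) / 4)\<close> primitive.\<close>

lemma Lt_ambiguous:
  assumes "M = d * e" "0 < d" "coprime d e"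
  shows "\<exists>l. 4 * l = d + e \<and> form d d l" and "isLat (Lt d d)"
    and "lmult (Lt d d) (Lt d d) = scl (of_int d) Om"
proof -
  have "4 dvd d + e" using mult_mod4_eq3(3)[of d e] M_mod4 assms(1) by simp
  then obtain l where l: "4 * l = d + e" unfolding dvd_def by metis
  have "d * (4 * l) = d * (d + e)" unfolding l ..
  hence f: "form d d l" using assms unfolding form_def by (simp add: algebra_simps)
  show "\<exists>l. 4 * l = d + e \<and> form d d l" using l f by blast
  have "coprime d l"
  proof (rule coprimeI)
    fix q assume "q dvd d" "q dvd l"
    moreover have "e = 4 * l - d" using l by simp
    ultimately have "q dvd e" by simp
    thus "is_unit q" using coprime_common_divisor[OF assms(3) \<open>q dvd d\<close>] by blast
  qed
  hence g: "gcd d (gcd d l) = 1" by simp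
  show "isLat (Lt d d)" using isLat_gcd[OF f g] .
  have "cnj ` Lt d d = Lt d d"
    using Lt_minus[of d d] Lt_shift[of d d "-1"] by simp
  moreover obtain u v w where "u * d + v * d + w * l = 1" using bezout3_int[OF g] by blast
  ultimately show "lmult (Lt d d) (Lt d d) = scl (of_int d) Om" using Lt_norm[OF f] by metis
qed

text \<open>The vector \<open>c * d\<close> of \<open>Lt d' d'\<close> has norm
  \<open>d * d'\<close>, so the form \<open>(d', d', l')\<close> takes the value \<open>d\<close>.
  Completing the square, \<open>4 * d * d'\<close> is a square plus \<open>M * y * y\<close>; being
  less than \<open>M\<close>, it leaves \<open>y = 0\<close>, so \<open>d = d' * x * x\<close> and
  \<open>d'\<close> divides \<open>d\<close>.\<close>

lemma ambiguous_not_sim: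
  assumes "M = d * e" "0 < d" "coprime d e" "M = d' * e'" "0 < d'" "coprime d' e'"
    and "coprime d d'" "4 * (d * d') < M" "sim (Lt d d) (Lt d' d')"
  shows "d' = 1"
proof -
  obtain l where l: "4 * l = d + e" "form d d l" using Lt_ambiguous(1)[OF assms(1-3)] by blast
  obtain l' where l': "4 * l' = d' + e'" "form d' d' l'" using Lt_ambiguous(1)[OF assms(4-6)] by blast
  obtain c where c: "c \<noteq> 0" "Lt d' d' = scl c (Lt d d)" using assms(9) by (auto simp: sim_def)
  have g: "gcd k (gcd k l) = 1" if "4 * l = k + e" "coprime k e" for k l e :: int
  proof -
    have "coprime k l"
    proof (rule coprimeI)
      fix q assume "q dvd k" "q dvd l"
      moreover have "e = 4 * l - k" using that(1) by simp
      ultimately have "q dvd e" by simp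
      thus "is_unit q" using coprime_common_divisor[OF that(2) \<open>q dvd k\<close>] by blast
    qed
    thus ?thesis by simp
  qed
  have n: "of_int d' = (cmod c)\<^sup>2 * of_int d"
    by (rule sim_Lt_norm[OF l(2) g[OF l(1) assms(3)] l'(2) g[OF l'(1) assms(6)] c(2,1)])
  have "c * of_int d \<in> Lt d' d'" unfolding c(2) by (intro scl_I Lt_gen)
  then obtain x y where xy: "c * of_int d = of_int (x * d') + of_int y * tau d'" by (elim Lt_E)
  have "real_of_int (d' * (d' * (x * x) + d' * (x * y) + l' * (y * y))) = (cmod (c * of_int d))\<^sup>2"
    unfolding xy cmod_Lt[OF l'(2)] ..
  also have "\<dots> = of_int (d' * d)"
    by (simp add: n norm_mult power_mult_distrib power2_eq_square)
  finally have "d' * (d' * (x * x) + d' * (x * y) + l' * (y * y)) = d' * d" by (simp only: of_int_eq_iff)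
  hence v: "d' * (x * x) + d' * (x * y) + l' * (y * y) = d" using assms(5) by simp
  have "4 * (d * d') = (2 * d' * x + d' * y) * (2 * d' * x + d' * y) + M * (y * y)"
  proof -
    have "4 * (d' * l') = d' * d' + M" using l'(2) by (simp add: form_def)
    hence M: "M = 4 * (d' * l') - d' * d'" by simp
    show ?thesis unfolding v[symmetric] M by (simp add: algebra_simps)
  qed
  moreover have "0 \<le> (2 * d' * x + d' * y) * (2 * d' * x + d' * y)" by simp
  ultimately have "M * (y * y) < M * 1" using assms(8) by linarith
  hence "y * y < 1" using M_pos by (simp only: mult_less_cancel_left_pos)
  moreover have "y = 0 \<or> 0 < y * y" by (auto simp: zero_less_mult_iff)
  ultimately have y: "y = 0" by linarith
  have "d = d' * (x * x)" using v by (simp add: y)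
  hence "d' dvd d" by (rule dvdI)
  hence "is_unit d'" using coprime_common_divisor[OF assms(7) _ dvd_refl] by blast
  thus ?thesis using assms(5) by simp
qed

text \<open>The classes of \<open>m1\<close> and \<open>m2\<close> have order 2 and are distinct.
  The factor \<open>p\<close> is kept out of both: together with \<open>4 < p\<close> this gives
  \<open>4 * m1 * m2 < M\<close>, the bound under which \<open>ambiguous_not_sim\<close> separates
  them.\<close>

theorem RedP_card_klein:
  assumes "M = p * (m1 * m2)" "4 < p" "1 < m1" "1 < m2" "coprime m1 m2" "coprime p m1" "coprime p m2"
  shows "4 dvd card RedP"
proof -
  interpret comm_group Cl by (rule comm_group_Cl)
  have M: "M = m1 * (p * m2)" "M = m2 * (p * m1)" "M = 1 * M" using assms(1) by (simp_all add: mult_ac)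
  have c: "coprime m1 (p * m2)" "coprime m2 (p * m1)" "coprime 1 M"
    using assms(5-7) by (simp_all add: coprime_mult_right_iff coprime_commute)
  have "4 * (m1 * m2) < p * (m1 * m2)" using assms by simp
  hence lt: "4 * (m1 * m2) < M" using assms(1) by simp
  have "m1 \<le> m1 * m2" "m2 \<le> m1 * m2" using assms pos_factors_le[of m1 m2] by auto
  hence lt1: "4 * (1 * m1) < M" "4 * (1 * m2) < M" using lt by linarith+
  have p: "0 < m1" "0 < m2" "(0::int) < 1" using assms by simp_all
  have L: "isLat (Lt m1 m1)" "isLat (Lt m2 m2)"
    using Lt_ambiguous(2)[OF M(1) p(1) c(1)] Lt_ambiguous(2)[OF M(2) p(2) c(2)] .
  have sq: "rd (Lt m1 m1) \<otimes>\<^bsub>Cl\<^esub> rd (Lt m1 m1) = \<one>\<^bsub>Cl\<^esub>" "rd (Lt m2 m2) \<otimes>\<^bsub>Cl\<^esub> rd (Lt m2 m2) = \<one>\<^bsub>Cl\<^esub>"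
    using Lt_ambiguous(3)[OF M(1) p(1) c(1)] Lt_ambiguous(3)[OF M(2) p(2) c(2)] L p
    by (simp_all add: Cl_mult_rd rd_scl_Om Cl_simps(3))
  have "rd Om \<noteq> rd (Lt m1 m1)" "rd Om \<noteq> rd (Lt m2 m2)"
    unfolding rd_eq_iff[OF isLat_Om L(1)] rd_eq_iff[OF isLat_Om L(2)]
    using ambiguous_not_sim[OF M(3) p(3) c(3) M(1) p(1) c(1) _ lt1(1)]
      ambiguous_not_sim[OF M(3) p(3) c(3) M(2) p(2) c(2) _ lt1(2)] assms(3,4) by auto
  moreover have "rd (Lt m1 m1) \<noteq> rd (Lt m2 m2)"
    unfolding rd_eq_iff[OF L]
    using ambiguous_not_sim[OF M(1) p(1) c(1) M(2) p(2) c(2) assms(5) lt] assms(4) by auto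
  ultimately have "4 dvd order Cl"
    using sq L finite_RedP rd_RedP by (intro klein_dvd_order[of "rd (Lt m1 m1)" "rd (Lt m2 m2)"]) (auto simp: Cl_simps(1,3))
  thus ?thesis by (simp add: order_def Cl_simps(1))
qed

text \<open>This is Dirichlet composition of \<open>(w, b, w * l)\<close> with itself. The product
  contains \<open>w * tau b\<close> and, from \<open>tau b\<close> squared plus
  \<open>l * w * w\<close>, also \<open>b * tau b\<close>; coprimality combines these to
  \<open>tau b\<close>.\<close>

lemma Lt_square:
  assumes "form (w * w) b l" "0 < w" "coprime w b"
  shows "lmult (Lt w b) (Lt w b) = Lt (w * w) b"
proof
  have e: "4 * (w * w * l) = b * b + M" using assms(1) by (simp add: form_def)
  show "lmult (Lt w b) (Lt w b) \<subseteq> Lt (w * w) b"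
  proof (rule lmult_least[OF subgrp_Lt])
    fix s t assume "s \<in> Lt w b" "t \<in> Lt w b"
    then obtain x y x' y' where s: "s = of_int (x * w) + of_int y * tau b" and t: "t = of_int (x' * w) + of_int y' * tau b"
      by (elim Lt_E)
    have "s * t = of_int (x * w * x' * w) + of_int (x * w * y' + y * x' * w) * tau b + of_int (y * y') * (tau b * tau b)"
      unfolding s t by (simp add: algebra_simps)
    also have "\<dots> = of_int ((x * x' - y * y' * l) * (w * w)) + of_int (x * w * y' + y * x' * w + y * y' * b) * tau b"
      unfolding tau_sq[OF e] by (simp add: algebra_simps)
    finally show "s * t \<in> Lt (w * w) b" by (simp only: Lt_I)
  qed
  let ?P = "lmult (Lt w b) (Lt w b)"
  have g: "subgrp ?P" by (intro subgrp_lmult subgrp_Lt)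
  obtain u v where uv: "u * w + v * b = 1" using bezout_int[of w b] assms(3) by (auto simp: coprime_iff_gcd_eq_1)
  have ww: "of_int w * of_int w \<in> ?P" and wt: "of_int w * tau b \<in> ?P" and tt: "tau b * tau b \<in> ?P"
    by (intro lmult.prod Lt_gen)+
  show "Lt (w * w) b \<subseteq> ?P"
  proof (rule Lt_least[OF g])
    show "of_int (w * w) \<in> ?P" using ww by simp
    have "of_int u * (of_int w * tau b) + of_int v * (tau b * tau b + of_int l * (of_int w * of_int w)) \<in> ?P"
      by (rule subgrp_add[OF g subgrp_of_int_mult[OF g wt] subgrp_of_int_mult[OF g subgrp_add[OF g tt subgrp_of_int_mult[OF g ww]]]])
    also have "of_int u * (of_int w * tau b) + of_int v * (tau b * tau b + of_int l * (of_int w * of_int w))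
        = of_int (u * w + v * b) * tau b"
      unfolding tau_sq[OF e] by (simp add: algebra_simps)
    finally show "tau b \<in> ?P" by (simp add: uv)
  qed
qed

text \<open>With \<open>\<lambda> = X m + Y \<tau>\<close> and \<open>\<mu> = Z m + W \<tau>\<close> a basis of the lattice, multiplication by the conjugate
  of \<open>\<lambda>\<close> maps \<open>\<lambda>\<close> to \<open>m n\<close> and \<open>\<mu>\<close> to \<open>m\<close> times the second generator of \<open>Lt n b\<close>.\<close>

lemma ambiguous_represents:
  assumes "form m m l" "n = m * (X * X) + m * (X * Y) + l * (Y * Y)" "0 < n" "X * W - Y * Z = 1"
    and "b = m + 2 * (m * (X * Z) + m * (Y * Z) + l * (Y * W))"
  shows "form n b (m * (Z * Z) + m * (Z * W) + l * (W * W))" and "sim (Lt m m) (Lt n b)"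
proof -
  have e: "4 * (m * l) = m * m + M" and m: "0 < m" using assms(1) by (simp_all add: form_def)
  have "4 * (n * (m * (Z * Z) + m * (Z * W) + l * (W * W)))
     = (m * (X * W - Y * Z) + 2 * (m * (X * Z) + m * (Y * Z) + l * (Y * W)))
       * (m * (X * W - Y * Z) + 2 * (m * (X * Z) + m * (Y * Z) + l * (Y * W)))
       + (4 * (m * l) - m * m) * ((X * W - Y * Z) * (X * W - Y * Z))"
    unfolding assms(2) by (simp add: algebra_simps)
  also have "\<dots> = b * b + M" unfolding assms(4) unfolding e assms(5) by simp
  finally show "form n b (m * (Z * Z) + m * (Z * W) + l * (W * W))" using assms(3) by (simp add: form_def)
  let ?t = "tau m" and ?lam = "of_int (X * m) + of_int Y * tau m"
  have cl: "cnj ?lam = of_int ((X + Y) * m) - of_int Y * ?t" by (simp add: cnj_tau algebra_simps)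
  have tb: "tau b = ?t + of_int (m * (X * Z) + m * (Y * Z) + l * (Y * W))" unfolding assms(5) by (rule tau_shift)
  have *: "cnj ?lam * (of_int (x * m) + of_int y * ?t) = of_int m * (of_int (p * n) + of_int q * tau b)"
    if "x = p * X + q * Z" "y = p * Y + q * W" for x y p q
  proof -
    have "cnj ?lam * (of_int (x * m) + of_int y * ?t) = of_int ((X + Y) * m * x * m)
        + of_int ((X + Y) * m * y - Y * x * m) * ?t - of_int (Y * y) * (?t * ?t)"
      unfolding cl by (simp add: algebra_simps)
    also have "\<dots> = of_int m * (of_int ((X + Y) * m * x + Y * y * l) + of_int (X * y - Y * x) * ?t)"
      unfolding tau_sq[OF e] by (simp add: algebra_simps)
    also have "X * y - Y * x = q * (X * W - Y * Z)" unfolding that by (simp add: algebra_simps)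
    also have "q * (X * W - Y * Z) = q" unfolding assms(4) by simp
    also have "(X + Y) * m * x + Y * y * l = p * n + q * (m * (X * Z) + m * (Y * Z) + l * (Y * W))"
      unfolding that assms(2) by (simp add: algebra_simps)
    finally show ?thesis unfolding tb by (simp add: algebra_simps)
  qed
  have "scl (cnj ?lam) (Lt m m) = scl (of_int m) (Lt n b)"
  proof
    show "scl (cnj ?lam) (Lt m m) \<subseteq> scl (of_int m) (Lt n b)"
    proof
      fix z assume "z \<in> scl (cnj ?lam) (Lt m m)"
      then obtain x y where z: "z = cnj ?lam * (of_int (x * m) + of_int y * ?t)" by (elim scl_Lt_E)
      have "(x * W - y * Z) * X + (y * X - x * Y) * Z = x * (X * W - Y * Z)"
        "(x * W - y * Z) * Y + (y * X - x * Y) * W = y * (X * W - Y * Z)" by (simp_all add: algebra_simps)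
      hence "x = (x * W - y * Z) * X + (y * X - x * Y) * Z" "y = (x * W - y * Z) * Y + (y * X - x * Y) * W"
        unfolding assms(4) by simp_all
      from *[OF this] show "z \<in> scl (of_int m) (Lt n b)" unfolding z by (simp only: scl_I Lt_I)
    qed
    show "scl (of_int m) (Lt n b) \<subseteq> scl (cnj ?lam) (Lt m m)"
    proof
      fix z assume "z \<in> scl (of_int m) (Lt n b)"
      then obtain p q where z: "z = of_int m * (of_int (p * n) + of_int q * tau b)" by (elim scl_Lt_E)
      show "z \<in> scl (cnj ?lam) (Lt m m)" unfolding z *[OF refl refl, symmetric] by (simp only: scl_I Lt_I)
    qed
  qed
  moreover have "cnj ?lam \<noteq> 0"
  proof
    assume "cnj ?lam = 0"
    hence "of_int (X * m) + of_int Y * tau m = of_int 0 + of_int 0 * tau m" by (simp only: complex_cnj_zero_iff) simp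
    hence "X = 0" "Y = 0" unfolding Lt_unique using m by auto
    thus False using assms(4) by simp
  qed
  ultimately have "sim (Lt m m) (scl (of_int m) (Lt n b))" using sim_scl by metis
  moreover have "sim (scl (of_int m) (Lt n b)) (Lt n b)" using m by (intro sim_sym[OF sim_scl]) simp
  ultimately show "sim (Lt m m) (Lt n b)" by (rule sim_trans)
qed

text \<open>The ambiguous form \<open>(m, m, l)\<close> properly represents \<open>w\<^sup>2\<close>, so it is equivalent to some
  \<open>(w\<^sup>2, b, l')\<close>, the square of \<open>(w, b, w * l')\<close>; the latter has order 4.\<close>

theorem RedP_card_order_four:
  assumes "M = p * m" "4 < p" "1 < m" "coprime p m"
    and "4 * (w * w) = m * ((2 * X + Y) * (2 * X + Y)) + p * (Y * Y)" "0 < w" "coprime X Y" "coprime w M"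
  shows "4 dvd card RedP"
proof -
  interpret comm_group Cl by (rule comm_group_Cl)
  have M: "M = m * p" "M = 1 * M" using assms(1) by (simp_all add: mult_ac)
  have c: "coprime m p" "coprime 1 M" using assms(4) by (simp_all add: coprime_commute)
  have "4 * m < p * m" using assms by simp
  hence lt: "4 * (1 * m) < M" using assms(1) by simp
  have p: "0 < m" "(0::int) < 1" using assms by simp_all
  obtain l where l: "4 * l = m + p" "form m m l" using Lt_ambiguous(1)[OF M(1) p(1) c(1)] by blast
  note L = Lt_ambiguous(2,3)[OF M(1) p(1) c(1)]
  \<comment> \<open>Because \<open>4 * l = m + p\<close>, the assumed representation is four times
    the value of the form \<open>(m, m, l)\<close> at \<open>(X, Y)\<close>.\<close>
  have "4 * (w * w) = 4 * (m * (X * X) + m * (X * Y) + l * (Y * Y))"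
    using assms(5) arg_cong[OF l(1), of "\<lambda>z. z * (Y * Y)"] by (simp add: algebra_simps)
  hence w: "w * w = m * (X * X) + m * (X * Y) + l * (Y * Y)" by simp
  have w0: "0 < w * w" using assms(6) by simp
  obtain u v where "u * X + v * Y = 1" using bezout_int[of X Y] assms(7) by (auto simp: coprime_iff_gcd_eq_1)
  hence det: "X * u - Y * (- v) = 1" by (simp add: algebra_simps)
  \<comment> \<open>The vector \<open>(X, Y)\<close> is completed by \<open>(- v, u)\<close> to a
    unimodular change of variables, and \<open>b\<close> is the middle coefficient of the
    transformed form.\<close>
  define b where "b = m + 2 * (m * (X * - v) + m * (Y * - v) + l * (Y * u))"
  define l' where "l' = m * (- v * - v) + m * (- v * u) + l * (u * u)"
  have f: "form (w * w) b l'" and s: "sim (Lt m m) (Lt (w * w) b)"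
    using ambiguous_represents[OF l(2) w w0 det b_def] by (simp_all add: l'_def)
  have cw: "coprime w b"
  proof (rule coprimeI)
    fix q assume "q dvd w" "q dvd b"
    moreover have "M = w * (4 * (w * l')) - b * b" using f by (simp add: form_def algebra_simps)
    ultimately have "q dvd M" by simp
    thus "is_unit q" using coprime_common_divisor[OF assms(8) \<open>q dvd w\<close>] by blast
  qed
  have f': "form w b (w * l')" using f assms(6) by (simp add: form_def mult.assoc)
  have "gcd w (gcd b (w * l')) = 1"
    using coprime_divisors[OF dvd_refl gcd_dvd1 cw, of "w * l'"] unfolding coprime_iff_gcd_eq_1 .
  hence G: "isLat (Lt w b)" by (rule isLat_gcd[OF f'])
  have sq: "lmult (Lt w b) (Lt w b) = Lt (w * w) b" by (rule Lt_square[OF f assms(6) cw])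
  hence G2: "isLat (Lt (w * w) b)" using isLat_lmult[OF G G] by simp
  have 1: "rd (Lt w b) \<otimes>\<^bsub>Cl\<^esub> rd (Lt w b) = rd (Lt m m)"
    using sim_sym[OF s] L(1) G G2 by (simp add: Cl_mult_rd sq rd_eq_iff)
  have 2: "rd (Lt m m) \<otimes>\<^bsub>Cl\<^esub> rd (Lt m m) = \<one>\<^bsub>Cl\<^esub>"
    using L p by (simp add: Cl_mult_rd rd_scl_Om Cl_simps(3))
  have 3: "rd (Lt m m) \<noteq> \<one>\<^bsub>Cl\<^esub>"
    using ambiguous_not_sim[OF M(2) p(2) c(2) M(1) p(1) c(1) _ lt] assms(3) rd_eq_iff[OF isLat_Om L(1)]
    by (auto simp: Cl_simps(3))
  have "4 dvd order Cl"
    by (rule order_four_dvd_order[of "rd (Lt w b)"]) (use 1 2 3 G finite_RedP rd_RedP in \<open>auto simp: Cl_simps(1)\<close>)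
  thus ?thesis by (simp add: order_def Cl_simps(1))
qed

end

section \<open>Legendre's equation\<close>

lemma QuadRes_square_factor:
  assumes "prime (p::int)" "\<not> p dvd t" "QuadRes p (a * (t * t))"
  shows "QuadRes p a"
proof -
  obtain y where y: "[y\<^sup>2 = a * (t * t)] (mod p)" using assms(3) by (auto simp: QuadRes_def)
  have "coprime t p" using prime_imp_coprime[OF assms(1,2)] by (simp add: coprime_commute)
  then obtain s where s: "[t * s = 1] (mod p)" using cong_solve_coprime_int by blast
  have "[(s * y)\<^sup>2 = s\<^sup>2 * (a * (t * t))] (mod p)"
    unfolding power_mult_distrib using y by (rule cong_scalar_left)
  also have "s\<^sup>2 * (a * (t * t)) = a * ((t * s) * (t * s))" by (simp add: power2_eq_square mult_ac)
  also have "[\<dots> = a * (1 * 1)] (mod p)" using s by (intro cong_scalar_left cong_mult)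
  finally show ?thesis unfolding QuadRes_def by (intro exI[of _ "s * y"]) simp
qed

lemma prime_dvd_square_iff: "prime (p::int) \<Longrightarrow> p dvd x * x \<longleftrightarrow> p dvd x"
  by (simp add: prime_dvd_mult_iff)

lemma prime_ne_square: "prime (p::int) \<Longrightarrow> r * r \<noteq> p"
proof
  assume p: "prime p" and e: "r * r = p"
  hence "p dvd r" using prime_dvd_square_iff[OF p, of r] by simp
  then obtain k where "r = p * k" by (elim dvdE)
  hence "p * (p * k * k) = p * 1" using e by (simp add: algebra_simps)
  hence "p * (k * k) = 1" using p by (simp add: mult_ac)
  hence "p dvd 1" by (metis dvd_triv_left)
  thus False using p by (metis not_prime_unit)
qed

lemma prime_product_ne_square:
  assumes "prime (p::int)" "prime (l::int)" "p \<noteq> l" shows "r * r \<noteq> p * l"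
proof
  assume e: "r * r = p * l"
  hence "p dvd r" using prime_dvd_square_iff[OF assms(1), of r] by simp
  then obtain k where "r = p * k" by (elim dvdE)
  hence "p * (p * k * k) = p * l" using e by (simp add: algebra_simps)
  hence "p * (k * k) = l" using assms(1) by (simp add: mult_ac)
  hence "p dvd l" by (metis dvd_triv_left)
  thus False using primes_dvd_imp_eq[OF assms(1,2)] assms(3) by simp
qed

lemma square_less_of_abs_le:
  fixes x r :: int assumes "\<bar>x\<bar> \<le> r" "r * r \<le> n" "r * r \<noteq> n" shows "x * x < n"
proof -
  have "\<bar>x\<bar> * \<bar>x\<bar> \<le> r * r" using assms(1) by (intro mult_mono) auto
  thus ?thesis using assms(2,3) by simp
qed

text \<open>The pigeonhole principle yields small \<open>x, y, z\<close>, not all zero, with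
  \<open>px\<^sup>2 + ly\<^sup>2 - z\<^sup>2\<close> equal to \<open>0\<close> or \<open>pl\<close>; the second value is converted into a solution by
  \<open>p(xz + ly)\<^sup>2 + l(yz - px)\<^sup>2 = (z\<^sup>2 + pl)\<^sup>2\<close>.\<close>

lemma legendre_equation:
  fixes p l :: int
  assumes p: "prime p" and l: "prime l" and ne: "p \<noteq> l" and pl: "QuadRes l p" and lp: "QuadRes p l"
  shows "\<exists>a b c. (a,b) \<noteq> (0,0) \<and> c * c = p * (a * a) + l * (b * b)"
proof -
  obtain \<alpha> where \<alpha>: "[\<alpha>\<^sup>2 = p] (mod l)" using pl by (auto simp: QuadRes_def)
  obtain \<beta> where \<beta>: "[\<beta>\<^sup>2 = l] (mod p)" using lp by (auto simp: QuadRes_def)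
  have p0: "0 < p" and l0: "0 < l" using p l prime_gt_0_int by auto
  obtain r where r: "0 \<le> r" "r * r \<le> l" "l < (r + 1) * (r + 1)" using ex_floor_sqrt[of l] l0 by auto
  obtain s where s: "0 \<le> s" "s * s \<le> p" "p < (s + 1) * (s + 1)" using ex_floor_sqrt[of p] p0 by auto
  obtain t where t: "0 \<le> t" "t * t \<le> p * l" "p * l < (t + 1) * (t + 1)" using ex_floor_sqrt[of "p * l"] p0 l0 by auto
  let ?S = "{0..r} \<times> {0..s} \<times> {0..t}" and ?T = "{0..<l} \<times> {0..<p}"
  let ?f = "\<lambda>(u,v,w). ((w - \<alpha> * u) mod l, (w - \<beta> * v) mod p)"
  \<comment> \<open>There must be more triples than pairs of residues. The upper bounds defining
    \<open>r\<close>, \<open>s\<close> and \<open>t\<close> multiply to the square of that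
    inequality.\<close>
  have "(p * l) * (p * l) < ((r + 1) * (s + 1) * (t + 1)) * ((r + 1) * (s + 1) * (t + 1))"
  proof -
    have h: "l * p < ((r + 1) * (r + 1)) * ((s + 1) * (s + 1))"
      by (rule mult_strict_mono[OF r(3) s(3)]) (use r(1) p0 in simp_all)
    have "0 < l * p" using l0 p0 by simp
    hence "(l * p) * (p * l) < (((r + 1) * (r + 1)) * ((s + 1) * (s + 1))) * ((t + 1) * (t + 1))"
      using p0 l0 by (intro mult_strict_mono[OF h t(3)] order_less_trans[OF _ h]) simp_all
    thus ?thesis by (simp only: mult_ac)
  qed
  hence lt: "p * l < (r + 1) * (s + 1) * (t + 1)"
    using mult_mono[of "(r + 1) * (s + 1) * (t + 1)" "p * l" "(r + 1) * (s + 1) * (t + 1)" "p * l"] r s t p0 l0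
    by (meson add_nonneg_nonneg linorder_not_le mult_nonneg_nonneg order_less_imp_le zero_le_one)
  have "card (?f ` ?S) \<le> card ?T" using p0 l0 by (intro card_mono) auto
  also have "\<dots> = nat (p * l)" using p0 l0 by (simp add: card_cartesian_product nat_mult_distrib mult.commute)
  also have "\<dots> < nat ((r + 1) * (s + 1) * (t + 1))" using lt p0 l0 by (simp add: zless_nat_eq_int_zless)
  also have "\<dots> = card ?S" using r s t by (simp add: card_cartesian_product nat_mult_distrib mult.assoc)
  finally have "\<not> inj_on ?f ?S" by (rule pigeonhole)
  then obtain P Q where PQ: "P \<in> ?S" "Q \<in> ?S" "P \<noteq> Q" "?f P = ?f Q" by (auto simp: inj_on_def)
  obtain u v w u' v' w' where P: "P = (u,v,w)" and Q: "Q = (u',v',w')" by (cases P; cases Q)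
  define x y z where xyz: "x = u - u'" "y = v - v'" "z = w - w'"
  have b: "\<bar>x\<bar> \<le> r" "\<bar>y\<bar> \<le> s" "\<bar>z\<bar> \<le> t" and nz: "x \<noteq> 0 \<or> y \<noteq> 0 \<or> z \<noteq> 0"
    using PQ(1-3) by (auto simp: P Q xyz)
  have "l dvd (w - \<alpha> * u) - (w' - \<alpha> * u')" "p dvd (w - \<beta> * v) - (w' - \<beta> * v')"
    using PQ(4) by (simp_all add: P Q mod_eq_dvd_iff)
  hence d: "l dvd z - \<alpha> * x" "p dvd z - \<beta> * y" by (simp_all add: xyz algebra_simps)
  define N where "N = p * (x * x) + l * (y * y) - z * z"
  have "l dvd N"
  proof -
    have "l dvd p - \<alpha>\<^sup>2" using \<alpha> by (simp add: cong_iff_dvd_diff dvd_diff_commute)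
    hence "l dvd (p - \<alpha>\<^sup>2) * (x * x) + l * (y * y) - (z - \<alpha> * x) * (z + \<alpha> * x)" using d(1) by simp
    also have "\<dots> = N" by (simp add: N_def power2_eq_square algebra_simps)
    finally show ?thesis .
  qed
  moreover have "p dvd N"
  proof -
    have "p dvd l - \<beta>\<^sup>2" using \<beta> by (simp add: cong_iff_dvd_diff dvd_diff_commute)
    hence "p dvd (l - \<beta>\<^sup>2) * (y * y) + p * (x * x) - (z - \<beta> * y) * (z + \<beta> * y)" using d(2) by simp
    also have "\<dots> = N" by (simp add: N_def power2_eq_square algebra_simps)
    finally show ?thesis .
  qed
  moreover have "coprime p l" using p l ne by (rule primes_coprime)
  ultimately have "p * l dvd N" by (intro divides_mult)
  then obtain k where k: "N = p * l * k" by (elim dvdE)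
  \<comment> \<open>Primes and products of two distinct primes are not squares, so the bounds are
    strict; this confines \<open>N\<close> strictly between \<open>- p * l\<close> and
    \<open>2 * p * l\<close>.\<close>
  have "x * x < l" "y * y < p" "z * z < p * l"
    using square_less_of_abs_le[OF b(1) r(2) prime_ne_square[OF l]]
      square_less_of_abs_le[OF b(2) s(2) prime_ne_square[OF p]]
      square_less_of_abs_le[OF b(3) t(2) prime_product_ne_square[OF p l ne]] .
  hence "p * (x * x) < p * l" "l * (y * y) < p * l" "z * z < p * l"
    using p0 l0 by (simp_all add: mult.commute[of p l])
  moreover have "0 \<le> p * (x * x)" "0 \<le> l * (y * y)" "0 \<le> z * z" using p0 l0 by simp_all
  ultimately have "p * l * (- 1) < p * l * k" "p * l * k < p * l * 2" unfolding k[symmetric] N_def by linarith+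
  hence "- 1 < k" "k < 2" using p0 l0 by (simp_all only: mult_less_cancel_left_pos mult_pos_pos)
  hence "k = 0 \<or> k = 1" by linarith
  thus ?thesis
  proof
    assume "k = 0"
    hence e: "z * z = p * (x * x) + l * (y * y)" using k by (simp add: N_def)
    moreover have "(x,y) \<noteq> (0,0)" using e nz by auto
    ultimately show ?thesis by blast
  next
    assume "k = 1"
    hence e: "p * (x * x) + l * (y * y) = z * z + p * l" using k by (simp add: N_def)
    have "p * ((x * z + l * y) * (x * z + l * y)) + l * ((y * z - p * x) * (y * z - p * x))
        = (z * z + p * l) * (p * (x * x) + l * (y * y))" by (simp add: algebra_simps)
    hence q: "(z * z + p * l) * (z * z + p * l)
        = p * ((x * z + l * y) * (x * z + l * y)) + l * ((y * z - p * x) * (y * z - p * x))" unfolding e by simp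
    have "0 < p * l" "0 \<le> z * z" using p0 l0 by simp_all
    hence "z * z + p * l \<noteq> 0" by linarith
    hence "(x * z + l * y, y * z - p * x) \<noteq> (0,0)" using q by auto
    thus ?thesis using q by blast
  qed
qed

lemma make_coprime:
  fixes p n V U W :: int
  assumes "W * W = p * (V * V) + n * (U * U)" "(V,U) \<noteq> (0,0)"
  shows "\<exists>g V' U' W'. V = V' * g \<and> U = U' * g \<and> coprime V' U' \<and> W' * W' = p * (V' * V') + n * (U' * U')"
proof -
  define g where "g = gcd V U"
  have g: "g \<noteq> 0" using assms(2) by (simp add: g_def)
  obtain V' U' where VU: "V = V' * g" "U = U' * g" "coprime V' U'"
    using gcd_coprime_exists[of V U] g unfolding g_def by blast
  have "W * W = (g * g) * (p * (V' * V') + n * (U' * U'))" unfolding assms(1) VU by (simp add: algebra_simps)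
  hence "g\<^sup>2 dvd W\<^sup>2" by (simp add: power2_eq_square)
  hence "g dvd W" by simp
  then obtain W' where W': "W = g * W'" by (elim dvdE)
  have "(g * g) * (W' * W') = (g * g) * (p * (V' * V') + n * (U' * U'))"
    using assms(1) unfolding VU W' by (simp add: algebra_simps)
  hence "W' * W' = p * (V' * V') + n * (U' * U')" using g by simp
  with VU show ?thesis by blast
qed

text \<open>\<open>W'\<close> and \<open>V'\<close> are the coordinates of a power of \<open>W + V \<surd>p\<close>; the last conjunct is the invariant
  that keeps \<open>V'\<close> prime to \<open>l\<close>.\<close>

lemma norm_equation_power:
  fixes p l V U W :: int
  assumes "prime l" "odd l" "\<not> l dvd p" "\<not> l dvd V" "W * W = p * (V * V) + l * (U * U)"
  shows "\<exists>W' V'. W' * W' = p * (V' * V') + (l * (U * U)) ^ Suc j \<and> \<not> l dvd V' \<and> l dvd W * V' - V * W'"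
proof (induction j)
  case 0
  thus ?case using assms by (intro exI[of _ W] exI[of _ V]) (simp add: mult.commute)
next
  case (Suc j)
  then obtain W' V' where h: "W' * W' = p * (V' * V') + (l * (U * U)) ^ Suc j" "\<not> l dvd V'" "l dvd W * V' - V * W'" by blast
  have lW: "\<not> l dvd W"
  proof
    assume "l dvd W"
    hence "l dvd W * W - l * (U * U)" by simp
    hence "l dvd p * (V * V)" unfolding assms(5) by simp
    thus False using assms(1,3,4) by (simp add: prime_dvd_mult_iff)
  qed
  have "\<not> l dvd 2"
  proof
    assume "l dvd 2"
    hence "l \<le> 2" by (simp add: zdvd_imp_le)
    hence "l = 2" using prime_gt_1_int[OF assms(1)] by simp
    thus False using assms(2) by simp
  qed
  define W'' V'' where d: "W'' = W * W' + p * (V * V')" "V'' = W * V' + V * W'"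
  have "W'' * W'' - p * (V'' * V'') = (W * W - p * (V * V)) * (W' * W' - p * (V' * V'))"
    unfolding d by (simp add: algebra_simps)
  hence "W'' * W'' = p * (V'' * V'') + (l * (U * U)) ^ Suc (Suc j)" unfolding h(1) assms(5) by simp
  moreover have "\<not> l dvd V''"
  proof
    assume "l dvd V''"
    hence "l dvd V'' + (W * V' - V * W')" using h(3) by (rule dvd_add)
    also have "V'' + (W * V' - V * W') = 2 * (W * V')" unfolding d by simp
    finally show False using \<open>\<not> l dvd 2\<close> lW h(2) assms(1) by (simp add: prime_dvd_mult_iff)
  qed
  moreover have "l dvd W * V'' - V * W''"
  proof -
    have "W * V'' - V * W'' = (W * W - p * (V * V)) * V'" unfolding d by (simp add: algebra_simps)
    also have "\<dots> = l * (U * U * V')" unfolding assms(5) by simp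
    finally show ?thesis by simp
  qed
  ultimately show ?case by blast
qed

lemma square_mod4: "(x::int) * x mod 4 = (if even x then 0 else 1)"
proof (cases "even x")
  case True
  thus ?thesis by (auto elim!: evenE)
next
  case False
  then obtain b where "x = 2 * b + 1" by (elim oddE)
  hence "x * x = 1 + 4 * (b * b + b)" by (simp add: algebra_simps)
  hence "x * x mod 4 = 1 mod 4" by (simp only: mod_mult_self2)
  thus ?thesis using False by simp
qed

lemma add_3_mult_mod4: "(x + 3 * y) mod 4 = (x mod 4 + 3 * (y mod 4)) mod (4::int)"
  by presburger

text \<open>Raising a solution of Legendre's equation for \<open>l\<close> to the power
  \<open>e\<close> gives \<open>W^2 = p V^2 + m U^2\<close>, where the invariant of
  \<open>norm_equation_power\<close> keeps \<open>W\<close> prime to \<open>l\<close>. Modulo 4,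
  \<open>V\<close> must be odd. For odd \<open>U\<close> the number \<open>W\<close> is even, and
  \<open>w = W / 2\<close>, \<open>Y = V\<close> works up to sign; for even \<open>U\<close> the
  solution is doubled, with \<open>w = W\<close> and \<open>Y = 2 V\<close>.\<close>

lemma represents_square:
  fixes p l :: int
  assumes p: "prime p" "p mod 4 = 1" and l: "prime l" "p \<noteq> l" and m: "m = l ^ e" "odd e" "m mod 4 = 3"
    and qr: "QuadRes l p" "QuadRes p l"
  shows "\<exists>w X Y. 0 < w \<and> coprime X Y \<and> coprime w (p * m)
     \<and> 4 * (w * w) = m * ((2 * X + Y) * (2 * X + Y)) + p * (Y * Y)"
proof -
  have e0: "e \<noteq> 0" using m(2) by (cases e) auto
  have "odd m" using m(3) by presburger
  hence "odd l" using e0 by (simp add: m(1))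
  have lp: "\<not> l dvd p" "\<not> p dvd l" using primes_dvd_imp_eq[OF l(1) p(1)] primes_dvd_imp_eq[OF p(1) l(1)] l(2) by auto
  obtain V0 U0 W0 where 0: "(V0,U0) \<noteq> (0,0)" "W0 * W0 = p * (V0 * V0) + l * (U0 * U0)"
    using legendre_equation[OF p(1) l qr] by blast
  obtain V1 U1 W1 where 1: "coprime V1 U1" "W1 * W1 = p * (V1 * V1) + l * (U1 * U1)"
    using make_coprime[OF 0(2,1)] by blast
  have V1: "\<not> l dvd V1"
  proof
    assume v: "l dvd V1"
    hence "l dvd W1 * W1" unfolding 1(2) by simp
    hence w: "l dvd W1" using l(1) by (simp add: prime_dvd_square_iff)
    obtain v' w' where vw: "V1 = l * v'" "W1 = l * w'" using v w by (elim dvdE)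
    have "l * (U1 * U1) = l * (l * (w' * w' - p * (v' * v')))"
      using 1(2) unfolding vw by (simp add: algebra_simps)
    hence "U1 * U1 = l * (w' * w' - p * (v' * v'))" using l(1) by (simp only: mult_cancel_left) auto
    hence "l dvd U1 * U1" by simp
    hence "l dvd U1" using l(1) by (simp add: prime_dvd_square_iff)
    thus False using coprime_common_divisor[OF 1(1) v] not_prime_unit l(1) by blast
  qed
  obtain j where j: "e = Suc j" using e0 by (cases e) auto
  obtain W2 V2 where 2: "W2 * W2 = p * (V2 * V2) + (l * (U1 * U1)) ^ e" "\<not> l dvd V2"
    using norm_equation_power[OF l(1) \<open>odd l\<close> lp(1) V1 1(2), of j] unfolding j by blast
  have "(l * (U1 * U1)) ^ e = m * (U1 ^ e * U1 ^ e)" by (simp add: m(1) power_mult_distrib)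
  hence 3: "W2 * W2 = p * (V2 * V2) + m * (U1 ^ e * U1 ^ e)" using 2(1) by simp
  have "(V2, U1 ^ e) \<noteq> (0,0)" using 2(2) by auto
  then obtain g V U W where 4: "V2 = V * g" "coprime V U" "W * W = p * (V * V) + m * (U * U)"
    using make_coprime[OF 3] by blast
  have lV: "\<not> l dvd V" using 2(2) by (auto simp: 4(1))
  have lW: "\<not> l dvd W"
  proof
    assume "l dvd W"
    moreover have "l dvd m" using e0 by (simp add: m(1))
    ultimately have "l dvd W * W - m * (U * U)" by simp
    hence "l dvd p * (V * V)" unfolding 4(3) by simp
    thus False using l(1) lp lV by (simp add: prime_dvd_mult_iff)
  qed
  have pm: "\<not> p dvd m" using lp(2) prime_dvd_power[OF p(1)] by (auto simp: m(1))
  have pW: "\<not> p dvd W"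
  proof
    assume w: "p dvd W"
    hence "p dvd W * W - p * (V * V)" by simp
    hence "p dvd m * (U * U)" unfolding 4(3) by simp
    hence u: "p dvd U" using p(1) pm by (simp add: prime_dvd_mult_iff)
    obtain u' w' where uw: "U = p * u'" "W = p * w'" using u w by (elim dvdE)
    have "p * (V * V) = p * (p * (w' * w' - m * (u' * u')))"
      using 4(3) unfolding uw by (simp add: algebra_simps)
    hence "V * V = p * (w' * w' - m * (u' * u'))" using p(1) by (simp only: mult_cancel_left) auto
    hence "p dvd V * V" by simp
    hence "p dvd V" using p(1) by (simp add: prime_dvd_square_iff)
    thus False using coprime_common_divisor[OF 4(2) _ u] not_prime_unit p(1) by blast
  qed
  have "coprime W p" "coprime W l"
    using prime_imp_coprime[OF p(1) pW] prime_imp_coprime[OF l(1) lW] by (simp_all add: coprime_commute)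
  hence cW: "coprime W (p * m)" by (simp add: m(1) coprime_mult_right_iff)
  have W0: "W \<noteq> 0" using pW by auto
  have mod4: "W * W mod 4 = (V * V mod 4 + 3 * (U * U mod 4)) mod 4"
  proof -
    have "p = 1 + 4 * (p div 4)" "m = 3 + 4 * (m div 4)"
      using mult_div_mod_eq[of 4 p] mult_div_mod_eq[of 4 m] p(2) m(3) by linarith+
    then obtain a b where ab: "p = 1 + 4 * a" "m = 3 + 4 * b" by blast
    have "W * W = (V * V + 3 * (U * U)) + 4 * (a * (V * V) + b * (U * U))"
      unfolding 4(3) ab by (simp add: algebra_simps)
    thus ?thesis by (simp only: mod_mult_self2 add_3_mult_mod4[of "V * V"])
  qed
  have "odd V"
  proof
    assume v: "even V"
    hence "odd U" using 4(2) coprime_common_divisor_int[of V U 2] by auto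
    hence "W * W mod 4 = 3" using mod4 v by (simp add: square_mod4)
    thus False by (simp add: square_mod4 split: if_splits)
  qed
  show ?thesis
  proof (cases "odd U")
    case True
    hence "even W" using mod4 \<open>odd V\<close> by (simp add: square_mod4 split: if_splits)
    then obtain w where w: "W = 2 * w" by (elim evenE)
    have "even (U - V)" using True \<open>odd V\<close> by simp
    then obtain X where X: "U - V = 2 * X" by (elim evenE)
    have U: "U = 2 * X + V" using X by simp
    have "coprime X V"
    proof (rule coprimeI)
      fix q assume q: "q dvd X" "q dvd V"
      hence "q dvd U" unfolding U by simp
      thus "is_unit q" using coprime_common_divisor[OF 4(2) q(2)] by blast
    qed
    moreover have "coprime \<bar>w\<bar> (p * m)" using cW by (simp add: w)
    moreover have "4 * (\<bar>w\<bar> * \<bar>w\<bar>) = m * ((2 * X + V) * (2 * X + V)) + p * (V * V)"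
      using 4(3) unfolding w U by simp
    moreover have "0 < \<bar>w\<bar>" using W0 w by simp
    ultimately show ?thesis by blast
  next
    case False
    have "coprime (U - V) (2 * V)"
    proof (rule coprimeI)
      fix q assume q: "q dvd U - V" "q dvd 2 * V"
      have "odd (U - V)" using False \<open>odd V\<close> by simp
      hence "odd q" using q(1) dvd_trans by blast
      hence "coprime q 2" by simp
      hence qV: "q dvd V" using q(2) by (simp add: coprime_dvd_mult_right_iff)
      hence "q dvd (U - V) + V" using q(1) by (intro dvd_add)
      hence "q dvd U" by simp
      thus "is_unit q" using coprime_common_divisor[OF 4(2) qV] by blast
    qed
    moreover have "coprime \<bar>W\<bar> (p * m)" using cW by simp
    moreover have "4 * (\<bar>W\<bar> * \<bar>W\<bar>) = m * ((2 * (U - V) + 2 * V) * (2 * (U - V) + 2 * V)) + p * ((2 * V) * (2 * V))"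
      using 4(3) by (simp add: algebra_simps)
    moreover have "0 < \<bar>W\<bar>" using W0 by simp
    ultimately show ?thesis by blast
  qed
qed

section \<open>Divisibility of the number of reduced forms by 4\<close>

lemma mod4_mult_1: assumes "(a::int) mod 4 = 1" shows "a * b mod 4 = b mod 4"
proof -
  have "a = 1 + 4 * (a div 4)" using mult_div_mod_eq[of 4 a] assms by linarith
  then obtain c where c: "a = 1 + 4 * c" by blast
  have "a * b = b + 4 * (c * b)" unfolding c by (simp add: algebra_simps)
  thus ?thesis by (simp only: mod_mult_self2)
qed

text \<open>As \<open>p\<close> is 1 modulo 4, the sign in quadratic reciprocity is
  positive.\<close>

lemma QuadRes_prime_swap:
  fixes p l :: int
  assumes "prime p" "p mod 4 = 1" "prime l" "odd l" "p \<noteq> l" "QuadRes p l"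
  shows "QuadRes l p"
proof -
  have pr: "prime (nat p)" "prime (nat l)" using assms(1,3) unfolding prime_int_nat_transfer by blast+
  have gt: "2 < p" "2 < l" using assms(2,4) prime_gt_1_int[OF assms(1)] prime_gt_1_int[OF assms(3)] by presburger+
  have c: "(p - 1) div 2 = 2 * ((p - 1) div 4)" using assms(2) by presburger
  have "Legendre p l * Legendre l p = (- 1) ^ nat ((p - 1) div 2 * ((l - 1) div 2))"
    using pr gt assms(5) by (intro Quadratic_Reciprocity_int)
  also have "even (nat ((p - 1) div 2 * ((l - 1) div 2)))" 
    unfolding c mult.assoc using gt by (subst even_nat_iff) simp_all
  hence "(- 1 :: int) ^ nat ((p - 1) div 2 * ((l - 1) div 2)) = 1" by simp
  finally have "Legendre p l * Legendre l p = 1" .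
  moreover have "\<not> p dvd l" using primes_dvd_imp_eq[OF assms(1,3)] assms(5) by auto
  hence "Legendre l p = 1" using assms(6) by (simp add: Legendre_def cong_0_iff)
  ultimately have "Legendre p l = 1" by simp
  thus ?thesis by (simp add: Legendre_def split: if_splits)
qed

context three_mod_four begin

text \<open>A full prime power \<open>l ^ e\<close> is split off from \<open>m\<close>. A cofactor
  \<open>t > 1\<close> yields two coprime ambiguous divisors. Otherwise \<open>e\<close> is odd,
  because a square is never 3 modulo 4; then \<open>m\<close> is \<open>l\<close> times a square,
  and \<open>l\<close> is a residue modulo \<open>p\<close> along with \<open>m\<close>.\<close>

theorem RedP_card_dvd:
  assumes p: "prime p" "p mod 4 = 1" and M: "M = p * m" and pm: "\<not> p dvd m" and qr: "QuadRes p m"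
  shows "4 dvd card RedP"
proof -
  have p4: "4 < p" using p(2) prime_gt_1_int[OF p(1)] by presburger
  have m0: "0 < m" using M M_pos p4 by (simp add: zero_less_mult_iff)
  have m4: "m mod 4 = 3" using mod4_mult_1[OF p(2), of m] M_mod4 M by simp
  have "m \<noteq> 0" "\<not> is_unit m" using m0 m4 by auto
  then obtain l where l: "l dvd m" "prime l" using prime_divisor_exists by blast
  define e where "e = multiplicity l m"
  obtain t where t: "m = l ^ e * t" "\<not> l dvd t" using multiplicity_decompose'[of m l] l m0 unfolding e_def
    by (metis less_irrefl not_prime_unit)
  have e0: "e \<noteq> 0" using t l(1) by (cases e) auto
  have l1: "1 < l" using prime_gt_1_int[OF l(2)] .
  have le: "1 < l ^ e" using l1 e0 by (simp add: one_less_power)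
  have t0: "0 < t" using m0 le l1 unfolding t(1) by (simp add: zero_less_mult_iff)
  have "odd m" using m4 by presburger
  hence "odd l" using l(1) dvd_trans by blast
  have ple: "p \<noteq> l" using l(1) pm by auto
  show ?thesis
  proof (cases "t = 1")
    case True
    hence m: "m = l ^ e" using t by simp
    have "odd e"
    proof
      assume "even e"
      then obtain f where "e = 2 * f" by (elim evenE)
      hence "m = l ^ f * l ^ f" unfolding m by (simp add: power_add[symmetric] mult_2)
      thus False using m4 square_mod4[of "l ^ f"] by (simp split: if_splits)
    qed
    then obtain f where f: "e = 2 * f + 1" by (elim oddE)
    have mf: "m = l * (l ^ f * l ^ f)" unfolding m f by (simp add: power_add[symmetric] mult_2)
    have "\<not> p dvd l ^ f" using pm unfolding mf by auto
    hence ql: "QuadRes p l" using QuadRes_square_factor[OF p(1)] qr unfolding mf by blast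
    have "QuadRes l p" by (rule QuadRes_prime_swap[OF p l(2) \<open>odd l\<close> ple ql])
    from represents_square[OF p l(2) ple m \<open>odd e\<close> m4 this ql]
    obtain w X Y where h: "0 < w" "coprime X Y" "coprime w (p * m)"
      "4 * (w * w) = m * ((2 * X + Y) * (2 * X + Y)) + p * (Y * Y)" by (elim exE conjE)
    show ?thesis
      using h M p4 le m prime_imp_coprime[OF p(1) pm] by (intro RedP_card_order_four[of p m w X Y]) auto
  next
    case False
    have ct: "coprime (l ^ e) t" using prime_imp_coprime[OF l(2) t(2)] by simp
    have "\<not> p dvd l ^ e" "\<not> p dvd t" using pm unfolding t(1) by auto
    thus ?thesis
      using False t0 le p4 ct M unfolding t(1)
      by (intro RedP_card_klein[of p "l ^ e" t] prime_imp_coprime[OF p(1)]) auto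
  qed
qed

text \<open>Dividing a form by its content \<open>y\<close> gives a primitive reduced form of
  discriminant \<open>- M / y^2\<close>, and multiplying by \<open>y\<close> goes back. As
  \<open>y\<close> is odd, \<open>M / y^2\<close> is again 3 modulo 4, so the class group is
  available for each content.\<close>

lemma Red_card_dvd:
  assumes "\<And>f M0. M = f * f * M0 \<Longrightarrow> three_mod_four M0 \<Longrightarrow> 4 dvd card (three_mod_four.RedP M0)"
  shows "4 dvd card Red"
proof -
  define g where "g = (\<lambda>(k::int,b::int,l::int). gcd k (gcd b l))"
  have "card Red = (\<Sum>y\<in>g ` Red. card {x \<in> Red. g x = y})"
    using sum.image_gen[OF finite_Red, of "\<lambda>_. 1::nat" g] by simp
  moreover have "4 dvd card {x \<in> Red. g x = y}" if "y \<in> g ` Red" for y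
  proof -
    from that obtain k b l where kbl: "(k,b,l) \<in> Red" "y = gcd k (gcd b l)" by (auto simp: g_def)
    have h: "0 < k" "4 * (k * l) = b * b + M" using kbl(1) by (auto simp: Red_def form_def)
    have y0: "0 < y" using h(1) kbl(2) by simp
    have "y dvd k" "y dvd b" "y dvd l" unfolding kbl(2) by (auto intro: dvd_trans[OF gcd_dvd2])
    then obtain k' b' l' where d: "k = y * k'" "b = y * b'" "l = y * l'" by (elim dvdE)
    define M0 where "M0 = 4 * (k' * l') - b' * b'"
    have e: "M = y * y * M0" using h(2) unfolding d M0_def by (simp add: algebra_simps)
    have "odd M" using M_mod4 by presburger
    hence "odd y" unfolding e by simp
    hence "y * y mod 4 = 1" by (simp add: square_mod4)
    hence "M0 mod 4 = 3" using mod4_mult_1[of "y * y" M0] M_mod4 e by simp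
    moreover have "0 < M0" using M_pos y0 unfolding e by (simp add: zero_less_mult_iff)
    ultimately have N: "three_mod_four M0" by unfold_locales
    interpret N: three_mod_four M0 by (rule N)
    have form_iff: "form (y * k) (y * b) (y * l) \<longleftrightarrow> N.form k b l" for k b l
    proof -
      have "4 * (y * k * (y * l)) = y * b * (y * b) + M \<longleftrightarrow> y * y * (4 * (k * l)) = y * y * (b * b + M0)"
        unfolding e by (simp add: algebra_simps)
      also have "\<dots> \<longleftrightarrow> 4 * (k * l) = b * b + M0" using y0 by simp
      finally show ?thesis using y0 by (simp add: form_def N.form_def zero_less_mult_iff)
    qed
    have mem: "(y * k, y * b, y * l) \<in> Red \<and> g (y * k, y * b, y * l) = y \<longleftrightarrow> (k,b,l) \<in> N.RedP" for k b l
    proof -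
      have "gcd (y * k) (gcd (y * b) (y * l)) = y * gcd k (gcd b l)"
        using y0 by (simp add: gcd_mult_left)
      moreover have "y * gcd k (gcd b l) = y \<longleftrightarrow> gcd k (gcd b l) = 1" using y0 by simp
      moreover have "- (y * k) < y * b \<longleftrightarrow> - k < b" using y0 mult_less_cancel_left_pos[of y "- k" b] by simp
      ultimately show ?thesis
        using y0 by (simp add: Red_def N.RedP_def form_iff g_def zero_less_mult_iff mult_le_cancel_left_pos)
    qed
    have "card {x \<in> Red. g x = y} = card N.RedP"
    proof (rule card_eq_by_inverse[of _ "\<lambda>(k,b,l). (k div y, b div y, l div y)" _ "\<lambda>(k,b,l). (y * k, y * b, y * l)"])
      fix x assume x: "x \<in> {x \<in> Red. g x = y}"
      obtain k b l where x': "x = (k,b,l)" by (cases x)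
      have "gcd k (gcd b l) = y" using x by (simp add: x' g_def)
      hence "y dvd k" "y dvd b" "y dvd l" by (auto intro: dvd_trans[OF gcd_dvd2])
      then obtain k' b' l' where d: "k = y * k'" "b = y * b'" "l = y * l'" by (elim dvdE)
      have "(k',b',l') \<in> N.RedP" using mem[of k' b' l'] x unfolding x' d by simp
      thus "(\<lambda>(k,b,l). (k div y, b div y, l div y)) x \<in> N.RedP \<and>
        (\<lambda>(k,b,l). (y * k, y * b, y * l)) ((\<lambda>(k,b,l). (k div y, b div y, l div y)) x) = x"
        using y0 by (simp add: x' d)
    next
      fix x assume x: "x \<in> N.RedP"
      obtain k b l where x': "x = (k,b,l)" by (cases x)
      show "(\<lambda>(k,b,l). (y * k, y * b, y * l)) x \<in> {x \<in> Red. g x = y} \<and>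
        (\<lambda>(k,b,l). (k div y, b div y, l div y)) ((\<lambda>(k,b,l). (y * k, y * b, y * l)) x) = x"
        using mem[of k b l] x y0 unfolding x' by simp
    qed
    thus ?thesis using assms[OF e N] by simp
  qed
  ultimately show ?thesis by (simp add: dvd_sum)
qed

text \<open>The substitution \<open>(t, p, q) = (b, 2 * k - b, 2 * l - b)\<close> turns
  \<open>4 * k * l - b * b\<close> into \<open>t * p + p * q + q * t\<close>. Reduced forms off the
  boundary come in mirror pairs with \<open>b\<close> and \<open>- b\<close>, whence the factor 2.
  On the boundary \<open>M\<close> factors, as \<open>k * (4 * l - k)\<close> for
  \<open>b = k\<close> and as \<open>(2 * k - b) * (2 * k + b)\<close> for
  \<open>k = l\<close>.\<close>

lemma card_Red: "card Red = 2 * card Trip + card PW"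
proof -
  let ?A = "{(k,b,l) \<in> Red. 0 < b \<and> b < k \<and> k < l}" and ?B = "{(k,b,l) \<in> Red. b < 0 \<and> k < l}"
    and ?C = "{(k,b,l) \<in> Red. b = k \<or> k = l}"
  have f: "finite ?A" "finite ?B" "finite ?C" by (rule finite_subset[OF _ finite_Red]; auto)+
  have R: "Red = ?A \<union> (?B \<union> ?C)"
  proof (rule Set.set_eqI)
    fix x :: "int \<times> int \<times> int"
    obtain k b l where x: "x = (k,b,l)" by (cases x)
    have "0 < b \<and> b < k \<and> k < l \<or> b < 0 \<and> k < l \<or> b = k \<or> k = l" if "(k,b,l) \<in> Red"
    proof -
      have "b \<noteq> 0" "b \<le> k" "k \<le> l" using form_odd[of k b l] that by (auto simp: Red_def)
      thus ?thesis by linarith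
    qed
    thus "x \<in> Red \<longleftrightarrow> x \<in> ?A \<union> (?B \<union> ?C)" unfolding x by blast
  qed
  have d: "?B \<inter> ?C = {}" "?A \<inter> (?B \<union> ?C) = {}" by (auto simp: Red_def form_def)
  have A: "card ?A = card Trip"
  proof (rule card_eq_by_inverse[of _ "\<lambda>(k,b,l). (b, 2 * k - b, 2 * l - b)" _ "\<lambda>(t,p,q). ((t + p) div 2, t, (t + q) div 2)"])
    fix x assume "x \<in> ?A"
    then obtain k b l where x: "x = (k,b,l)" and h: "0 < b" "b < k" "k < l" "form k b l" by (auto simp: Red_def)
    have "odd b" by (rule form_odd[OF h(4)])
    moreover have "b * (2 * k - b) + (2 * k - b) * (2 * l - b) + (2 * l - b) * b = M"
      using h(4) by (simp add: form_def algebra_simps)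
    ultimately show "(\<lambda>(k,b,l). (b, 2 * k - b, 2 * l - b)) x \<in> Trip \<and> (\<lambda>(t,p,q). ((t + p) div 2, t, (t + q) div 2))
      ((\<lambda>(k,b,l). (b, 2 * k - b, 2 * l - b)) x) = x" using h by (simp add: x Trip_def)
  next
    fix x assume "x \<in> Trip"
    then obtain t p q where x: "x = (t,p,q)" and h: "odd t" "odd p" "odd q" "0 < t" "t < p" "p < q"
      "t * p + p * q + q * t = M" by (auto simp: Trip_def)
    have "even (t + p)" "even (t + q)" using h by simp_all
    then obtain k l where kl: "t + p = 2 * k" "t + q = 2 * l" by (elim evenE)
    have pq: "p = 2 * k - t" "q = 2 * l - t" using kl by simp_all
    have "form k t l" using h(4,5,7) unfolding pq form_def by (simp add: algebra_simps)
    thus "(\<lambda>(t,p,q). ((t + p) div 2, t, (t + q) div 2)) x \<in> ?A \<and>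
      (\<lambda>(k,b,l). (b, 2 * k - b, 2 * l - b)) ((\<lambda>(t,p,q). ((t + p) div 2, t, (t + q) div 2)) x) = x"
      using h(4-6) kl by (simp add: x Red_def pq)
  qed
  have B: "card ?B = card ?A"
    by (rule card_eq_by_inverse[of _ "\<lambda>(k,b,l). (k,-b,l)" _ "\<lambda>(k,b,l). (k,-b,l)"]) (auto simp: Red_def form_def)
  let ?f = "\<lambda>(k::int,b,l). if b = k then (k, 2 * l - k) else (2 * k - b, b)"
  \<comment> \<open>The case \<open>b = k\<close> produces \<open>a \<le> w\<close> and the case
    \<open>k = l\<close> with \<open>b < k\<close> produces \<open>a > w\<close>, so comparing
    \<open>a\<close> with \<open>w\<close> recovers the type; \<open>a = w\<close> is the form with
    \<open>k = b = l\<close>.\<close>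
  let ?g = "\<lambda>(a::int,w). if a \<le> w then (a, a, (a + w) div 2) else ((a + w) div 2, w, (a + w) div 2)"
  have C: "card ?C = card PW"
  proof (rule card_eq_by_inverse[of _ ?f _ ?g])
    fix x assume "x \<in> ?C"
    then obtain k b l where x: "x = (k,b,l)" and h: "b = k \<or> k = l" "k \<le> l" "b \<le> k" "k = l \<longrightarrow> 0 < b" "0 < k"
      "4 * (k * l) = b * b + M" by (auto simp: Red_def form_def)
    show "?f x \<in> PW \<and> ?g (?f x) = x"
    proof (cases "b = k")
      case True
      thus ?thesis using h by (simp add: x PW_def algebra_simps)
    next
      case False
      thus ?thesis using h by (auto simp: x PW_def algebra_simps)
    qed
  next
    fix x assume "x \<in> PW"
    then obtain a w where x: "x = (a,w)" and aw: "(a,w) \<in> PW" by (cases x) auto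
    have h: "0 < a" "0 < w" "a * (a + 2 * w) = M" using aw by (simp_all add: PW_def)
    have "even (a + w)" using PW_odd[OF aw] by simp
    then obtain k where k: "a + w = 2 * k" by (elim evenE)
    have w: "w = 2 * k - a" using k by simp
    show "?g x \<in> ?C \<and> ?f (?g x) = x"
      using h unfolding x w by (auto simp: Red_def form_def algebra_simps)
  qed
  have "card Red = card ?A + (card ?B + card ?C)"
    using card_Un_disjoint[OF f(1) finite_UnI[OF f(2,3)] d(2)] card_Un_disjoint[OF f(2,3) d(1)] by (simp only: R[symmetric])
  thus ?thesis unfolding B A C by simp
qed

end

lemma combine_mod4:
  fixes a t b :: nat
  assumes "even (a + t)" "4 dvd 2 * t + b"
  shows "[int b + 2 * int a = 0] (mod 4)"
proof -
  have "4 dvd b + 2 * a" using assms by presburger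
  hence "4 dvd int (b + 2 * a)" by presburger
  thus ?thesis by (simp add: cong_0_iff)
qed

theorem theorem3p6:
  fixes p \<delta> k n :: int
  assumes "prime p" and "odd p" and "\<not> [p = 3] (mod 4)"
    and "[4 * \<delta> = 1] (mod p\<^sup>2)"
    and "Legendre k p = 1"
  shows "[N_V1 (p\<^sup>2 * n + (p * k + 1) * \<delta>) = 0] (mod 4)"
proof -
  define N where "N = p\<^sup>2 * n + (p * k + 1) * \<delta>"
  have p4: "p mod 4 = 1" using assms(2,3) unfolding cong_def by presburger
  have p5: "4 < p" using p4 prime_gt_1_int[OF assms(1)] by presburger
  obtain c where "4 * \<delta> - 1 = p\<^sup>2 * c" using assms(4) by (auto simp: cong_iff_dvd_diff elim: dvdE)
  hence c: "4 * \<delta> = 1 + p * p * c" by (simp add: power2_eq_square)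
  \<comment> \<open>Replacing \<open>4 * \<delta>\<close> by \<open>1 + p * p * c\<close> in
    \<open>4 * N\<close> makes \<open>p\<close> split off from \<open>4 * N - 1\<close>; this is the
    cofactor, visibly congruent to \<open>k\<close> modulo \<open>p\<close>.\<close>
  define m where "m = k + p * (4 * n + c * (p * k + 1))"
  have "4 * N = 4 * (p * p * n) + (p * k + 1) * (4 * \<delta>)" by (simp add: N_def power2_eq_square algebra_simps)
  hence M: "4 * N - 1 = p * m" unfolding c m_def by (simp add: algebra_simps)
  have k: "\<not> p dvd k" "QuadRes p k" using assms(5) by (auto simp: Legendre_def cong_0_iff split: if_splits)
  have pm: "\<not> p dvd m" using k(1) unfolding m_def by (simp add: dvd_add_left_iff)
  have qm: "QuadRes p m" using k(2) unfolding QuadRes_def m_def cong_def by simp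
  consider "N < 0" | "N = 0" | "0 < N" by linarith
  hence "[N_V1 N = 0] (mod 4)"
  proof cases
    case 1
    thus ?thesis by (simp add: N_V1_def)
  next
    case 2
    hence "p dvd - 1" using M by (metis diff_0 dvd_triv_left mult_zero_right)
    thus ?thesis using p5 zdvd_imp_le[of p 1] by simp
  next
    case 3
    interpret three_mod_four "4 * N - 1"
      using 3 by unfold_locales presburger+
    \<comment> \<open>The prime \<open>p\<close> divides \<open>4 * N - 1\<close> exactly once,
      whereas it divides three times a square to an even power, since \<open>p\<close> is not
      3.\<close>
    have sq: "4 * N - 1 \<noteq> 3 * x * x" for x
    proof
      assume e: "4 * N - 1 = 3 * x * x"
      hence "p dvd 3 * (x * x)" using M by (metis dvd_triv_left mult.assoc)
      moreover have "\<not> p dvd 3" using p5 zdvd_imp_le[of p 3] by auto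
      ultimately have "p dvd x" using assms(1) by (simp add: prime_dvd_mult_iff)
      then obtain y where "x = p * y" by (elim dvdE)
      hence "p * m = p * (p * (3 * (y * y)))" using e unfolding M by (simp add: mult_ac)
      hence "m = p * (3 * (y * y))" using p5 by simp
      thus False using pm by simp
    qed
    have "4 dvd card Red"
    proof (rule Red_card_dvd)
      fix f M0 assume e: "4 * N - 1 = f * f * M0" and N: "three_mod_four M0"
      \<comment> \<open>A square factor \<open>f * f\<close> cannot absorb \<open>p\<close>, so
        \<open>p\<close> passes to \<open>M0\<close>. The remaining cofactors satisfy
        \<open>m = m0 * (f * f)\<close>, and \<open>m0\<close> is a residue modulo \<open>p\<close>
        because \<open>m\<close> is.\<close>
      have pf: "\<not> p dvd f"
      proof
        assume "p dvd f"
        then obtain y where "f = p * y" by (elim dvdE)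
        hence "p * m = p * (p * (y * y * M0))" using e unfolding M by (simp add: mult_ac)
        hence "m = p * (y * y * M0)" using p5 by simp
        thus False using pm by simp
      qed
      have "p dvd f * f * M0" unfolding e[symmetric] M by simp
      hence "p dvd M0" using pf assms(1) by (simp add: prime_dvd_mult_iff)
      then obtain m0 where m0: "M0 = p * m0" by (elim dvdE)
      have "p * m = p * (m0 * (f * f))" using e unfolding M m0 by (simp add: mult_ac)
      hence m: "m = m0 * (f * f)" using p5 by simp
      have "\<not> p dvd m0" "QuadRes p m0"
        using pm qm QuadRes_square_factor[OF assms(1) pf, of m0] unfolding m by auto
      thus "4 dvd card (three_mod_four.RedP M0)"
        by (rule three_mod_four.RedP_card_dvd[OF N assms(1) p4 m0])
    qed
    hence R: "4 dvd 2 * card Trip + card PW" unfolding card_Red .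
    hence "even (card PW)" by presburger
    hence "even (card {(a,b,c,l) \<in> Quad. odd c} + card Trip)" by (rule Quad_Trip_parity[OF sq])
    from combine_mod4[OF this R]
    have "[int (card PW) + 2 * int (card {(a,b,c,l) \<in> Quad. odd c}) = 0] (mod 4)" .
    thus ?thesis using N_V1_mod4[OF refl] cong_trans by blast
  qed
  thus ?thesis by (simp only: N_def)
qed

end
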